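(* Let $I\subseteq\mathbb{R}$ be an open interval, $\kappa:I\to\mathbb{R}$ continuous, $c(t,t_0),s(t,t_0)$ the solutions of $\ddot u+\kappa u=0$ with $c(t_0,t_0)=\dot s(t_0,t_0)=1$, $s(t_0,t_0)=\dot c(t_0,t_0)=0$, and $U(t,t_0)$ the unitary evolution operator on $L^2(\mathbb{R},dq)$ generated by $H(t)=\tfrac12(P^2+\kappa(t)Q^2)$ (with $Q$ multiplication by $q$, $P=-i\,d/dq$, $U(t_0,t_0)=\mathbb I$, $\partial_tU=-iH(t)U$). For $\omega>0$ and $n\in\mathbb N_0$ let $$\phi^\omega_n(q)=\frac{\omega^{1/4}}{\sqrt{2^nn!\sqrt\pi}}e^{-\omega q^2/2}H_n(\sqrt\omega\,q),$$ with $H_n$ the Hermite polynomials. For $(t,t_0)\in I\times I$ with $s(t,t_0)\neq0$ define $$\Lambda=\begin{bmatrix}\omega-i\dfrac{c(t,t_0)}{s(t,t_0)}&\dfrac{i}{s(t,t_0)}\\[2mm] \dfrac{i}{s(t,t_0)}&\omega-i\dfrac{c(t_0,t)}{s(t,t_0)}\end{bmatrix}.$$ Then $U(t,t_0)\phi^\omega_0=\sum_{n\in\mathbb N_0}\langle\phi^\omega_{2n}|U(t,t_0)\phi^\omega_0\rangle\,\phi^\omega_{2n}$ (in particular, the components along $\phi^\omega_{2n+1}$ vanish), where for $n\in\mathbb N$ $$\langle\phi^\omega_{2n}|U(t,t_0)\phi^\omega_0\rangle=\frac{\sqrt{(2n)!}}{2^nn!}\big(2\omega(\Lambda^{-1})_{22}-1\big)^n\langle\phi^\omega_0|U(t,t_0)\phi^\omega_0\rangle,$$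 $$\langle\phi^\omega_0|U(t,t_0)\phi^\omega_0\rangle=\sqrt{\frac{2\omega}{\det\Lambda}}\,e^{-i\pi/4}\,s^{-1/2}(t,t_0),$$ and $$(\Lambda^{-1})_{22}=\frac{\omega s^2(t,t_0)-is(t,t_0)c(t,t_0)}{1+\omega^2s^2(t,t_0)-c(t,t_0)c(t_0,t)-i\omega s(t,t_0)\big(c(t,t_0)+c(t_0,t)\big)}.$$
   Context: $s^{-1/2}(t,t_0):=\exp\big(-\tfrac{i\pi}{2}\mathfrak m(s;t,t_0)\big)|s(t,t_0)|^{-1/2}$, where $\mathfrak m(s;t,t_0)\in\mathbb Z$ is the index function of $s(\cdot,t_0)$: $\mathfrak m(s;t_0,t_0)=0$ and $\mathfrak m(s;t_2,t_0)-\mathfrak m(s;t_1,t_0)$ is the number of zeros of $s(\cdot,t_0)$ in $(t_1,t_2]$ for $t_1<t_2$. Dots are derivatives in the first argument. *)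

theory Defs
  imports "HOL-Analysis.Analysis"
begin

definition lin_sol :: "(real \<Rightarrow> real) \<Rightarrow> real set \<Rightarrow> (real \<Rightarrow> real) \<Rightarrow> bool" where
  "lin_sol \<kappa> I u \<longleftrightarrow> (\<exists>u'. \<forall>t\<in>I. (u has_real_derivative u' t) (at t)
                                  \<and> (u' has_real_derivative (- \<kappa> t * u t)) (at t))"

text \<open>Index function m(s;t,t0): m(s;t0,t0) = 0 and m(s;t2,t0) - m(s;t1,t0) is the
  number of zeros of s(.,t0) in (t1,t2] for t1 < t2.\<close>
definition index_fn :: "(real \<Rightarrow> real \<Rightarrow> real) \<Rightarrow> real \<Rightarrow> real \<Rightarrow> int" where
  "index_fn s t t0 =
     (if t0 \<le> t then int (card {\<tau>. t0 < \<tau> \<and> \<tau> \<le> t \<and> s \<tau> t0 = 0})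
      else - int (card {\<tau>. t < \<tau> \<and> \<tau> \<le> t0 \<and> s \<tau> t0 = 0}))"

definition s_inv_sqrt :: "(real \<Rightarrow> real \<Rightarrow> real) \<Rightarrow> real \<Rightarrow> real \<Rightarrow> complex" where
  "s_inv_sqrt s t t0 = cis (- pi / 2 * real_of_int (index_fn s t t0)) * complex_of_real (\<bar>s t t0\<bar> powr (-1/2))"

fun hermite :: "nat \<Rightarrow> real \<Rightarrow> real" where
  "hermite 0 x = 1"
| "hermite (Suc 0) x = 2 * x"
| "hermite (Suc (Suc n)) x = 2 * x * hermite (Suc n) x - 2 * real (Suc n) * hermite n x"

definition hermite_fn :: "real \<Rightarrow> nat \<Rightarrow> real \<Rightarrow> complex" where
  "hermite_fn \<omega> n q = complex_of_real
     (\<omega> powr (1/4) / sqrt (2 ^ n * fact n * sqrt pi) * exp (- \<omega> * q\<^sup>2 / 2) * hermite n (sqrt \<omega> * q))"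

section \<open>L^2(R, dq), represented by functions real => complex (modulo a.e. equality)\<close>

definition sq_int :: "(real \<Rightarrow> complex) \<Rightarrow> bool" where
  "sq_int f \<longleftrightarrow> f \<in> borel_measurable lborel \<and> integrable lborel (\<lambda>q. (cmod (f q))\<^sup>2)"

definition l2_inner :: "(real \<Rightarrow> complex) \<Rightarrow> (real \<Rightarrow> complex) \<Rightarrow> complex" where
  "l2_inner f g = (LINT q|lborel. cnj (f q) * g q)"

definition l2_norm :: "(real \<Rightarrow> complex) \<Rightarrow> real" where
  "l2_norm f = sqrt (LINT q|lborel. (cmod (f q))\<^sup>2)"

fun vderiv_iter :: "nat \<Rightarrow> (real \<Rightarrow> complex) \<Rightarrow> real \<Rightarrow> complex" where
  "vderiv_iter 0 f = f"
| "vderiv_iter (Suc k) f = (\<lambda>x. vector_derivative (vderiv_iter k f) (at x))"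

definition schwartz :: "(real \<Rightarrow> complex) \<Rightarrow> bool" where
  "schwartz f \<longleftrightarrow> (\<forall>k x. vderiv_iter k f differentiable (at x))
      \<and> (\<forall>a k. \<exists>B. \<forall>x. \<bar>x\<bar> ^ a * cmod (vderiv_iter k f x) \<le> B)"

definition twice_diff :: "(real \<Rightarrow> complex) \<Rightarrow> bool" where
  "twice_diff f \<longleftrightarrow> (\<forall>x. f differentiable (at x) \<and> vderiv_iter 1 f differentiable (at x))"

definition ham :: "(real \<Rightarrow> real) \<Rightarrow> real \<Rightarrow> (real \<Rightarrow> complex) \<Rightarrow> real \<Rightarrow> complex" where
  "ham \<kappa> t \<psi> q = (1/2) * (- vderiv_iter 2 \<psi> q + complex_of_real (\<kappa> t * q\<^sup>2) * \<psi> q)"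

definition unitary_L2 :: "((real \<Rightarrow> complex) \<Rightarrow> (real \<Rightarrow> complex)) \<Rightarrow> bool" where
  "unitary_L2 V \<longleftrightarrow> (\<forall>f. sq_int f \<longrightarrow> sq_int (V f))
     \<and> (\<forall>f g. sq_int f \<longrightarrow> sq_int g \<longrightarrow> l2_inner (V f) (V g) = l2_inner f g)
     \<and> (\<forall>g. sq_int g \<longrightarrow> (\<exists>f. sq_int f \<and> l2_norm (\<lambda>q. V f q - g q) = 0))"

definition is_evolution :: "(real \<Rightarrow> real) \<Rightarrow> real set
     \<Rightarrow> (real \<Rightarrow> real \<Rightarrow> (real \<Rightarrow> complex) \<Rightarrow> (real \<Rightarrow> complex)) \<Rightarrow> bool" where
  "is_evolution \<kappa> I U \<longleftrightarrow>
     (\<forall>t\<in>I. \<forall>t0\<in>I. unitary_L2 (U t t0))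
   \<and> (\<forall>t0\<in>I. \<forall>f. sq_int f \<longrightarrow> l2_norm (\<lambda>q. U t0 t0 f q - f q) = 0)
   \<and> (\<forall>t0\<in>I. \<forall>\<phi>. schwartz \<phi> \<longrightarrow> (\<forall>t\<in>I.
          twice_diff (U t t0 \<phi>) \<and> sq_int (ham \<kappa> t (U t t0 \<phi>))
        \<and> ((\<lambda>h. l2_norm (\<lambda>q. (U (t + h) t0 \<phi> q - U t t0 \<phi> q) / complex_of_real h
                              + \<i> * ham \<kappa> t (U t t0 \<phi>) q)) \<longlongrightarrow> 0)
            (at 0 within {h. t + h \<in> I})))"

definition Lam :: "real \<Rightarrow> (real \<Rightarrow> real \<Rightarrow> real) \<Rightarrow> (real \<Rightarrow> real \<Rightarrow> real) \<Rightarrow> real \<Rightarrow> real \<Rightarrow> complex^2^2" where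
  "Lam \<omega> c s t t0 = vector
     [vector [complex_of_real \<omega> - \<i> * c t t0 / s t t0, \<i> / s t t0],
      vector [\<i> / s t t0, complex_of_real \<omega> - \<i> * c t0 t / s t t0]]"

end

theory Submission
  imports Defs "HOL-Probability.Distributions" "HOL-Real_Asymp.Real_Asymp"
begin

text \<open>
  The evolved ground state is a Gaussian. With \<open>z = c + i \<omega> s\<close> (at \<open>(\<cdot>, t0)\<close>) and
  \<open>p = - (i/2) z'/z\<close>, the packet \<open>\<psi>\<^sub>t(q) = const \<cdot> A(t) exp (- p(t) q\<^sup>2)\<close> with \<open>A' = - i p A\<close> solves the
  Schroedinger equation and has norm 1, because \<open>A\<^sup>2 z = 1\<close> and \<open>Re p = \<omega> / (2 |z|\<^sup>2)\<close>. Integration by parts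
  against a Gaussian shows that \<open>\<langle>\<psi>\<^sub>t, U(t,t0) \<phi>\<^sub>0\<rangle>\<close> does not depend on \<open>t\<close>; it is 1 at \<open>t0\<close>, and both
  vectors have norm 1, so they agree. The Hermite recurrence gives the coefficients of a Gaussian
  up to the ground-state overlap \<open>a\<close>. Differentiating in \<open>t\<close> gives \<open>a\<^sup>2 D = 2 \<omega>\<close> with
  \<open>D = \<omega> z - i z' = i s det \<Lambda>\<close>. The branch of \<open>a\<close> is settled by continuity: the formula with the index
  function extends continuously over the zeros of \<open>s\<close>, its quotient with \<open>a\<close> is a fourth root of
  unity, hence constant, and it is 1 at \<open>t0\<close>. Convergence of the expansion is Parseval's identity, which
  is the binomial series of \<open>(1 - |r|\<^sup>2)\<close> to the power \<open>-1/2\<close>.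
\<close>


section \<open>Square-integrable functions\<close>

text \<open>The obstacle is how little \<open>is_evolution\<close> says about the evolved state: it
  is twice differentiable, it and its image under \<open>ham\<close> are square integrable, and the
  equation holds in norm. No decay of its derivative is given, so symmetry of the Hamiltonian is
  proved with a Gaussian in one slot, whose decay kills the boundary terms. The second difficulty is
  the complex square roots. Amplitude and overlap are introduced without choosing a root, as the
  exponential of an integral and as an inner product; their squares then come from conserved
  quantities. Since the determinant of \<Lambda> blows up at the zeros of \<open>s\<close>, the
  branch is followed on \<open>2 \<omega> / D\<close>, which is continuous and nonvanishing on
  \<open>I\<close>. At a zero of \<open>s\<close> the Wronskian forces its real part to have the
  sign of the derivative of \<open>s\<close>, and this makes the one-sided limits agree. The base of
  the powers in the coefficients is the Cayley transform
  \<open>(\<omega> - 2 p) / (\<omega> + 2 p)\<close>; it has modulus below 1 because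
  \<open>p\<close> has positive real part, so the binomial series converges.\<close>

lemma sq_int_norm_mult:
  assumes "sq_int f" "sq_int g"
  shows "integrable lborel (\<lambda>q. cmod (f q) * cmod (g q))"
proof (rule Bochner_Integration.integrable_bound)
  show "integrable lborel (\<lambda>q. (cmod (f q))\<^sup>2 + (cmod (g q))\<^sup>2)"
    using assms by (auto simp: sq_int_def)
  have [measurable]: "f \<in> borel_measurable lborel" "g \<in> borel_measurable lborel"
    using assms by (auto simp: sq_int_def)
  show "(\<lambda>q. cmod (f q) * cmod (g q)) \<in> borel_measurable lborel" by measurable
  have "cmod (f q) * cmod (g q) \<le> (cmod (f q))\<^sup>2 + (cmod (g q))\<^sup>2" for q
    using sum_squares_bound[of "cmod (f q)" "cmod (g q)"]
      mult_nonneg_nonneg[OF norm_ge_zero[of "f q"] norm_ge_zero[of "g q"]] by linarith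
  then show "AE q in lborel. norm (cmod (f q) * cmod (g q)) \<le> norm ((cmod (f q))\<^sup>2 + (cmod (g q))\<^sup>2)"
    by (intro AE_I2) (simp add: abs_mult)
qed

lemma sq_int_inner:
  assumes "sq_int f" "sq_int g"
  shows "integrable lborel (\<lambda>q. cnj (f q) * g q)"
proof (rule Bochner_Integration.integrable_bound[OF sq_int_norm_mult[OF assms]])
  have [measurable]: "f \<in> borel_measurable lborel" "g \<in> borel_measurable lborel"
    using assms by (auto simp: sq_int_def)
  have [measurable]: "(\<lambda>q. cnj (f q)) \<in> borel_measurable lborel"
    by (rule measurable_compose[where N=borel, OF _ borel_measurable_continuous_onI]) (auto intro: continuous_intros)
  show "(\<lambda>q. cnj (f q) * g q) \<in> borel_measurable lborel" by measurable
qed (simp add: norm_mult)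

lemma sq_int_add:
  assumes "sq_int f" "sq_int g"
  shows "sq_int (\<lambda>q. f q + g q)"
proof -
  have [measurable]: "f \<in> borel_measurable lborel" "g \<in> borel_measurable lborel"
    using assms by (auto simp: sq_int_def)
  have "integrable lborel (\<lambda>q. (cmod (f q + g q))\<^sup>2)"
  proof (rule Bochner_Integration.integrable_bound)
    show "integrable lborel (\<lambda>q. (cmod (f q))\<^sup>2 + 2 * (cmod (f q) * cmod (g q)) + (cmod (g q))\<^sup>2)"
      using assms sq_int_norm_mult[OF assms] by (auto simp: sq_int_def)
    have "(cmod (f q + g q))\<^sup>2 \<le> (cmod (f q) + cmod (g q))\<^sup>2" for q
      by (intro power_mono norm_triangle_ineq) simp
    then show "AE q in lborel. norm ((cmod (f q + g q))\<^sup>2) \<le> norm ((cmod (f q))\<^sup>2 + 2 * (cmod (f q) * cmod (g q)) + (cmod (g q))\<^sup>2)"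
      by (intro AE_I2) (simp add: power2_sum algebra_simps)
  qed measurable
  then show ?thesis by (simp add: sq_int_def)
qed

lemma sq_int_cmult: "sq_int f \<Longrightarrow> sq_int (\<lambda>q. a * f q)"
  by (auto simp: sq_int_def norm_mult power_mult_distrib)

lemma sq_int_diff: "sq_int f \<Longrightarrow> sq_int g \<Longrightarrow> sq_int (\<lambda>q. f q - g q)"
  using sq_int_add[of f "\<lambda>q. -1 * g q"] sq_int_cmult[of g "-1"] by simp

lemma sq_int_sum: "(\<And>i. i \<in> A \<Longrightarrow> sq_int (f i)) \<Longrightarrow> sq_int (\<lambda>q. \<Sum>i\<in>A. f i q)"
  by (induction A rule: infinite_finite_induct) (auto intro: sq_int_add simp: sq_int_def[of "\<lambda>q. 0"])

lemma l2_norm_nonneg [simp]: "0 \<le> l2_norm f"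
  by (simp add: l2_norm_def)

lemma l2_norm_power2: "(l2_norm f)\<^sup>2 = (LINT q|lborel. (cmod (f q))\<^sup>2)"
  by (simp add: l2_norm_def)

text \<open>The quadratic in \<open>x\<close> obtained by integrating the square of
  \<open>x |f| + |g|\<close> is never negative, so its discriminant is not positive. Working with
  moduli serves both the bound on \<open>l2_inner\<close> and the triangle inequality.\<close>

lemma l2_Cauchy_Schwarz_norms:
  assumes "sq_int f" "sq_int g"
  shows "(LINT q|lborel. cmod (f q) * cmod (g q)) \<le> l2_norm f * l2_norm g"
proof -
  define a b P where "a = (l2_norm f)\<^sup>2" and "b = (l2_norm g)\<^sup>2"
    and "P = (LINT q|lborel. cmod (f q) * cmod (g q))"
  note int = assms[unfolded sq_int_def] sq_int_norm_mult[OF assms]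
  have quad: "0 \<le> x\<^sup>2 * a + 2 * x * P + b" for x
  proof -
    have "0 \<le> (LINT q|lborel. (x * cmod (f q) + cmod (g q))\<^sup>2)" by simp
    also have "\<dots> = (LINT q|lborel. x\<^sup>2 * (cmod (f q))\<^sup>2 + 2 * x * (cmod (f q) * cmod (g q)) + (cmod (g q))\<^sup>2)"
      by (intro Bochner_Integration.integral_cong) (auto simp: power2_eq_square algebra_simps)
    also have "\<dots> = x\<^sup>2 * a + 2 * x * P + b"
      using int unfolding a_def b_def P_def l2_norm_power2 by simp
    finally show ?thesis .
  qed
  have "P\<^sup>2 \<le> a * b"
  proof (cases "a = 0")
    case True
    have "P = 0"
    proof (rule ccontr)
      assume "P \<noteq> 0"
      \<comment> \<open>With \<open>a = 0\<close> the quadratic is the linear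
        \<open>2 x P + b\<close>; at this \<open>x\<close> it equals -1.\<close>
      then show False using quad[of "-(b+1)/(2*P)"] True by (simp add: field_simps)
    qed
    then show ?thesis using True by simp
  next
    case False
    then have "a > 0" by (simp add: a_def)
    \<comment> \<open>The minimiser of the quadratic.\<close>
    with quad[of "-P/a"] show ?thesis
      by (simp add: field_simps power2_eq_square)
  qed
  then have "P\<^sup>2 \<le> (l2_norm f * l2_norm g)\<^sup>2"
    by (simp add: a_def b_def power_mult_distrib)
  then show ?thesis
    unfolding P_def[symmetric] by (rule power2_le_imp_le) simp
qed

lemma l2_Cauchy_Schwarz:
  assumes "sq_int f" "sq_int g"
  shows "cmod (l2_inner f g) \<le> l2_norm f * l2_norm g"
proof -
  have "cmod (l2_inner f g) \<le> (LINT q|lborel. cmod (cnj (f q) * g q))"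
    unfolding l2_inner_def by (rule integral_norm_bound)
  also have "\<dots> \<le> l2_norm f * l2_norm g"
    using l2_Cauchy_Schwarz_norms[OF assms] by (simp add: norm_mult)
  finally show ?thesis .
qed

lemma l2_norm_triangle:
  assumes "sq_int f" "sq_int g"
  shows "l2_norm (\<lambda>q. f q + g q) \<le> l2_norm f + l2_norm g"
proof (rule power2_le_imp_le)
  note int = assms[unfolded sq_int_def] sq_int_norm_mult[OF assms]
  have "(l2_norm (\<lambda>q. f q + g q))\<^sup>2
      \<le> (LINT q|lborel. (cmod (f q))\<^sup>2 + 2 * (cmod (f q) * cmod (g q)) + (cmod (g q))\<^sup>2)"
    unfolding l2_norm_power2
  proof (rule integral_mono)
    show "integrable lborel (\<lambda>q. (cmod (f q + g q))\<^sup>2)"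
      using sq_int_add[OF assms] by (simp add: sq_int_def)
    show "integrable lborel (\<lambda>q. (cmod (f q))\<^sup>2 + 2 * (cmod (f q) * cmod (g q)) + (cmod (g q))\<^sup>2)"
      using int by simp
    have "(cmod (f q + g q))\<^sup>2 \<le> (cmod (f q) + cmod (g q))\<^sup>2" for q
      by (intro power_mono norm_triangle_ineq) simp
    then show "(cmod (f q + g q))\<^sup>2 \<le> (cmod (f q))\<^sup>2 + 2 * (cmod (f q) * cmod (g q)) + (cmod (g q))\<^sup>2" for q
      by (simp add: power2_sum algebra_simps)
  qed
  also have "\<dots> = (l2_norm f)\<^sup>2 + 2 * (LINT q|lborel. cmod (f q) * cmod (g q)) + (l2_norm g)\<^sup>2"
    using int by (simp add: l2_norm_power2)
  also have "\<dots> \<le> (l2_norm f)\<^sup>2 + 2 * (l2_norm f * l2_norm g) + (l2_norm g)\<^sup>2"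
    using l2_Cauchy_Schwarz_norms[OF assms] by simp
  finally show "(l2_norm (\<lambda>q. f q + g q))\<^sup>2 \<le> (l2_norm f + l2_norm g)\<^sup>2"
    by (simp add: power2_sum algebra_simps)
qed simp

lemma l2_inner_add_left:
  "sq_int f \<Longrightarrow> sq_int g \<Longrightarrow> sq_int h \<Longrightarrow> l2_inner (\<lambda>q. f q + g q) h = l2_inner f h + l2_inner g h"
  unfolding l2_inner_def using sq_int_inner by (simp add: ring_distribs)

lemma l2_inner_add_right:
  "sq_int f \<Longrightarrow> sq_int g \<Longrightarrow> sq_int h \<Longrightarrow> l2_inner h (\<lambda>q. f q + g q) = l2_inner h f + l2_inner h g"
  unfolding l2_inner_def using sq_int_inner by (simp add: ring_distribs)

lemma l2_inner_diff_left:
  "sq_int f \<Longrightarrow> sq_int g \<Longrightarrow> sq_int h \<Longrightarrow> l2_inner (\<lambda>q. f q - g q) h = l2_inner f h - l2_inner g h"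
  unfolding l2_inner_def using sq_int_inner by (simp add: left_diff_distrib)

lemma l2_inner_diff_right:
  "sq_int f \<Longrightarrow> sq_int g \<Longrightarrow> sq_int h \<Longrightarrow> l2_inner h (\<lambda>q. f q - g q) = l2_inner h f - l2_inner h g"
  unfolding l2_inner_def using sq_int_inner by (simp add: right_diff_distrib)

lemma l2_inner_cmult_left: "l2_inner (\<lambda>q. a * f q) g = cnj a * l2_inner f g"
  unfolding l2_inner_def by (simp add: mult.assoc)

lemma l2_inner_cmult_right: "l2_inner f (\<lambda>q. a * g q) = a * l2_inner f g"
proof -
  have "cnj (f q) * (a * g q) = a * (cnj (f q) * g q)" for q by simp
  then show ?thesis unfolding l2_inner_def by (simp only: integral_mult_right_zero)
qed

lemma l2_inner_sum_right:
  assumes "\<And>i. i \<in> A \<Longrightarrow> sq_int (f i)" "sq_int g"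
  shows "l2_inner g (\<lambda>q. \<Sum>i\<in>A. f i q) = (\<Sum>i\<in>A. l2_inner g (f i))"
  using assms unfolding l2_inner_def
  by (simp add: sum_distrib_left Bochner_Integration.integral_sum sq_int_inner)

lemma l2_inner_cnj: "l2_inner g f = cnj (l2_inner f g)"
  unfolding l2_inner_def by (subst Bochner_Integration.integral_cnj[symmetric]) (simp add: mult.commute)

lemma l2_inner_self: "l2_inner f f = complex_of_real ((l2_norm f)\<^sup>2)"
proof -
  have "l2_inner f f = (LINT q|lborel. complex_of_real ((cmod (f q))\<^sup>2))"
    unfolding l2_inner_def by (simp only: complex_norm_square mult.commute)
  then show ?thesis by (simp only: l2_norm_power2 integral_complex_of_real)
qed

lemma l2_norm_eq_0_AE:
  assumes "sq_int f" "l2_norm f = 0"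
  shows "AE q in lborel. f q = 0"
proof -
  have "(LINT q|lborel. (cmod (f q))\<^sup>2) = 0"
    using assms by (simp add: l2_norm_power2[symmetric])
  then have "AE q in lborel. (cmod (f q))\<^sup>2 = 0"
    using assms by (subst (asm) integral_nonneg_eq_0_iff_AE) (auto simp: sq_int_def)
  then show ?thesis by simp
qed

section \<open>Curves differentiable in the L2 norm\<close>

definition has_l2_derivative :: "(real \<Rightarrow> real \<Rightarrow> complex) \<Rightarrow> (real \<Rightarrow> complex) \<Rightarrow> real \<Rightarrow> bool" where
  "has_l2_derivative f f' t \<longleftrightarrow>
     ((\<lambda>h. l2_norm (\<lambda>q. (f (t + h) q - f t q) / complex_of_real h - f' q)) \<longlongrightarrow> 0) (at 0)"

text \<open>The product rule with explicit error. With \<open>A\<close> and \<open>B\<close> the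
  errors of the two difference quotients, the increment of the inner product divided by
  \<open>h\<close> misses the claimed derivative by
  \<open><A, g> + <f, B> + h <f' + A, g' + B>\<close>. Cauchy-Schwarz bounds this by
  \<open>R\<close>, which tends to 0. Square integrability near \<open>t\<close> is asked only
  eventually, because the curves are controlled only on an open interval.\<close>

lemma l2_inner_has_vector_derivative:
  assumes ev: "\<forall>\<^sub>F h in at 0. sq_int (f (t + h))" "\<forall>\<^sub>F h in at 0. sq_int (g (t + h))"
    and sq: "sq_int (f t)" "sq_int (g t)" "sq_int f'" "sq_int g'"
    and der: "has_l2_derivative f f' t" "has_l2_derivative g g' t"
  shows "((\<lambda>\<tau>. l2_inner (f \<tau>) (g \<tau>)) has_vector_derivative (l2_inner f' (g t) + l2_inner (f t) g')) (at t)"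
proof -
  let ?D = "l2_inner f' (g t) + l2_inner (f t) g'"
  define A where "A h q = (f (t + h) q - f t q) / complex_of_real h - f' q" for h q
  define B where "B h q = (g (t + h) q - g t q) / complex_of_real h - g' q" for h q
  have lim: "((\<lambda>h. l2_norm (A h)) \<longlongrightarrow> 0) (at 0)" "((\<lambda>h. l2_norm (B h)) \<longlongrightarrow> 0) (at 0)"
    using der unfolding has_l2_derivative_def A_def B_def by auto
  define R where "R h = l2_norm (A h) * l2_norm (g t) + l2_norm (f t) * l2_norm (B h)
      + \<bar>h\<bar> * ((l2_norm f' + l2_norm (A h)) * (l2_norm g' + l2_norm (B h)))" for h
  have "(R \<longlongrightarrow> 0 * l2_norm (g t) + l2_norm (f t) * 0 + \<bar>0\<bar> * ((l2_norm f' + 0) * (l2_norm g' + 0))) (at 0)"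
    unfolding R_def by (intro tendsto_intros lim)
  then have R0: "(R \<longlongrightarrow> 0) (at 0)" by simp
  have "\<forall>\<^sub>F h in at 0. norm (norm (l2_inner (f (t + h)) (g (t + h)) - l2_inner (f t) (g t) - h *\<^sub>R ?D) / norm h) \<le> R h"
    using ev eventually_neq_at_within[of 0 0]
  proof eventually_elim
    case (elim h)
    have "sq_int (\<lambda>q. (1 / complex_of_real h) * (f (t + h) q - f t q) - f' q)"
      by (intro sq_int_diff sq_int_cmult elim sq)
    then have sA: "sq_int (A h)" by (simp add: A_def[abs_def])
    have "sq_int (\<lambda>q. (1 / complex_of_real h) * (g (t + h) q - g t q) - g' q)"
      by (intro sq_int_diff sq_int_cmult elim sq)
    then have sB: "sq_int (B h)" by (simp add: B_def[abs_def])
    define F where "F = (\<lambda>q. f' q + A h q)"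
    define G where "G = (\<lambda>q. g' q + B h q)"
    have sF: "sq_int F" and sG: "sq_int G" unfolding F_def G_def by (intro sq_int_add sq sA sB)+
    have f: "f (t + h) = (\<lambda>q. f t q + complex_of_real h * F q)"
      using elim by (auto simp: A_def F_def fun_eq_iff field_simps)
    have g: "g (t + h) = (\<lambda>q. g t q + complex_of_real h * G q)"
      using elim by (auto simp: B_def G_def fun_eq_iff field_simps)
    have e1: "l2_inner (f (t + h)) (g (t + h)) = l2_inner (f t) (g t) + h * l2_inner (f t) G
        + h * l2_inner F (g t) + h * (h * l2_inner F G)"
      unfolding f g
      by (simp add: l2_inner_add_left l2_inner_add_right l2_inner_cmult_left l2_inner_cmult_right
          sq_int_add sq_int_cmult sq sF sG ring_distribs del: of_real_mult)
    have e2: "l2_inner (f t) G = l2_inner (f t) g' + l2_inner (f t) (B h)"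
       "l2_inner F (g t) = l2_inner f' (g t) + l2_inner (A h) (g t)"
      by (simp_all add: F_def G_def l2_inner_add_left l2_inner_add_right sq sA sB)
    have "l2_inner (f (t + h)) (g (t + h)) - l2_inner (f t) (g t) - h *\<^sub>R ?D
       = h * (l2_inner (A h) (g t) + l2_inner (f t) (B h) + h * l2_inner F G)"
      unfolding e1 e2 by (simp add: scaleR_conv_of_real algebra_simps)
    then have "norm (norm (l2_inner (f (t + h)) (g (t + h)) - l2_inner (f t) (g t) - h *\<^sub>R ?D) / norm h)
       = norm (l2_inner (A h) (g t) + l2_inner (f t) (B h) + h * l2_inner F G)"
      using elim by (simp add: norm_mult)
    also have "\<dots> \<le> norm (l2_inner (A h) (g t)) + norm (l2_inner (f t) (B h)) + \<bar>h\<bar> * norm (l2_inner F G)"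
      by (intro norm_triangle_le add_mono) (auto simp: norm_mult)
    also have "\<dots> \<le> R h"
      unfolding R_def
    proof (intro add_mono mult_left_mono l2_Cauchy_Schwarz sq sA sB)
      have "norm (l2_inner F G) \<le> l2_norm F * l2_norm G" by (intro l2_Cauchy_Schwarz sF sG)
      also have "\<dots> \<le> (l2_norm f' + l2_norm (A h)) * (l2_norm g' + l2_norm (B h))"
        unfolding F_def G_def
        by (intro mult_mono l2_norm_triangle sq sA sB) auto
      finally show "norm (l2_inner F G) \<le> (l2_norm f' + l2_norm (A h)) * (l2_norm g' + l2_norm (B h))" .
    qed auto
    finally show ?case .
  qed
  then have "((\<lambda>h. norm (l2_inner (f (t + h)) (g (t + h)) - l2_inner (f t) (g t) - h *\<^sub>R ?D) / norm h) \<longlongrightarrow> 0) (at 0)"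
    by (rule Lim_null_comparison[OF _ R0])
  then show ?thesis
    unfolding has_vector_derivative_def has_derivative_at
    by (auto intro: bounded_linear_scaleR_left)
qed

section \<open>Gaussian integrals\<close>

text \<open>The fundamental theorem on \<open>[-n, n]\<close>, with dominated convergence as
  \<open>n\<close> grows. Every integration by parts below is an instance, with \<open>F\<close> as
  the boundary term.\<close>

lemma integral_derivative_eq_0:
  fixes F f :: "real \<Rightarrow> complex"
  assumes der: "\<And>x. (F has_vector_derivative f x) (at x)" and int: "integrable lborel f"
    and lim: "(F \<longlongrightarrow> 0) at_top" "(F \<longlongrightarrow> 0) at_bot"
  shows "(LINT q|lborel. f q) = 0"
proof -
  have [measurable]: "f \<in> borel_measurable lborel" using int by simp
  have "(\<lambda>n. LINT q|lborel. indicator {- real n..real n} q *\<^sub>R f q) \<longlonglongrightarrow> (LINT q|lborel. f q)"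
  proof (rule integral_dominated_convergence[where w="\<lambda>q. norm (f q)"])
    have "(\<lambda>n. indicator {- real n..real n} q *\<^sub>R f q) \<longlonglongrightarrow> f q" for q
    proof (rule tendsto_eventually)
      obtain N where "\<bar>q\<bar> < real N" using reals_Archimedean2 by blast
      then have "\<forall>\<^sub>F n in sequentially. \<bar>q\<bar> < real n"
        by (intro eventually_sequentiallyI[of N]) simp
      then show "\<forall>\<^sub>F n in sequentially. indicator {- real n..real n} q *\<^sub>R f q = f q"
        by eventually_elim (auto simp: indicator_def)
    qed
    then show "AE q in lborel. (\<lambda>n. indicator {- real n..real n} q *\<^sub>R f q) \<longlonglongrightarrow> f q" by simp
  qed (use int in \<open>auto simp: indicator_def\<close>)
  moreover have "(LINT q|lborel. indicator {- real n..real n} q *\<^sub>R f q) = F (real n) - F (- real n)" for n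
  proof -
    have si: "set_integrable lborel {- real n..real n} f"
      unfolding set_integrable_def using int by (intro integrable_mult_indicator) auto
    have "(f has_integral F (real n) - F (- real n)) {- real n..real n}"
      by (intro fundamental_theorem_of_calculus)
         (auto intro: has_vector_derivative_at_within der)
    then show ?thesis
      using set_borel_integral_eq_integral(2)[OF si] by (simp add: set_lebesgue_integral_def integral_unique)
  qed
  moreover have "(\<lambda>n. F (real n) - F (- real n)) \<longlonglongrightarrow> 0 - 0"
  proof (intro tendsto_diff)
    show "(\<lambda>n. F (real n)) \<longlonglongrightarrow> 0" by (rule filterlim_compose[OF lim(1) filterlim_real_sequentially])
    show "(\<lambda>n. F (- real n)) \<longlonglongrightarrow> 0"
      by (rule filterlim_compose[OF lim(2)]) real_asymp
  qed
  ultimately show ?thesis by (simp add: LIMSEQ_unique)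
qed

lemma integrable_power_gauss:
  fixes e :: real
  assumes "e > 0"
  shows "integrable lborel (\<lambda>q. q ^ k * exp (- e * q\<^sup>2))"
proof -
  \<comment> \<open>The deviation for which the normal density has exponent \<open>- e q^2\<close>,
    so that its moments can be reused.\<close>
  define \<sigma> where "\<sigma> = 1 / sqrt (2 * e)"
  have \<sigma>: "\<sigma> > 0" "2 * \<sigma>\<^sup>2 = 1 / e" using assms by (auto simp: \<sigma>_def power_divide)
  have "integrable lborel (\<lambda>q. sqrt (2 * pi * \<sigma>\<^sup>2) * (normal_density 0 \<sigma> q * (q - 0) ^ k))"
    using integrable_normal_moment[OF \<sigma>(1), of 0 k] by (intro integrable_mult_right)
  also have "(\<lambda>q. sqrt (2 * pi * \<sigma>\<^sup>2) * (normal_density 0 \<sigma> q * (q - 0) ^ k)) = (\<lambda>q. q ^ k * exp (- e * q\<^sup>2))"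
    using \<sigma>(1) by (auto simp: normal_density_def \<sigma>(2) fun_eq_iff)
  finally show ?thesis .
qed

lemma integral_gauss:
  fixes e :: real
  assumes "e > 0"
  shows "(LINT q|lborel. exp (- e * q\<^sup>2)) = sqrt (pi / e)"
proof -
  define \<sigma> where "\<sigma> = 1 / sqrt (2 * e)"
  have \<sigma>: "\<sigma> > 0" "2 * \<sigma>\<^sup>2 = 1 / e" using assms by (auto simp: \<sigma>_def power_divide)
  have eq: "(\<lambda>q. exp (- e * q\<^sup>2)) = (\<lambda>q. sqrt (2 * pi * \<sigma>\<^sup>2) * normal_density 0 \<sigma> q)"
    using \<sigma>(1) by (auto simp: normal_density_def \<sigma>(2) fun_eq_iff)
  have "2 * pi * \<sigma>\<^sup>2 = pi / e" using \<sigma>(2) by (simp add: field_simps)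
  then show ?thesis
    unfolding eq using integral_normal_density[OF \<sigma>(1), of 0] by simp
qed

lemma integrable_poly_gauss_real:
  fixes e :: real
  assumes "e > 0"
  shows "integrable lborel (\<lambda>q. poly P q * exp (- e * q\<^sup>2))"
proof -
  have "integrable lborel (\<lambda>q. \<Sum>i\<le>degree P. coeff P i * (q ^ i * exp (- e * q\<^sup>2)))"
    by (intro Bochner_Integration.integrable_sum integrable_mult_right integrable_power_gauss assms)
  then show ?thesis by (simp add: poly_altdef sum_distrib_right mult.assoc)
qed

lemma tendsto_poly_gauss:
  fixes e :: real
  assumes "e > 0"
  shows "((\<lambda>q. poly P q * exp (- e * q\<^sup>2)) \<longlongrightarrow> 0) at_top"
    and "((\<lambda>q. poly P q * exp (- e * q\<^sup>2)) \<longlongrightarrow> 0) at_bot"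
proof -
  have top: "((\<lambda>q. poly P q * exp (- e * q\<^sup>2)) \<longlongrightarrow> 0) at_top" for P
  proof -
    have "((\<lambda>q. q ^ k * exp (- e * q\<^sup>2)) \<longlongrightarrow> 0) at_top" for k
      using assms by real_asymp
    then have "((\<lambda>q. \<Sum>i\<le>degree P. coeff P i * (q ^ i * exp (- e * q\<^sup>2))) \<longlongrightarrow> 0) at_top"
      by (intro tendsto_null_sum tendsto_mult_right_zero)
    then show ?thesis by (simp add: poly_altdef sum_distrib_right mult.assoc)
  qed
  then show "((\<lambda>q. poly P q * exp (- e * q\<^sup>2)) \<longlongrightarrow> 0) at_top" .
  show "((\<lambda>q. poly P q * exp (- e * q\<^sup>2)) \<longlongrightarrow> 0) at_bot"
    using top[of "pcompose P [:0, -1:]"] unfolding filterlim_at_bot_mirror by (simp add: poly_pcompose)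
qed

definition gauss :: "complex \<Rightarrow> real \<Rightarrow> complex" where
  "gauss p q = exp (- p * complex_of_real (q\<^sup>2))"

lemma norm_gauss: "cmod (gauss p q) = exp (- Re p * q\<^sup>2)"
  by (simp add: gauss_def)

lemma gauss_measurable [measurable]: "gauss p \<in> borel_measurable borel"
  unfolding gauss_def by measurable

lemma gauss_mult: "gauss p q * gauss p' q = gauss (p + p') q"
  by (simp add: gauss_def exp_add[symmetric] algebra_simps)

lemma cnj_gauss: "cnj (gauss p q) = gauss (cnj p) q"
  by (simp add: gauss_def exp_cnj)

lemma gauss_has_vector_derivative:
  "(gauss p has_vector_derivative (- 2 * p * complex_of_real q * gauss p q)) (at q)"
proof -
  have "((\<lambda>x. exp (- p * x\<^sup>2)) has_field_derivative (- 2 * p * complex_of_real q * exp (- p * (complex_of_real q)\<^sup>2)))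
     (at (complex_of_real q))"
    by (auto intro!: derivative_eq_intros)
  from has_vector_derivative_real_field[OF this] show ?thesis
    by (simp add: gauss_def[abs_def])
qed

lemma poly_gauss_has_vector_derivative:
  "((\<lambda>q. complex_of_real (poly P q) * gauss p q) has_vector_derivative
     (complex_of_real (poly (pderiv P) q) - 2 * p * complex_of_real (q * poly P q)) * gauss p q) (at q)"
  by (rule has_vector_derivative_eq_rhs, rule has_vector_derivative_mult,
      rule has_vector_derivative_of_real, rule poly_DERIV, rule gauss_has_vector_derivative)
     (simp add: algebra_simps)

lemma integrable_poly_gauss:
  assumes "Re p > 0"
  shows "integrable lborel (\<lambda>q. complex_of_real (poly P q) * gauss p q)"
proof (rule Bochner_Integration.integrable_bound[OF integrable_poly_gauss_real[OF assms, of P]])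
  show "(\<lambda>q. complex_of_real (poly P q) * gauss p q) \<in> borel_measurable lborel" 
  proof -
    have [measurable]: "poly P \<in> borel_measurable borel"
      by (intro borel_measurable_continuous_onI continuous_on_poly continuous_on_id)
    show ?thesis by measurable
  qed
qed (simp add: norm_mult norm_gauss)

lemma tendsto_cpoly_gauss:
  assumes "Re p > 0"
  shows "((\<lambda>q. complex_of_real (poly P q) * gauss p q) \<longlongrightarrow> 0) at_top"
    and "((\<lambda>q. complex_of_real (poly P q) * gauss p q) \<longlongrightarrow> 0) at_bot"
proof -
  have eq: "cmod (complex_of_real (poly P q) * gauss p q) = \<bar>poly P q * exp (- Re p * q\<^sup>2)\<bar>" for q
    by (simp add: norm_mult norm_gauss abs_mult)
  show "((\<lambda>q. complex_of_real (poly P q) * gauss p q) \<longlongrightarrow> 0) at_top"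
    by (rule tendsto_norm_zero_cancel, unfold eq) (rule tendsto_rabs_zero[OF tendsto_poly_gauss(1)[OF assms]])
  show "((\<lambda>q. complex_of_real (poly P q) * gauss p q) \<longlongrightarrow> 0) at_bot"
    by (rule tendsto_norm_zero_cancel, unfold eq) (rule tendsto_rabs_zero[OF tendsto_poly_gauss(2)[OF assms]])
qed

text \<open>The derivative of \<open>P\<close> times the Gaussian integrates to 0. This single
  identity yields the Hermite moments, the orthogonality relations and the second moment of a
  Gaussian.\<close>

lemma integral_pderiv_gauss:
  assumes "Re p > 0"
  shows "(LINT q|lborel. complex_of_real (poly (pderiv P) q) * gauss p q)
    = 2 * p * (LINT q|lborel. complex_of_real (q * poly P q) * gauss p q)"
proof -
  have i1: "integrable lborel (\<lambda>q. complex_of_real (poly (pderiv P) q) * gauss p q)"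
    by (rule integrable_poly_gauss[OF assms])
  have i2: "integrable lborel (\<lambda>q. complex_of_real (q * poly P q) * gauss p q)"
    using integrable_poly_gauss[OF assms, of "pCons 0 P"] by simp
  have i3: "integrable lborel (\<lambda>q. 2 * p * (complex_of_real (q * poly P q) * gauss p q))"
    by (rule integrable_mult_right[OF i2])
  have eq: "(complex_of_real (poly (pderiv P) q) - 2 * p * complex_of_real (q * poly P q)) * gauss p q
     = complex_of_real (poly (pderiv P) q) * gauss p q - 2 * p * (complex_of_real (q * poly P q) * gauss p q)" for q
    by (simp add: algebra_simps)
  have "(LINT q|lborel. complex_of_real (poly (pderiv P) q) * gauss p q - 2 * p * (complex_of_real (q * poly P q) * gauss p q)) = 0"
    by (rule integral_derivative_eq_0[OF poly_gauss_has_vector_derivative[where P=P and p=p, unfolded eq]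
        Bochner_Integration.integrable_diff[OF i1 i3] tendsto_cpoly_gauss[OF assms]])
  then have "(LINT q|lborel. complex_of_real (poly (pderiv P) q) * gauss p q)
      - (LINT q|lborel. 2 * p * (complex_of_real (q * poly P q) * gauss p q)) = 0"
    using Bochner_Integration.integral_diff[OF i1 i3] by simp
  then show ?thesis by simp
qed

section \<open>Gaussians as test vectors in L2\<close>

lemma sq_int_poly_gauss:
  assumes "Re p > 0"
  shows "sq_int (\<lambda>q. complex_of_real (poly P q) * gauss p q)"
proof -
  have "(cmod (complex_of_real (poly P q) * gauss p q))\<^sup>2 = poly (P ^ 2) q * exp (- (2 * Re p) * q\<^sup>2)" for q
    by (simp add: norm_mult norm_gauss power_mult_distrib exp_double[symmetric])
  moreover have "integrable lborel (\<lambda>q. poly (P ^ 2) q * exp (- (2 * Re p) * q\<^sup>2))"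
    using assms by (intro integrable_poly_gauss_real) simp
  moreover have "(\<lambda>q. complex_of_real (poly P q) * gauss p q) \<in> borel_measurable lborel"
    using integrable_poly_gauss[OF assms] by (rule borel_measurable_integrable)
  ultimately show ?thesis unfolding sq_int_def by presburger
qed

lemma sq_int_gauss: "Re p > 0 \<Longrightarrow> sq_int (gauss p)"
  using sq_int_poly_gauss[of p 1] by simp

text \<open>Turns weighted integrability of a derivative into a pointwise growth bound on the
  function. It replaces the missing decay hypotheses on the evolved state: applied twice, it bounds
  first its derivative and then the state itself.\<close>

lemma derivative_gauss_growth:
  fixes F f :: "real \<Rightarrow> complex" and e :: real
  assumes der: "\<And>x. (F has_vector_derivative f x) (at x)" and e: "e > 0"
    and int: "integrable lborel (\<lambda>q. gauss (of_real e) q * f q)"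
  shows "\<exists>C\<ge>0. \<forall>x. cmod (F x) \<le> C * exp (e * x\<^sup>2)"
proof -
  define K where "K = (LINT q|lborel. cmod (gauss (of_real e) q * f q))"
  have K: "K \<ge> 0" by (simp add: K_def)
  \<comment> \<open>Measurability of \<open>f\<close> is read off from the weighted function by
    dividing out the Gaussian.\<close>
  have "f = (\<lambda>q. gauss (- of_real e) q * (gauss (of_real e) q * f q))"
    by (simp add: mult.assoc[symmetric] gauss_mult) (simp add: gauss_def)
  moreover have "(\<lambda>q. gauss (- of_real e) q * (gauss (of_real e) q * f q)) \<in> borel_measurable lborel"
    using borel_measurable_integrable[OF int] by (intro borel_measurable_times[of "gauss (- of_real e)"]) auto
  ultimately have meas [measurable]: "f \<in> borel_measurable lborel" by metis
  \<comment> \<open>On \<open>[-R, R]\<close> the weight is at least \<open>exp (- e R^2)\<close>,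
    so removing it from the integral costs at most the factor \<open>exp (e R^2)\<close>.\<close>
  have incr: "cmod (F b - F a) \<le> exp (e * R\<^sup>2) * K" if "a \<le> b" "\<bar>a\<bar> \<le> R" "\<bar>b\<bar> \<le> R" for a b R
  proof -
    have le: "cmod (indicator {a..b} q *\<^sub>R f q) \<le> exp (e * R\<^sup>2) * cmod (gauss (of_real e) q * f q)" for q
    proof (cases "q \<in> {a..b}")
      case True
      then have "\<bar>q\<bar> \<le> \<bar>R\<bar>" using that by auto
      then have "q\<^sup>2 \<le> R\<^sup>2" by (simp only: abs_le_square_iff)
      then have "e * q\<^sup>2 \<le> e * R\<^sup>2" using e by simp
      then have "1 \<le> exp (e * R\<^sup>2) * exp (- e * q\<^sup>2)" by (simp add: exp_add[symmetric])
      then have "1 * cmod (f q) \<le> (exp (e * R\<^sup>2) * exp (- e * q\<^sup>2)) * cmod (f q)"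
        by (intro mult_right_mono) auto
      then show ?thesis using True by (simp add: norm_mult norm_gauss mult.assoc)
    qed simp
    have ib: "integrable lborel (\<lambda>q. exp (e * R\<^sup>2) * cmod (gauss (of_real e) q * f q))"
      using int by simp
    have si: "set_integrable lborel {a..b} f"
      unfolding set_integrable_def
    proof (rule Bochner_Integration.integrable_bound[OF ib])
      show "AE q in lborel. cmod (indicator {a..b} q *\<^sub>R f q) \<le> norm (exp (e * R\<^sup>2) * cmod (gauss (of_real e) q * f q))"
        using le by (intro AE_I2) (simp add: abs_mult)
    qed measurable
    have "(f has_integral F b - F a) {a..b}"
      using that by (intro fundamental_theorem_of_calculus)
         (auto intro: has_vector_derivative_at_within der)
    then have "F b - F a = (LINT q|lborel. indicator {a..b} q *\<^sub>R f q)"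
      using set_borel_integral_eq_integral(2)[OF si] by (simp add: set_lebesgue_integral_def integral_unique)
    then have "cmod (F b - F a) \<le> (LINT q|lborel. cmod (indicator {a..b} q *\<^sub>R f q))"
      using integral_norm_bound by metis
    also have "\<dots> \<le> (LINT q|lborel. exp (e * R\<^sup>2) * cmod (gauss (of_real e) q * f q))"
      using si le ib unfolding set_integrable_def by (intro integral_mono integrable_norm)
    finally show ?thesis by (simp add: K_def)
  qed
  have "cmod (F x) \<le> (cmod (F 0) + K) * exp (e * x\<^sup>2)" for x
  proof -
    have "cmod (F x - F 0) \<le> exp (e * x\<^sup>2) * K"
      using incr[of 0 x "\<bar>x\<bar>"] incr[of x 0 "\<bar>x\<bar>"] by (cases "0 \<le> x") (auto simp: norm_minus_commute)
    moreover have "cmod (F 0) \<le> cmod (F 0) * exp (e * x\<^sup>2)"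
      using e mult_left_mono[of 1 "exp (e * x\<^sup>2)" "cmod (F 0)"] by simp
    moreover have "cmod (F x) \<le> cmod (F 0) + cmod (F x - F 0)" by (rule norm_triangle_sub)
    ultimately show ?thesis by (simp add: algebra_simps)
  qed
  then show ?thesis using K by (intro exI[of _ "cmod (F 0) + K"]) auto
qed

lemma twice_diff_derivs:
  assumes "twice_diff f"
  shows "(f has_vector_derivative vderiv_iter 1 f x) (at x)"
    and "(vderiv_iter 1 f has_vector_derivative vderiv_iter 2 f x) (at x)"
  using assms by (simp_all add: twice_diff_def vector_derivative_works numeral_2_eq_2)

text \<open>Symmetry of the Hamiltonian when one argument is Gaussian: the function on the right is
  the Hamiltonian applied to \<open>gauss p\<close>, computed from
  \<open>gauss'' = (4 p^2 q^2 - 2 p) gauss\<close>.\<close>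

lemma l2_inner_gauss_ham:
  assumes p: "Re p > 0" and f: "twice_diff f" "sq_int f" "sq_int (ham \<kappa> t f)"
  shows "l2_inner (gauss p) (ham \<kappa> t f)
    = l2_inner (\<lambda>q. (p - (2 * p\<^sup>2 - complex_of_real (\<kappa> t) / 2) * complex_of_real (q\<^sup>2)) * gauss p q) f"
proof -
  \<comment> \<open>The decay rate of \<open>gauss p\<close> is split into four parts. The growth
    bounds use up one for \<open>f'\<close> and two for \<open>f\<close>, so a positive rate is left
    in the boundary term.\<close>
  define e where "e = Re p / 4"
  have e: "e > 0" "Re p = 4 * e" using p by (auto simp: e_def)
  define k where "k = complex_of_real (\<kappa> t)"
  define g where "g = ham \<kappa> t f"
  define f1 where "f1 = vderiv_iter 1 f"
  define f2 where "f2 = vderiv_iter 2 f"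
  have f1: "(f has_vector_derivative f1 x) (at x)" for x
    unfolding f1_def by (rule twice_diff_derivs[OF f(1)])
  have f2: "(f1 has_vector_derivative f2 x) (at x)" for x
    unfolding f1_def f2_def by (rule twice_diff_derivs[OF f(1)])
  have f2_eq: "f2 q = k * of_real (q\<^sup>2) * f q - 2 * g q" for q
    by (simp add: g_def ham_def k_def f2_def field_simps)
  have sg: "sq_int g" using f by (simp add: g_def)
  have int: "integrable lborel (\<lambda>q. gauss p' q * h q)"
      "integrable lborel (\<lambda>q. of_real (q\<^sup>2) * gauss p' q * h q)"
    if "Re p' > 0" "sq_int h" for p' h
  proof -
    have "Re (cnj p') > 0" using that by simp
    note sq_int_inner[OF sq_int_poly_gauss[OF this, of 1] that(2)]
      sq_int_inner[OF sq_int_poly_gauss[OF this, of "[:0,0,1:]"] that(2)]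
    then show "integrable lborel (\<lambda>q. gauss p' q * h q)"
      "integrable lborel (\<lambda>q. of_real (q\<^sup>2) * gauss p' q * h q)"
      by (simp_all add: cnj_gauss power2_eq_square)
  qed
  \<comment> \<open>Square integrability of \<open>f''\<close> is not given. It is the combination
    \<open>\<kappa> q^2 f - 2 H f\<close>, and the Gaussian weight absorbs the factor
    \<open>q^2\<close>.\<close>
  have int_f2: "integrable lborel (\<lambda>q. gauss (of_real e) q * f2 q)"
  proof -
    have "integrable lborel (\<lambda>q. k * (of_real (q\<^sup>2) * gauss (of_real e) q * f q) - 2 * (gauss (of_real e) q * g q))"
      using e by (intro Bochner_Integration.integrable_diff integrable_mult_right int f sg) auto
    then show ?thesis by (simp add: f2_eq algebra_simps)
  qed
  obtain C1 where C1: "C1 \<ge> 0" "\<And>x. cmod (f1 x) \<le> C1 * exp (e * x\<^sup>2)"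
    using derivative_gauss_growth[OF f2 e(1) int_f2] by blast
  have meas_f1 [measurable]: "f1 \<in> borel_measurable borel"
  proof (rule borel_measurable_continuous_onI, rule continuous_at_imp_continuous_on, rule ballI)
    show "isCont f1 x" for x using f2[of x] by (rule has_vector_derivative_continuous)
  qed
  have "integrable lborel (\<lambda>q. gauss (of_real (2 * e)) q * f1 q)"
  proof (rule Bochner_Integration.integrable_bound)
    show "integrable lborel (\<lambda>q. C1 * exp (- e * q\<^sup>2))"
      using integrable_poly_gauss_real[OF e(1), of "[:C1:]"] by simp
    have "cmod (gauss (of_real (2 * e)) q * f1 q) \<le> C1 * exp (- e * q\<^sup>2)" for q
    proof -
      have "cmod (gauss (of_real (2 * e)) q * f1 q) \<le> exp (- (2 * e) * q\<^sup>2) * (C1 * exp (e * q\<^sup>2))"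
        unfolding norm_mult norm_gauss using C1(2)[of q] by (intro mult_mono) auto
      also have "\<dots> = C1 * exp (- e * q\<^sup>2)"
        by (simp add: algebra_simps exp_add[symmetric])
      finally show ?thesis .
    qed
    then show "AE q in lborel. cmod (gauss (of_real (2 * e)) q * f1 q) \<le> norm (C1 * exp (- e * q\<^sup>2))"
      using C1 by (intro AE_I2) (simp add: abs_mult)
  qed measurable
  then obtain C2 where C2: "C2 \<ge> 0" "\<And>x. cmod (f x) \<le> C2 * exp (2 * e * x\<^sup>2)"
    using derivative_gauss_growth[OF f1, of "2 * e"] e by auto
  define G where "G = gauss (cnj p)"
  have Rc: "Re (cnj p) > 0" using p by simp
  \<comment> \<open>The boundary term \<open>G f' - G' f\<close> of two integrations by parts; its
    derivative is \<open>G f'' - G'' f\<close>, rewritten below without \<open>f''\<close>.\<close>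
  define B where "B q = G q * f1 q + 2 * cnj p * (of_real q * (G q * f q))" for q
  have G': "(G has_vector_derivative (- 2 * cnj p * of_real x * G x)) (at x)" for x
    unfolding G_def by (rule gauss_has_vector_derivative)
  have qder: "((\<lambda>x. complex_of_real x) has_vector_derivative 1) (at x)" for x
    by (rule has_vector_derivative_eq_rhs, rule has_vector_derivative_of_real, rule DERIV_ident) simp
  have B': "(B has_vector_derivative
      (k - 4 * (cnj p)\<^sup>2) * (of_real (q\<^sup>2) * G q * f q) + 2 * cnj p * (G q * f q) - 2 * (G q * g q)) (at q)" for q
    unfolding B_def[abs_def]
    by (rule has_vector_derivative_eq_rhs)
       (rule has_vector_derivative_add has_vector_derivative_mult G' f1 f2 qder has_vector_derivative_const
         has_vector_derivative_mult_right
        | simp add: f2_eq algebra_simps power2_eq_square)+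
  note i1 = int(2)[OF Rc f(2), folded G_def] and i2 = int(1)[OF Rc f(2), folded G_def]
    and i3 = int(1)[OF Rc sg, folded G_def]
  have Bbound: "cmod (B q) \<le> \<bar>C1 * exp (- e * q\<^sup>2)\<bar> + \<bar>2 * cmod p * C2 * q * exp (- e * q\<^sup>2)\<bar>" for q
  proof -
    have "cmod (B q) \<le> exp (- (4*e) * q\<^sup>2) * (C1 * exp (e * q\<^sup>2)) + 2 * cmod p * (\<bar>q\<bar> * (exp (- (4*e) * q\<^sup>2) * (C2 * exp (2 * e * q\<^sup>2))))"
      unfolding B_def G_def
      by (rule order_trans[OF norm_triangle_ineq])
         (unfold norm_mult norm_gauss, intro add_mono mult_mono C1 C2, auto simp: e C1 C2)
    also have "\<dots> = C1 * exp (- (3*e) * q\<^sup>2) + 2 * cmod p * C2 * \<bar>q\<bar> * exp (- (2*e) * q\<^sup>2)"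
    proof -
      have E: "exp (- (3*e) * q\<^sup>2) = exp (- (4*e) * q\<^sup>2) * exp (e * q\<^sup>2)"
        "exp (- (2*e) * q\<^sup>2) = exp (- (4*e) * q\<^sup>2) * exp (2 * e * q\<^sup>2)"
        by (simp_all add: exp_add[symmetric])
      show ?thesis unfolding E by (simp only: mult_ac)
    qed
    also have "\<dots> \<le> C1 * exp (- e * q\<^sup>2) + 2 * cmod p * C2 * \<bar>q\<bar> * exp (- e * q\<^sup>2)"
      using e C1 C2 by (intro add_mono mult_left_mono) (auto intro!: mult_right_mono)
    also have "\<dots> = \<bar>C1 * exp (- e * q\<^sup>2)\<bar> + \<bar>2 * cmod p * C2 * q * exp (- e * q\<^sup>2)\<bar>"
      using C1 C2 by (simp add: abs_mult)
    finally show ?thesis .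
  qed
  have Blim: "(B \<longlongrightarrow> 0) at_top" "(B \<longlongrightarrow> 0) at_bot"
    using tendsto_add[OF tendsto_rabs_zero[OF tendsto_poly_gauss(1)[OF e(1), of "[:C1:]"]]
        tendsto_rabs_zero[OF tendsto_poly_gauss(1)[OF e(1), of "[:0, 2 * cmod p * C2:]"]]]
      tendsto_add[OF tendsto_rabs_zero[OF tendsto_poly_gauss(2)[OF e(1), of "[:C1:]"]]
        tendsto_rabs_zero[OF tendsto_poly_gauss(2)[OF e(1), of "[:0, 2 * cmod p * C2:]"]]]
    by (auto intro!: Lim_null_comparison[OF always_eventually[OF allI, OF Bbound]] simp: mult_ac)
  have "(LINT q|lborel. (k - 4 * (cnj p)\<^sup>2) * (of_real (q\<^sup>2) * G q * f q) + 2 * cnj p * (G q * f q) - 2 * (G q * g q)) = 0"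
    by (rule integral_derivative_eq_0[OF B' _ Blim])
       (intro Bochner_Integration.integrable_diff Bochner_Integration.integrable_add integrable_mult_right i1 i2 i3)
  then have eq: "(k - 4 * (cnj p)\<^sup>2) * (LINT q|lborel. of_real (q\<^sup>2) * G q * f q) + 2 * cnj p * (LINT q|lborel. G q * f q)
       = 2 * (LINT q|lborel. G q * g q)"
    using i1 i2 i3 by simp
  have "l2_inner (\<lambda>q. (p - (2 * p\<^sup>2 - k / 2) * complex_of_real (q\<^sup>2)) * gauss p q) f
     = (LINT q|lborel. cnj p * (G q * f q) - (2 * (cnj p)\<^sup>2 - k/2) * (of_real (q\<^sup>2) * G q * f q))"
    unfolding l2_inner_def G_def by (simp add: cnj_gauss k_def algebra_simps)
  also have "\<dots> = cnj p * (LINT q|lborel. G q * f q) - (2 * (cnj p)\<^sup>2 - k/2) * (LINT q|lborel. of_real (q\<^sup>2) * G q * f q)"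
    using i1 i2 by (subst Bochner_Integration.integral_diff) auto
  also have "\<dots> = (LINT q|lborel. G q * g q)"
    using eq by (simp add: field_simps)
  also have "\<dots> = l2_inner (gauss p) (ham \<kappa> t f)"
    unfolding l2_inner_def by (simp add: cnj_gauss G_def g_def)
  finally show ?thesis by (simp add: k_def)
qed

section \<open>Hermite functions\<close>

text \<open>\<open>hermite n (a q)\<close> as a formal polynomial in \<open>q\<close>, the form in
  which Gaussian integration by parts is stated. The scale \<open>a\<close> is later the square root
  of \<omega>.\<close>

fun hermite_poly :: "real \<Rightarrow> nat \<Rightarrow> real poly" where
  "hermite_poly a 0 = 1"
| "hermite_poly a (Suc 0) = [:0, 2 * a:]"
| "hermite_poly a (Suc (Suc n)) = [:0, 2 * a:] * hermite_poly a (Suc n) - smult (2 * real (Suc n)) (hermite_poly a n)"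

lemma poly_hermite_poly: "poly (hermite_poly a n) q = hermite n (a * q)"
  by (induction n rule: hermite.induct[where P="\<lambda>n x. poly (hermite_poly a n) q = hermite n (a * q)"])
     (simp_all add: algebra_simps)

lemma pderiv_hermite_poly: "pderiv (hermite_poly a (Suc n)) = smult (2 * real (Suc n) * a) (hermite_poly a n)"
proof (induction n rule: induct_nat_012)
  case 0
  show ?case by (simp add: pderiv_pCons)
next
  case 1
  show ?case by (simp add: pderiv_pCons pderiv_diff pderiv_mult)
next
  case (ge2 n)
  show ?case
  proof (rule poly_ext)
    fix x
    have H2: "poly (hermite_poly a (Suc (Suc n))) x
        = 2 * a * x * poly (hermite_poly a (Suc n)) x - 2 * real (Suc n) * poly (hermite_poly a n) x"
      by simp
    have "poly (pderiv (hermite_poly a (Suc (Suc (Suc n))))) x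
      = 2 * a * poly (hermite_poly a (Suc (Suc n))) x
        + 2 * a * x * (2 * real (Suc (Suc n)) * a * poly (hermite_poly a (Suc n)) x)
        - 2 * real (Suc (Suc n)) * (2 * real (Suc n) * a * poly (hermite_poly a n) x)"
      unfolding hermite_poly.simps(3)[of a "Suc n"] pderiv_diff pderiv_mult pderiv_smult ge2
      by (simp add: pderiv_pCons algebra_simps del: hermite_poly.simps)
    also have "\<dots> = 2 * real (Suc (Suc (Suc n))) * a * poly (hermite_poly a (Suc (Suc n))) x"
      unfolding H2 by (simp add: algebra_simps del: hermite_poly.simps)
    finally show "poly (pderiv (hermite_poly a (Suc (Suc (Suc n))))) x
      = poly (smult (2 * real (Suc (Suc (Suc n))) * a) (hermite_poly a (Suc (Suc n)))) x"
      by simp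
  qed
qed

text \<open>The raising relation, one step of Rodrigues' formula: multiplied by
  \<open>exp (- a^2 q^2)\<close>, the right side is minus the derivative of
  \<open>hermite_poly a n\<close> times that weight.\<close>

lemma hermite_poly_Suc:
  "poly (hermite_poly a (Suc n)) q * a = 2 * a\<^sup>2 * q * poly (hermite_poly a n) q - poly (pderiv (hermite_poly a n)) q"
  by (cases n) (simp_all add: pderiv_hermite_poly power2_eq_square algebra_simps del: of_nat_Suc)

definition hermite_const :: "real \<Rightarrow> nat \<Rightarrow> real" where
  "hermite_const \<omega> n = \<omega> powr (1/4) / sqrt (2 ^ n * fact n * sqrt pi)"

lemma hermite_fn_eq:
  "hermite_fn \<omega> n q = of_real (hermite_const \<omega> n) *
     (of_real (poly (hermite_poly (sqrt \<omega>) n) q) * gauss (of_real (\<omega> / 2)) q)"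
  by (simp add: hermite_fn_def hermite_const_def poly_hermite_poly gauss_def exp_of_real[symmetric])

lemma hermite_const_power2:
  assumes "\<omega> > 0"
  shows "(hermite_const \<omega> n)\<^sup>2 = sqrt \<omega> / (2 ^ n * fact n * sqrt pi)"
proof -
  have "(\<omega> powr (1/4))\<^sup>2 = sqrt \<omega>"
    using assms by (simp add: power2_eq_square powr_add[symmetric] powr_half_sqrt[symmetric])
  then show ?thesis by (simp add: hermite_const_def power_divide)
qed

lemma sq_int_hermite_fn:
  assumes "\<omega> > 0"
  shows "sq_int (hermite_fn \<omega> n)"
proof -
  have "sq_int (\<lambda>q. of_real (hermite_const \<omega> n) *
     (of_real (poly (hermite_poly (sqrt \<omega>) n) q) * gauss (of_real (\<omega> / 2)) q))"
    using assms by (intro sq_int_cmult sq_int_poly_gauss) simp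
  then show ?thesis by (simp add: hermite_fn_eq[abs_def])
qed

section \<open>Hermite coefficients of a Gaussian\<close>

definition hermite_moment :: "real \<Rightarrow> complex \<Rightarrow> nat \<Rightarrow> complex" where
  "hermite_moment \<omega> p n = (LINT q|lborel. of_real (poly (hermite_poly (sqrt \<omega>) n) q) * gauss p q)"

lemma hermite_moment_1:
  assumes "Re p > 0"
  shows "hermite_moment \<omega> p (Suc 0) = 0"
proof -
  have "p \<noteq> 0" using assms by auto
  then have "(LINT q|lborel. complex_of_real (q * poly 1 q) * gauss p q) = 0"
    using integral_pderiv_gauss[OF assms, of 1] by (simp add: pderiv_1)
  moreover have "hermite_moment \<omega> p (Suc 0) = (LINT q|lborel. of_real (2 * sqrt \<omega>) * (complex_of_real (q * poly 1 q) * gauss p q))"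
    unfolding hermite_moment_def by (intro Bochner_Integration.integral_cong) auto
  ultimately show ?thesis by (simp only: integral_mult_right_zero mult_zero_right)
qed

text \<open>The integral \<open>J\<close> of \<open>q H_(n+1)\<close> against the Gaussian occurs
  twice: in the three-term recurrence for \<open>H_(n+2)\<close>, and in the integration by parts
  where the derivative of \<open>H_(n+1)\<close> gives back \<open>H_n\<close>. Eliminating it links
  moments two apart, so all odd ones vanish with the first.\<close>

lemma hermite_moment_rec:
  assumes p: "Re p > 0" and \<omega>: "\<omega> > 0"
  shows "hermite_moment \<omega> p (Suc (Suc n)) = 2 * of_nat (Suc n) * (of_real \<omega> / p - 1) * hermite_moment \<omega> p n"
proof -
  define a where "a = sqrt \<omega>"
  have a2: "complex_of_real a * complex_of_real a = of_real \<omega>" 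
    using \<omega> by (simp add: a_def flip: of_real_mult)
  have p0: "p \<noteq> 0" using p by auto
  define J where "J = (LINT q|lborel. complex_of_real (q * poly (hermite_poly a (Suc n)) q) * gauss p q)"
  have i1: "integrable lborel (\<lambda>q. complex_of_real (q * poly (hermite_poly a (Suc n)) q) * gauss p q)"
    using integrable_poly_gauss[OF p, of "pCons 0 (hermite_poly a (Suc n))"] by simp
  have i2: "integrable lborel (\<lambda>q. complex_of_real (poly (hermite_poly a n) q) * gauss p q)"
    by (rule integrable_poly_gauss[OF p])
  have "(LINT q|lborel. of_real (2 * real (Suc n) * a) * (complex_of_real (poly (hermite_poly a n) q) * gauss p q)) = 2 * p * J"
    using integral_pderiv_gauss[OF p, of "hermite_poly a (Suc n)"]
    unfolding J_def pderiv_hermite_poly by (simp add: mult.assoc)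
  then have J: "of_real (2 * real (Suc n) * a) * hermite_moment \<omega> p n = 2 * p * J"
    unfolding hermite_moment_def a_def[symmetric] by (simp only: integral_mult_right_zero)
  have "hermite_moment \<omega> p (Suc (Suc n))
     = (LINT q|lborel. of_real (2 * a) * (complex_of_real (q * poly (hermite_poly a (Suc n)) q) * gauss p q)
         - of_real (2 * real (Suc n)) * (complex_of_real (poly (hermite_poly a n) q) * gauss p q))"
    unfolding hermite_moment_def a_def[symmetric]
    by (intro Bochner_Integration.integral_cong) (auto simp: algebra_simps)
  also have "\<dots> = of_real (2 * a) * J - of_real (2 * real (Suc n)) * hermite_moment \<omega> p n"
    unfolding hermite_moment_def a_def[symmetric] J_def
    by (subst Bochner_Integration.integral_diff) (intro integrable_mult_right i1 i2, intro integrable_mult_right i1 i2, simp only: integral_mult_right_zero)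
  finally have H: "hermite_moment \<omega> p (Suc (Suc n)) = of_real (2 * a) * J - of_real (2 * real (Suc n)) * hermite_moment \<omega> p n" .
  have "p * hermite_moment \<omega> p (Suc (Suc n)) = of_real a * (2 * p * J) - p * of_real (2 * real (Suc n)) * hermite_moment \<omega> p n"
    unfolding H by (simp add: algebra_simps)
  also have "\<dots> = 2 * of_nat (Suc n) * (of_real \<omega> - p) * hermite_moment \<omega> p n"
    unfolding J[symmetric] a2[symmetric] by (simp add: algebra_simps)
  finally show ?thesis using p0 by (simp add: field_simps)
qed

lemma hermite_moment_odd:
  assumes "Re p > 0" "\<omega> > 0"
  shows "hermite_moment \<omega> p (2 * n + 1) = 0"
proof (induction n)
  case 0
  show ?case using hermite_moment_1[OF assms(1)] by simp
next
  case (Suc n)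
  then show ?case using hermite_moment_rec[OF assms, of "2 * n + 1"] by simp
qed

lemma hermite_moment_even:
  assumes "Re p > 0" "\<omega> > 0"
  shows "hermite_moment \<omega> p (2 * n) = fact (2 * n) / fact n * (of_real \<omega> / p - 1) ^ n * hermite_moment \<omega> p 0"
proof (induction n)
  case (Suc n)
  have f: "(fact (2 * Suc n) / fact (Suc n) :: complex) = 2 * of_nat (Suc (2 * n)) * (fact (2 * n) / fact n)"
  proof -
    have "(fact (2 * Suc n) :: complex) = (2 * of_nat (Suc n)) * (of_nat (Suc (2 * n)) * fact (2 * n))"
      by (simp add: algebra_simps)
    then show ?thesis by (simp add: divide_simps del: of_nat_Suc)
  qed
  have "hermite_moment \<omega> p (2 * Suc n) = 2 * of_nat (Suc (2 * n)) * (of_real \<omega> / p - 1) * hermite_moment \<omega> p (2 * n)"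
    using hermite_moment_rec[OF assms, of "2 * n"] by simp
  also have "\<dots> = fact (2 * Suc n) / fact (Suc n) * (of_real \<omega> / p - 1) ^ Suc n * hermite_moment \<omega> p 0"
    unfolding Suc f power_Suc by (simp only: mult_ac)
  finally show ?case .
qed simp

lemma l2_inner_hermite_gauss:
  "l2_inner (hermite_fn \<omega> n) (gauss p) = of_real (hermite_const \<omega> n) * hermite_moment \<omega> (of_real (\<omega> / 2) + p) n"
proof -
  have "cnj (hermite_fn \<omega> n q) * gauss p q =
      of_real (hermite_const \<omega> n) * (of_real (poly (hermite_poly (sqrt \<omega>) n) q) * gauss (of_real (\<omega> / 2) + p) q)" for q
    unfolding hermite_fn_eq by (simp add: cnj_gauss gauss_mult mult.assoc)
  then show ?thesis
    unfolding l2_inner_def hermite_moment_def by (simp only: integral_mult_right_zero)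
qed

lemma l2_inner_hermite_gauss_odd:
  assumes "Re p > 0" "\<omega> > 0"
  shows "l2_inner (hermite_fn \<omega> (2 * n + 1)) (gauss p) = 0"
  using hermite_moment_odd[of "of_real (\<omega> / 2) + p" \<omega> n] assms by (simp add: l2_inner_hermite_gauss)

lemma l2_inner_hermite_gauss_even:
  assumes "Re p > 0" "\<omega> > 0"
  shows "l2_inner (hermite_fn \<omega> (2 * n)) (gauss p)
    = of_real (sqrt (fact (2 * n)) / (2 ^ n * fact n)) * (of_real \<omega> / (of_real (\<omega> / 2) + p) - 1) ^ n
      * l2_inner (hermite_fn \<omega> 0) (gauss p)"
proof -
  \<comment> \<open>The moment contributes \<open>(2n)! / n!\<close> and the normalisation
    \<open>1 / (2^n sqrt ((2n)!))\<close>; together they give the stated prefactor.\<close>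
  have c: "hermite_const \<omega> (2 * n) * (fact (2 * n) / fact n) = sqrt (fact (2 * n)) / (2 ^ n * fact n) * hermite_const \<omega> 0"
  proof -
    have "sqrt (2 ^ (2 * n)) = (2 ^ n :: real)" by (simp add: power_mult real_sqrt_power)
    then have "hermite_const \<omega> (2 * n) = hermite_const \<omega> 0 / (2 ^ n * sqrt (fact (2 * n)))"
      unfolding hermite_const_def by (simp add: real_sqrt_mult)
    then have "hermite_const \<omega> (2 * n) * fact (2 * n) = hermite_const \<omega> 0 / 2 ^ n * (fact (2 * n) / sqrt (fact (2 * n)))"
      by simp
    also have "fact (2 * n) / sqrt (fact (2 * n)) = sqrt (fact (2 * n) :: real)"
      by (rule real_div_sqrt) simp
    finally show ?thesis by (simp add: field_simps)
  qed
  have cc: "complex_of_real (hermite_const \<omega> (2 * n)) * (fact (2 * n) / fact n)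
     = of_real (sqrt (fact (2 * n)) / (2 ^ n * fact n)) * of_real (hermite_const \<omega> 0)"
    using arg_cong[OF c, of complex_of_real] by simp
  have p: "Re (of_real (\<omega> / 2) + p) > 0" using assms by simp
  show ?thesis
    unfolding l2_inner_hermite_gauss hermite_moment_even[OF p assms(2), of n]
    using arg_cong[OF cc, of "\<lambda>u. u * ((of_real \<omega> / (of_real (\<omega> / 2) + p) - 1) ^ n * hermite_moment \<omega> (of_real (\<omega> / 2) + p) 0)"]
    by (simp only: mult_ac)
qed

lemma hermite_orthogonal_integral:
  assumes \<omega>: "\<omega> > 0"
  shows "(LINT q|lborel. of_real (poly (hermite_poly (sqrt \<omega>) m * hermite_poly (sqrt \<omega>) n) q) * gauss (of_real \<omega>) q)
     = of_real (if m = n then 2 ^ n * fact n * sqrt (pi / \<omega>) else 0)"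
proof -
  define a where "a = sqrt \<omega>"
  have a: "a > 0" "a\<^sup>2 = \<omega>" using \<omega> by (auto simp: a_def)
  have p: "Re (complex_of_real \<omega>) > 0" using \<omega> by simp
  define N where "N P = (LINT q|lborel. of_real (poly P q) * gauss (of_real \<omega>) q)" for P :: "real poly"
  have N_smult: "N (smult k P) = of_real k * N P" for k P
    unfolding N_def poly_smult of_real_mult mult.assoc by (rule integral_mult_right_zero)
  \<comment> \<open>Integration by parts with the raising relation moves one index from the Hermite
    factor to a derivative of \<open>P\<close>. If \<open>P\<close> is itself a Hermite polynomial,
    both indices drop by one, until one of them is 0; then either a derivative of a constant or the
    plain Gaussian integral is left.\<close>
  have step: "N (P * hermite_poly a (Suc k)) * of_real a = N (pderiv P * hermite_poly a k)" for P k
  proof -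
    let ?H = "hermite_poly a k"
    have i: "integrable lborel (\<lambda>q. of_real (poly Q q) * gauss (of_real \<omega>) q)" for Q
      by (rule integrable_poly_gauss[OF p])
    have "N (pderiv (P * ?H)) = 2 * of_real \<omega> * (LINT q|lborel. of_real (q * poly (P * ?H) q) * gauss (of_real \<omega>) q)"
      unfolding N_def by (rule integral_pderiv_gauss[OF p])
    also have "\<dots> = 2 * of_real \<omega> * N (pCons 0 (P * ?H))"
      unfolding N_def by (simp del: poly_mult)
    finally have e1: "N (pderiv (P * ?H)) = 2 * of_real \<omega> * N (pCons 0 (P * ?H))" .
    have e2: "N (pderiv (P * ?H)) = N (P * pderiv ?H) + N (pderiv P * ?H)"
      unfolding N_def pderiv_mult
      by (subst Bochner_Integration.integral_add[symmetric, OF i i]) (simp add: algebra_simps)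
    have "N (smult a (P * hermite_poly a (Suc k))) = N (smult (2 * \<omega>) (pCons 0 (P * ?H))) - N (P * pderiv ?H)"
    proof -
      have "a * poly (P * hermite_poly a (Suc k)) q = 2 * \<omega> * (q * poly (P * ?H) q) - poly (P * pderiv ?H) q" for q
        using arg_cong[OF hermite_poly_Suc[of a k q], of "\<lambda>u. poly P q * u"] a by (simp add: algebra_simps)
      then have "of_real (poly (smult a (P * hermite_poly a (Suc k))) q) * gauss (of_real \<omega>) q
        = of_real (poly (smult (2 * \<omega>) (pCons 0 (P * ?H))) q) * gauss (of_real \<omega>) q
          - of_real (poly (P * pderiv ?H) q) * gauss (of_real \<omega>) q" for q
        by (simp only: left_diff_distrib[symmetric] of_real_diff[symmetric] poly_smult poly_pCons add_0)
      then show ?thesis unfolding N_def by (simp only: Bochner_Integration.integral_diff[OF i i])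
    qed
    then have "of_real a * N (P * hermite_poly a (Suc k)) = 2 * of_real \<omega> * N (pCons 0 (P * ?H)) - N (P * pderiv ?H)"
      unfolding N_smult by simp
    also have "\<dots> = N (pderiv P * ?H)"
      unfolding e1[symmetric] e2 by simp
    finally show ?thesis by (simp add: mult.commute)
  qed
  have a0: "complex_of_real a \<noteq> 0" using a by simp
  have base: "N (hermite_poly a 0 * hermite_poly a (Suc k)) = 0" for k
    using step[of "hermite_poly a 0" k] a0 by (simp add: N_def pderiv_1)
  have "N (hermite_poly a m * hermite_poly a n) = of_real (if m = n then 2 ^ n * fact n * sqrt (pi / \<omega>) else 0)" for m n
  proof (induction m arbitrary: n)
    case 0
    show ?case
    proof (cases n)
      case 0
      have "N 1 = (LINT q|lborel. complex_of_real (exp (- \<omega> * q\<^sup>2)))"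
        unfolding N_def by (intro Bochner_Integration.integral_cong) (auto simp: gauss_def exp_of_real[symmetric])
      also have "\<dots> = of_real (sqrt (pi / \<omega>))"
        using integral_gauss[OF \<omega>] by (simp only: integral_complex_of_real)
      finally show ?thesis using 0 by simp
    next
      case (Suc k)
      then show ?thesis using base[of k] by simp
    qed
  next
    case (Suc m)
    show ?case
    proof (cases n)
      case 0
      then show ?thesis using base[of m] by (simp add: mult.commute)
    next
      case (Suc k)
      have "N (hermite_poly a (Suc m) * hermite_poly a (Suc k)) * of_real a
         = (of_real (2 * real (Suc m)) * N (hermite_poly a m * hermite_poly a k)) * of_real a"
        unfolding step pderiv_hermite_poly by (simp add: N_smult del: of_nat_Suc)
      then have "N (hermite_poly a (Suc m) * hermite_poly a (Suc k)) = of_real (2 * real (Suc m)) * N (hermite_poly a m * hermite_poly a k)"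
        using a0 mult_right_cancel by blast
      then show ?thesis using Suc Suc.IH[of k] by (auto simp del: of_nat_Suc)
    qed
  qed
  then show ?thesis unfolding N_def a_def .
qed

lemma hermite_fn_orthonormal:
  assumes \<omega>: "\<omega> > 0"
  shows "l2_inner (hermite_fn \<omega> m) (hermite_fn \<omega> n) = (if m = n then 1 else 0)"
proof -
  let ?I = "(LINT q|lborel. of_real (poly (hermite_poly (sqrt \<omega>) m * hermite_poly (sqrt \<omega>) n) q) * gauss (of_real \<omega>) q)"
  have eq: "cnj (hermite_fn \<omega> m q) * hermite_fn \<omega> n q = of_real (hermite_const \<omega> m * hermite_const \<omega> n) *
     (of_real (poly (hermite_poly (sqrt \<omega>) m * hermite_poly (sqrt \<omega>) n) q) * gauss (of_real \<omega>) q)" for q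
  proof -
    have "gauss (of_real \<omega>) q = gauss (of_real (\<omega>/2)) q * gauss (of_real (\<omega>/2)) q"
      unfolding gauss_mult by simp
    then show ?thesis unfolding hermite_fn_eq by (simp add: cnj_gauss)
  qed
  have "l2_inner (hermite_fn \<omega> m) (hermite_fn \<omega> n) = of_real (hermite_const \<omega> m * hermite_const \<omega> n) * ?I"
    unfolding l2_inner_def eq by (rule integral_mult_right_zero)
  moreover have "(hermite_const \<omega> n)\<^sup>2 * (2 ^ n * fact n * sqrt (pi / \<omega>)) = 1"
    unfolding hermite_const_power2[OF \<omega>] using \<omega> by (simp add: real_sqrt_divide)
  ultimately show ?thesis
    unfolding hermite_orthogonal_integral[OF \<omega>] by (auto simp: power2_eq_square simp flip: of_real_mult)
qed

section \<open>The ground state is a Schwartz function\<close>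

lemma poly_gauss_bounded:
  fixes e :: real
  assumes "e > 0"
  shows "\<exists>B. \<forall>x. \<bar>poly P x * exp (- e * x\<^sup>2)\<bar> \<le> B"
proof -
  let ?f = "\<lambda>x. poly P x * exp (- e * x\<^sup>2)"
  have "\<forall>\<^sub>F x in at_top. \<bar>?f x\<bar> < 1"
    using order_tendstoD(2)[OF tendsto_rabs_zero[OF tendsto_poly_gauss(1)[OF assms]], of 1] by simp
  then obtain R1 where R1: "\<And>x. x \<ge> R1 \<Longrightarrow> \<bar>?f x\<bar> < 1" by (auto simp: eventually_at_top_linorder)
  have "\<forall>\<^sub>F x in at_bot. \<bar>?f x\<bar> < 1"
    using order_tendstoD(2)[OF tendsto_rabs_zero[OF tendsto_poly_gauss(2)[OF assms]], of 1] by simp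
  then obtain R2 where R2: "\<And>x. x \<le> R2 \<Longrightarrow> \<bar>?f x\<bar> < 1" by (auto simp: eventually_at_bot_linorder)
  have "continuous_on {R2..R1} ?f" by (intro continuous_intros)
  then have "bounded (?f ` {R2..R1})" using compact_continuous_image compact_imp_bounded by blast
  then have "\<exists>B. \<forall>x\<in>{R2..R1}. \<bar>?f x\<bar> \<le> B" unfolding bounded_iff by simp
  then obtain B where B: "\<And>x. x \<in> {R2..R1} \<Longrightarrow> \<bar>?f x\<bar> \<le> B" by blast
  have "\<bar>?f x\<bar> \<le> max 1 B" for x
    using R1[of x] R2[of x] B[of x] by (cases "x \<ge> R1"; cases "x \<le> R2") auto
  then show ?thesis by blast
qed

text \<open>\<open>is_evolution\<close> grants the differential equation only for Schwartz initial
  data. Polynomials times a fixed Gaussian are closed under differentiation, so every iterated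
  derivative has this form and is bounded after multiplication by a power.\<close>

lemma schwartz_hermite_fn_0:
  assumes \<omega>: "\<omega> > 0"
  shows "schwartz (hermite_fn \<omega> 0)"
proof -
  define p where "p = \<omega> / 2"
  have p: "p > 0" using \<omega> by (simp add: p_def)
  define f where "f P q = complex_of_real (poly P q) * gauss (of_real p) q" for P q
  have der: "(f P has_vector_derivative f (pderiv P - smult (2 * p) (pCons 0 P)) q) (at q)" for P q
    using poly_gauss_has_vector_derivative[of P "of_real p" q] unfolding f_def[abs_def]
    by (simp add: algebra_simps)
  have iter: "\<exists>P. vderiv_iter k (hermite_fn \<omega> 0) = f P" for k
  proof (induction k)
    case 0
    have "hermite_fn \<omega> 0 = f [:hermite_const \<omega> 0:]"
      by (simp add: fun_eq_iff hermite_fn_eq f_def p_def)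
    then show ?case by (auto simp del: hermite.simps)
  next
    case (Suc k)
    then obtain P where P: "vderiv_iter k (hermite_fn \<omega> 0) = f P" by blast
    have "vderiv_iter (Suc k) (hermite_fn \<omega> 0) = f (pderiv P - smult (2 * p) (pCons 0 P))"
      using der by (simp add: P fun_eq_iff vector_derivative_at)
    then show ?case by blast
  qed
  show ?thesis unfolding schwartz_def
  proof (intro conjI allI)
    fix k x
    obtain P where P: "vderiv_iter k (hermite_fn \<omega> 0) = f P" using iter by blast
    show "vderiv_iter k (hermite_fn \<omega> 0) differentiable at x"
      unfolding P using der by (rule differentiableI_vector)
  next
    fix a k
    obtain P where P: "vderiv_iter k (hermite_fn \<omega> 0) = f P" using iter by blast
    have "\<bar>x\<bar> ^ a * cmod (f P x) = \<bar>poly (monom 1 a * P) x * exp (- p * x\<^sup>2)\<bar>" for x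
      by (simp add: f_def norm_mult norm_gauss poly_monom abs_mult power_abs)
    then show "\<exists>B. \<forall>x. \<bar>x\<bar> ^ a * cmod (vderiv_iter k (hermite_fn \<omega> 0) x) \<le> B"
      unfolding P using poly_gauss_bounded[OF p, of "monom 1 a * P"] by simp
  qed
qed

section \<open>Zeros and the index function\<close>

lemma lin_sol_derivs:
  assumes "lin_sol \<kappa> I u" "open I" "t \<in> I"
  shows "(u has_real_derivative deriv u t) (at t)"
    and "(deriv u has_real_derivative - \<kappa> t * u t) (at t)"
proof -
  obtain u' where u': "\<And>t. t \<in> I \<Longrightarrow> (u has_real_derivative u' t) (at t)"
     "\<And>t. t \<in> I \<Longrightarrow> (u' has_real_derivative - \<kappa> t * u t) (at t)"
    using assms(1) unfolding lin_sol_def by blast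
  have eq: "deriv u x = u' x" if "x \<in> I" for x using u'(1)[OF that] by (rule DERIV_imp_deriv)
  show "(u has_real_derivative deriv u t) (at t)" using u'(1)[OF assms(3)] eq[OF assms(3)] by simp
  \<comment> \<open>\<open>deriv u\<close> agrees with the witness only on \<open>I\<close>;
    openness makes this enough for the derivative at \<open>t\<close>.\<close>
  show "(deriv u has_real_derivative - \<kappa> t * u t) (at t)"
    by (rule has_field_derivative_transform_within_open[OF u'(2)[OF assms(3)] assms(2,3)]) (simp add: eq)
qed

text \<open>The derivative \<open>u v'' - u'' v\<close> vanishes because both functions solve the
  same equation. It serves for \<open>c\<close> and \<open>s\<close> with common base point, and at
  the end for solutions with different base points.\<close>

lemma wronskian_constant:
  assumes u: "lin_sol \<kappa> I u" and v: "lin_sol \<kappa> I v" and I: "open I" "is_interval I" and "x \<in> I" "y \<in> I"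
  shows "u x * deriv v x - deriv u x * v x = u y * deriv v y - deriv u y * v y"
proof -
  have "((\<lambda>x. u x * deriv v x - deriv u x * v x) has_real_derivative 0) (at z within I)" if "z \<in> I" for z
  proof (rule has_field_derivative_at_within)
    note d = lin_sol_derivs[OF u I(1) that] lin_sol_derivs[OF v I(1) that]
    show "((\<lambda>x. u x * deriv v x - deriv u x * v x) has_real_derivative 0) (at z)"
      by (rule DERIV_cong[OF DERIV_diff[OF DERIV_mult[OF d(1,4)] DERIV_mult[OF d(2,3)]]]) simp
  qed
  then obtain k where "\<And>z. z \<in> I \<Longrightarrow> u z * deriv v z - deriv u z * v z = k"
    using has_field_derivative_zero_constant[OF is_interval_convex[OF I(2)],
        of "\<lambda>x. u x * deriv v x - deriv u x * v x"] by metis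
  then show ?thesis using assms by simp
qed

text \<open>One inequality for both sides of the zero: \<open>u\<close> has the sign of
  \<open>l\<close> to the right and the opposite sign to the left.\<close>

lemma simple_zero_eventually_sign:
  fixes u :: "real \<Rightarrow> real"
  assumes "(u has_real_derivative l) (at x)" "l \<noteq> 0" "u x = 0"
  shows "\<forall>\<^sub>F y in at x. 0 < l * (u y * (y - x))"
proof -
  have "((\<lambda>y. l * ((u y - u x) / (y - x))) \<longlongrightarrow> l * l) (at x)"
    using assms(1) by (intro tendsto_mult_left) (simp add: has_field_derivative_iff)
  moreover have "l * l > 0" using assms(2) by (simp add: zero_less_mult_iff) linarith
  ultimately have "\<forall>\<^sub>F y in at x. 0 < l * ((u y - u x) / (y - x))" by (rule order_tendstoD(1))
  then show ?thesis using eventually_neq_at_within[of x x]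
  proof eventually_elim
    case (elim y)
    then have "0 < (l * ((u y - u x) / (y - x))) * (y - x)\<^sup>2"
      by (simp only: zero_less_mult_iff[of "l * ((u y - u x) / (y - x))"]) simp
    then show ?case using elim assms(3) by (simp add: power2_eq_square mult_ac)
  qed
qed

text \<open>\<open>card\<close> is 0 on infinite sets, so \<open>index_fn\<close> counts zeros only
  once finiteness is known. Infinitely many zeros would accumulate at a point that is a zero by
  continuity, and a simple zero is isolated.\<close>

lemma finite_simple_zeros:
  fixes u :: "real \<Rightarrow> real"
  assumes der: "\<And>x. x \<in> {a..b} \<Longrightarrow> (u has_real_derivative u' x) (at x)"
    and simple: "\<And>x. x \<in> {a..b} \<Longrightarrow> u x = 0 \<Longrightarrow> u' x \<noteq> 0"
  shows "finite {x \<in> {a..b}. u x = 0}"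
proof (rule ccontr)
  let ?Z = "{x \<in> {a..b}. u x = 0}"
  assume "infinite ?Z"
  then obtain x where x: "x \<in> {a..b}" "x islimpt ?Z"
    using compact_Icc[of a b] unfolding compact_eq_Bolzano_Weierstrass by (metis (no_types, lifting) mem_Collect_eq subsetI)
  have freq: "\<exists>\<^sub>F y in at x. y \<in> ?Z"
    using x(2) by (simp add: islimpt_conv_frequently_at)
  have "u x = 0"
  proof (rule ccontr)
    assume "u x \<noteq> 0"
    moreover have "(u \<longlongrightarrow> u x) (at x)" using DERIV_isCont[OF der[OF x(1)]] by (simp add: isCont_def)
    ultimately have "\<forall>\<^sub>F y in at x. u y \<noteq> 0" using tendsto_imp_eventually_ne by blast
    then have "\<forall>\<^sub>F y in at x. y \<notin> ?Z" by (rule eventually_mono) simp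
    with freq show False by (simp add: frequently_def)
  qed
  then have "\<forall>\<^sub>F y in at x. y \<notin> ?Z"
    using simple_zero_eventually_sign[OF der[OF x(1)] simple[OF x(1)]] by (auto elim: eventually_mono)
  with freq show False by (auto simp: frequently_def)
qed

text \<open>The counting property that characterises the index function, recovered from a definition
  that splits on the side of \<open>t0\<close>.\<close>

lemma index_fn_diff:
  assumes fin: "\<And>x y. x \<in> J \<Longrightarrow> y \<in> J \<Longrightarrow> finite {\<tau>. x < \<tau> \<and> \<tau> \<le> y \<and> s \<tau> t0 = 0}"
    and J: "t0 \<in> J" "t1 \<in> J" "t2 \<in> J" and le: "t1 \<le> t2"
  shows "index_fn s t2 t0 - index_fn s t1 t0 = int (card {\<tau>. t1 < \<tau> \<and> \<tau> \<le> t2 \<and> s \<tau> t0 = 0})"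
proof -
  define Z where "Z x y = {\<tau>. x < \<tau> \<and> \<tau> \<le> y \<and> s \<tau> t0 = 0}" for x y
  have add: "card (Z x z) = card (Z x y) + card (Z y z)" if "x \<le> y" "y \<le> z" "x \<in> J" "y \<in> J" "z \<in> J" for x y z
  proof -
    have "Z x z = Z x y \<union> Z y z" "Z x y \<inter> Z y z = {}" using that by (auto simp: Z_def)
    then show ?thesis using card_Un_disjoint[of "Z x y" "Z y z"] fin that by (simp add: Z_def)
  qed
  have "Z t0 t0 = {}" by (auto simp: Z_def)
  then have idx: "index_fn s t t0 = (if t0 \<le> t then int (card (Z t0 t)) else - int (card (Z t t0)))" for t
    by (simp add: index_fn_def Z_def)
  show ?thesis
    unfolding Z_def[symmetric] idx
    \<comment> \<open>\<open>t0\<close> may lie before, between or after the two times; each order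
      is one use of additivity.\<close>
    using add[of t0 t1 t2] add[of t1 t0 t2] add[of t1 t2 t0] J le by auto
qed

text \<open>Zeros are isolated and the counting interval is closed on the right. So the index is
  continuous from the right, and a zero at \<open>x\<close> is missing only from the values to its
  left.\<close>

lemma index_fn_locally:
  fixes s :: "real \<Rightarrow> real \<Rightarrow> real"
  assumes J: "open J" "is_interval J" "t0 \<in> J" "x \<in> J"
    and der: "\<And>x. x \<in> J \<Longrightarrow> ((\<lambda>t. s t t0) has_real_derivative s' x) (at x)"
    and simple: "\<And>x. x \<in> J \<Longrightarrow> s x t0 = 0 \<Longrightarrow> s' x \<noteq> 0"
  shows "\<forall>\<^sub>F y in at x. index_fn s y t0 = index_fn s x t0 - (if y < x \<and> s x t0 = 0 then 1 else 0)"
proof -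
  have fin: "finite {\<tau>. a < \<tau> \<and> \<tau> \<le> b \<and> s \<tau> t0 = 0}" if "a \<in> J" "b \<in> J" for a b
  proof (rule finite_subset)
    have "{a..b} \<subseteq> J" using mem_is_interval_1_I[OF J(2) that] by (simp add: subset_iff)
    then show "finite {x \<in> {a..b}. s x t0 = 0}"
      using der simple by (intro finite_simple_zeros[of a b "\<lambda>t. s t t0" s']) (simp_all add: subset_iff)
  qed auto
  have "\<forall>\<^sub>F y in at x. s y t0 \<noteq> 0"
  proof (cases "s x t0 = 0")
    case True
    from simple_zero_eventually_sign[OF der[OF J(4)] simple[OF J(4) True] True]
    show ?thesis by (auto elim: eventually_mono)
  next
    case False
    moreover have "((\<lambda>t. s t t0) \<longlongrightarrow> s x t0) (at x)" using DERIV_isCont[OF der[OF J(4)]] by (simp add: isCont_def)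
    ultimately show ?thesis using tendsto_imp_eventually_ne by blast
  qed
  then obtain d1 where d1: "d1 > 0" "\<And>y. y \<noteq> x \<Longrightarrow> dist y x < d1 \<Longrightarrow> s y t0 \<noteq> 0"
    by (auto simp: eventually_at)
  obtain d2 where d2: "d2 > 0" "ball x d2 \<subseteq> J" using J(1,4) openE by blast
  show ?thesis
    unfolding eventually_at
  proof (intro exI[of _ "min d1 d2"] conjI ballI impI)
    fix y assume y: "y \<noteq> x \<and> dist y x < min d1 d2"
    then have yJ: "y \<in> J" using d2 by (auto simp: dist_commute)
    show "index_fn s y t0 = index_fn s x t0 - (if y < x \<and> s x t0 = 0 then 1 else 0)"
    proof (cases "x < y")
      case True
      have "{\<tau>. x < \<tau> \<and> \<tau> \<le> y \<and> s \<tau> t0 = 0} = {}"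
        using y True d1(2) by (auto simp: dist_real_def)
      moreover have "index_fn s y t0 - index_fn s x t0 = int (card {\<tau>. x < \<tau> \<and> \<tau> \<le> y \<and> s \<tau> t0 = 0})"
        using index_fn_diff[of J s t0 x y, OF fin] J yJ True by simp
      ultimately have "index_fn s y t0 - index_fn s x t0 = 0" by (metis card.empty of_nat_0)
      then show ?thesis using True by simp
    next
      case False
      then have lt: "y < x" using y by simp
      have "{\<tau>. y < \<tau> \<and> \<tau> \<le> x \<and> s \<tau> t0 = 0} = (if s x t0 = 0 then {x} else {})"
      proof -
        have "\<tau> = x" if "y < \<tau>" "\<tau> \<le> x" "s \<tau> t0 = 0" for \<tau>
          using d1(2)[of \<tau>] that y by (cases "\<tau> = x") (auto simp: dist_real_def)
        then show ?thesis using lt by auto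
      qed
      then have "int (card {\<tau>. y < \<tau> \<and> \<tau> \<le> x \<and> s \<tau> t0 = 0}) = (if s x t0 = 0 then 1 else 0)" by simp
      then show ?thesis using index_fn_diff[of J s t0 y x, OF fin] J yJ lt by auto
    qed
  qed (use d1 d2 in auto)
qed

section \<open>Branches of the square root\<close>

lemma csqrt_scale:
  assumes "r > 0"
  shows "csqrt (complex_of_real r * z) = of_real (sqrt r) * csqrt z"
proof (rule csqrt_unique)
  show "(of_real (sqrt r) * csqrt z)\<^sup>2 = of_real r * z"
    using assms by (simp add: power_mult_distrib flip: of_real_power)
  show "0 < Re (of_real (sqrt r) * csqrt z) \<or> Re (of_real (sqrt r) * csqrt z) = 0 \<and> 0 \<le> Im (of_real (sqrt r) * csqrt z)"
    using csqrt_principal[of z] assms by auto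
qed

text \<open>If \<open>v\<close> lies in the right half plane, its principal root has argument
  strictly between -pi/4 and pi/4. A turn by pi/4 either way keeps the root in the right half plane,
  hence principal.\<close>

lemma csqrt_rotate:
  assumes "Re v > 0"
  shows "csqrt (\<i> * v) = cis (pi / 4) * csqrt v" and "csqrt (- \<i> * v) = cis (- pi / 4) * csqrt v"
proof -
  define x y where "x = Re (csqrt v)" and "y = Im (csqrt v)"
  have "(csqrt v)\<^sup>2 = v" by simp
  then have "Re v = x\<^sup>2 - y\<^sup>2" by (metis Re_power2 x_def y_def)
  \<comment> \<open>This is the argument bound in Cartesian form.\<close>
  then have "y\<^sup>2 < x\<^sup>2" using assms by simp
  moreover have "x \<ge> 0" unfolding x_def using csqrt_principal[of v] by auto
  ultimately have xy: "\<bar>y\<bar> < x" by (metis power2_abs power2_less_imp_less)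
  have c: "cos (pi / 4) > 0" "sin (pi/4) = cos (pi/4)" by (simp_all add: cos_45 sin_45)
  have "cis (pi/4) ^ 2 = cis (pi/2)" "cis (- pi/4) ^ 2 = cis (- (pi/2))"
    by (simp_all only: power2_eq_square cis_mult) simp_all
  then have sq: "cis (pi/4) ^ 2 = \<i>" "cis (- pi/4) ^ 2 = - \<i>"
    by (simp_all add: complex_eq_iff)
  have "Re (cis (pi / 4) * csqrt v) = cos (pi/4) * (x - y)" "Re (cis (- pi / 4) * csqrt v) = cos (pi/4) * (x + y)"
    by (simp_all add: x_def y_def c algebra_simps)
  moreover have "cos (pi/4) * (x - y) > 0" "cos (pi/4) * (x + y) > 0"
    using xy c by (auto intro!: mult_pos_pos)
  ultimately have pos: "Re (cis (pi / 4) * csqrt v) > 0" "Re (cis (- pi / 4) * csqrt v) > 0" by simp_all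
  show "csqrt (\<i> * v) = cis (pi / 4) * csqrt v"
    by (rule csqrt_unique) (use pos sq in \<open>auto simp only: power_mult_distrib power2_csqrt\<close>)
  show "csqrt (- \<i> * v) = cis (- pi / 4) * csqrt v"
    by (rule csqrt_unique) (use pos sq in \<open>auto simp only: power_mult_distrib power2_csqrt\<close>)
qed

lemma cis_power4_index: "cis (- pi / 2 * real_of_int m) ^ 4 = 1"
proof -
  have "cis (- pi / 2 * real_of_int m) ^ 4 = cis (2 * pi * real_of_int (- m))"
    by (rule trans[OF Complex.DeMoivre arg_cong[where f=cis]]) simp
  also have "\<dots> = 1" by (rule cis_multiple_2pi) simp
  finally show ?thesis .
qed

text \<open>Identifies the continuous root \<open>G\<close> of \<open>w\<close> that starts at 1.
  The assumption \<open>nonzero\<close> keeps the principal root off its cut while \<open>s\<close>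
  does not vanish. The assumption \<open>zero\<close> puts \<open>w\<close>, up to the sign of
  \<open>s'\<close>, in the right half plane when \<open>s\<close> vanishes, so that the jump of the
  principal root there is exactly a quarter turn, undone by the jump of the index.\<close>

lemma continuous_root_eq_index_branch:
  fixes s :: "real \<Rightarrow> real \<Rightarrow> real" and w G :: "real \<Rightarrow> complex"
  assumes J: "open J" "is_interval J" "t0 \<in> J" "t \<in> J"
    and der: "\<And>x. x \<in> J \<Longrightarrow> ((\<lambda>t. s t t0) has_real_derivative s' x) (at x)"
    and w: "continuous_on J w" "\<And>x. x \<in> J \<Longrightarrow> w x \<noteq> 0"
    and zero: "\<And>x. x \<in> J \<Longrightarrow> s x t0 = 0 \<Longrightarrow> 0 < s' x * Re (w x)"
    and nonzero: "\<And>x. x \<in> J \<Longrightarrow> s x t0 \<noteq> 0 \<Longrightarrow> \<i> * of_real (s x t0) * w x \<notin> \<real>\<^sub>\<le>\<^sub>0"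
    and G: "continuous_on J G" "\<And>x. x \<in> J \<Longrightarrow> (G x)\<^sup>2 = w x"
    and init: "s t0 t0 = 0" "0 < s' t0" "G t0 = 1"
    and t: "s t t0 \<noteq> 0"
  shows "G t = csqrt (\<i> * of_real (s t t0) * w t) * cis (- pi / 4) * s_inv_sqrt s t t0"
proof -
  define u where "u x = s x t0" for x
  define m where "m x = index_fn s x t0" for x
  \<comment> \<open>The claimed formula, without the factors \<open>|s|\<close>; at a zero of \<open>s\<close> it is given the common one-sided limit.\<close>
  define F where "F x = (if u x \<noteq> 0 then csqrt (\<i> * of_real (sgn (u x)) * w x) * cis (- pi / 4)
       else csqrt (of_real (sgn (s' x)) * w x)) * cis (- pi / 2 * real_of_int (m x))" for x
  have isw: "isCont w x" if "x \<in> J" for x using w(1) J(1) that continuous_on_eq_continuous_at by blast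
  have simple: "s x t0 = 0 \<Longrightarrow> s' x \<noteq> 0" if "x \<in> J" for x using zero[OF that] by auto
  have idx: "\<forall>\<^sub>F y in at x. m y = m x - (if y < x \<and> u x = 0 then 1 else 0)" if "x \<in> J" for x
    unfolding m_def u_def by (rule index_fn_locally[where s'=s', OF J(1-3) that]) (fact der simple)+
  \<comment> \<open>The square of \<open>F\<close> is \<open>w\<close> only up to a sign that
    depends on the parity of the index. The fourth power removes that sign, and finitely many
    possible quotients are all that the connectedness argument requires.\<close>
  have F4: "F x ^ 4 = (w x)\<^sup>2" if "x \<in> J" for x
  proof -
    have q: "v ^ 4 = (v\<^sup>2)\<^sup>2" for v :: complex by (simp flip: power_mult)
    have c: "cis (- pi / 4) ^ 4 = -1" 
      by (rule trans[OF Complex.DeMoivre trans[OF arg_cong[where f=cis, of _ "- pi"]]]) (simp_all add: complex_eq_iff)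
    have "(complex_of_real (sgn r))\<^sup>2 = 1" if "r \<noteq> 0" for r :: real
      using that by (simp add: sgn_if)
    moreover have "s' x \<noteq> 0" if "u x = 0" using simple[OF \<open>x \<in> J\<close>] that by (simp add: u_def)
    ultimately have sg: "u x \<noteq> 0 \<Longrightarrow> (complex_of_real (sgn (u x)))\<^sup>2 = 1"
        "u x = 0 \<Longrightarrow> (complex_of_real (sgn (s' x)))\<^sup>2 = 1" by blast+
    have r: "csqrt v ^ 4 = v\<^sup>2" for v by (simp only: q power2_csqrt)
    show ?thesis
    proof (cases "u x = 0")
      case True
      then have Fx: "F x = csqrt (of_real (sgn (s' x)) * w x) * cis (- pi / 2 * real_of_int (m x))"
        by (simp add: F_def)
      have "F x ^ 4 = (of_real (sgn (s' x)) * w x)\<^sup>2"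
        unfolding Fx power_mult_distrib[of "csqrt _"] cis_power4_index r by simp
      then show ?thesis using sg(2)[OF True] by (simp only: power_mult_distrib mult_1)
    next
      case False
      then have Fx: "F x = csqrt (\<i> * of_real (sgn (u x)) * w x) * cis (- pi / 4) * cis (- pi / 2 * real_of_int (m x))"
        by (simp add: F_def)
      have "F x ^ 4 = (\<i> * of_real (sgn (u x)) * w x)\<^sup>2 * (- 1)"
        unfolding Fx power_mult_distrib[of "csqrt _ * _"] power_mult_distrib[of "csqrt _"] cis_power4_index r c by simp
      then show ?thesis using sg(1)[OF False] by (simp only: power_mult_distrib) simp
    qed
  qed
  have contF: "isCont F x" if x: "x \<in> J" for x
  proof (cases "u x = 0")
    case False
    define \<sigma> where "\<sigma> = sgn (u x)"
    \<comment> \<open>Away from zeros the sign of \<open>s\<close> and the index are locally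
      constant, so \<open>F\<close> is locally a principal root times a constant.\<close>
    let ?g = "\<lambda>y. csqrt (\<i> * of_real \<sigma> * w y) * cis (- pi / 4) * cis (- pi / 2 * real_of_int (m x))"
    have nin: "\<i> * of_real \<sigma> * w x \<notin> \<real>\<^sub>\<le>\<^sub>0"
    proof
      assume *: "\<i> * of_real \<sigma> * w x \<in> \<real>\<^sub>\<le>\<^sub>0"
      have "\<i> * of_real (s x t0) * w x = of_real \<bar>u x\<bar> * (\<i> * of_real \<sigma> * w x)"
        by (simp add: u_def \<sigma>_def sgn_if)
      also have "\<dots> \<in> \<real>\<^sub>\<le>\<^sub>0" using * by (auto simp: complex_nonpos_Reals_iff mult_nonneg_nonpos)
      finally show False using nonzero[OF x] False by (simp add: u_def)
    qed
    have "isCont csqrt (\<i> * of_real \<sigma> * w x)" using nin by (rule continuous_at_csqrt)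
    moreover have "isCont (\<lambda>y. \<i> * of_real \<sigma> * w y) x" by (intro continuous_intros isw x)
    ultimately have "isCont (\<lambda>y. csqrt (\<i> * of_real \<sigma> * w y)) x"
      using isCont_o2 by blast
    then have cg: "isCont ?g x" by (intro continuous_intros)
    have "isCont u x" unfolding u_def[abs_def] using der[OF x] by (rule DERIV_isCont)
    then have "(u \<longlongrightarrow> u x) (nhds x)" by (simp add: isCont_def tendsto_at_iff_tendsto_nhds)
    then have "((\<lambda>y. u y * u x) \<longlongrightarrow> u x * u x) (nhds x)" by (intro tendsto_intros)
    moreover have "0 < u x * u x" using False by (simp add: zero_less_mult_iff) linarith
    ultimately have "\<forall>\<^sub>F y in nhds x. 0 < u y * u x" by (rule order_tendstoD(1))
    moreover have "\<forall>\<^sub>F y in nhds x. m y = m x"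
      using idx[OF x] False by (simp add: eventually_nhds_conv_at)
    ultimately have "\<forall>\<^sub>F y in nhds x. F y = ?g y"
    proof eventually_elim
      case (elim y)
      then have "sgn (u y) = \<sigma>" "u y \<noteq> 0" by (auto simp: \<sigma>_def sgn_if zero_less_mult_iff)
      then show ?case using elim by (simp add: F_def)
    qed
    from isCont_cong[OF this] cg show ?thesis by simp
  next
    case True
    define \<sigma> where "\<sigma> = sgn (s' x)"
    \<comment> \<open>The common form of \<open>F\<close> on both sides of the zero. It uses the
      index at \<open>x\<close> itself, which is also the index just to the right.\<close>
    let ?g = "\<lambda>y. csqrt (of_real \<sigma> * w y) * cis (- pi / 2 * real_of_int (m x))"
    have s0: "s' x \<noteq> 0" using simple[OF x] True by (simp add: u_def)
    have pos: "0 < Re (of_real \<sigma> * w x)" using zero[OF x] True s0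
      by (auto simp: u_def \<sigma>_def sgn_if zero_less_mult_iff split: if_splits)
    then have "of_real \<sigma> * w x \<notin> \<real>\<^sub>\<le>\<^sub>0" by (auto simp: complex_nonpos_Reals_iff)
    then have "isCont csqrt (of_real \<sigma> * w x)" by (rule continuous_at_csqrt)
    moreover have c1: "isCont (\<lambda>y. of_real \<sigma> * w y) x" by (intro continuous_intros isw x)
    ultimately have "isCont (\<lambda>y. csqrt (of_real \<sigma> * w y)) x"
      using isCont_o2 by blast
    then have cg: "isCont ?g x" by (intro continuous_intros)
    have "\<forall>\<^sub>F y in at x. 0 < s' x * (u y * (y - x))"
      using simple_zero_eventually_sign[OF der[OF x] s0] True by (simp add: u_def)
    moreover have "((\<lambda>y. Re (of_real \<sigma> * w y)) \<longlongrightarrow> Re (of_real \<sigma> * w x)) (at x)"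
      using c1 unfolding isCont_def by (rule tendsto_Re)
    then have "\<forall>\<^sub>F y in at x. 0 < Re (of_real \<sigma> * w y)" using pos by (rule order_tendstoD(1))
    ultimately have "\<forall>\<^sub>F y in at x. F y = ?g y"
      using idx[OF x] eventually_neq_at_within[of x x]
    proof eventually_elim
      case (elim y)
      have uy: "u y \<noteq> 0" using elim by auto
      show ?case
      proof (cases "x < y")
        case gt: True
        have "sgn (u y) = \<sigma>" using elim gt
          by (auto simp: \<sigma>_def sgn_if zero_less_mult_iff mult_less_0_iff split: if_splits)
        moreover have "m y = m x" using elim gt by simp
        moreover have "csqrt (\<i> * (of_real \<sigma> * w y)) * cis (- pi / 4) = csqrt (of_real \<sigma> * w y)"
          using csqrt_rotate(1)[OF elim(2)] by (simp add: cis_mult mult.commute mult.left_commute)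
        ultimately show ?thesis using uy by (simp add: F_def mult.assoc)
      next
        case lt: False
        then have lt: "y < x" using elim by simp
        have sg: "complex_of_real (sgn (u y)) = - of_real \<sigma>" using elim lt
          by (auto simp: \<sigma>_def sgn_if zero_less_mult_iff mult_less_0_iff split: if_splits)
        have my: "m y = m x - 1" using elim lt True by simp
        have "csqrt (\<i> * of_real (sgn (u y)) * w y) = csqrt (- \<i> * (of_real \<sigma> * w y))"
          by (simp add: sg mult.assoc)
        also have "\<dots> = cis (- pi / 4) * csqrt (of_real \<sigma> * w y)"
          using csqrt_rotate(2)[OF elim(2)] .
        finally have "F y = (cis (- pi / 4) * cis (- pi / 4) * cis (- pi / 2 * real_of_int (m x - 1))) * csqrt (of_real \<sigma> * w y)"
          using uy by (simp add: F_def my mult_ac)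
        \<comment> \<open>To the left, the constant factor and the rotation of the root add up to a
          turn by -pi/2, and the index smaller by one contributes the opposite turn.\<close>
        also have "cis (- pi / 4) * cis (- pi / 4) * cis (- pi / 2 * real_of_int (m x - 1)) = cis (- pi / 2 * real_of_int (m x))"
          unfolding cis_mult by (rule arg_cong[where f=cis]) (simp add: algebra_simps)
        finally show ?thesis by (simp add: mult.commute)
      qed
    qed
    moreover have "F x = ?g x" using True by (simp add: F_def \<sigma>_def)
    ultimately have "\<forall>\<^sub>F y in nhds x. F y = ?g y" by (simp add: eventually_nhds_conv_at)
    from isCont_cong[OF this] cg show ?thesis by simp
  qed
  have F0: "F x \<noteq> 0" if "x \<in> J" for x using F4[OF that] w(2)[OF that] by auto
  have "continuous_on J (\<lambda>x. G x / F x)"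
    using F0 contF by (intro continuous_on_divide G continuous_at_imp_continuous_on) auto
  moreover have "(\<lambda>x. G x / F x) ` J \<subseteq> {z. z ^ 4 = 1}"
  proof (rule image_subsetI)
    fix x assume x: "x \<in> J"
    have "G x ^ 4 = (w x)\<^sup>2" unfolding G(2)[OF x, symmetric] by (simp flip: power_mult)
    then show "G x / F x \<in> {z. z ^ 4 = 1}" using F4[OF x] w(2)[OF x] by (simp add: power_divide)
  qed
  then have "finite ((\<lambda>x. G x / F x) ` J)" 
    by (rule finite_subset) (intro finite_roots_unity, simp)
  ultimately have "(\<lambda>x. G x / F x) constant_on J"
    by (intro continuous_finite_range_constant is_interval_connected J(2))
  then have "G t / F t = G t0 / F t0" using J by (auto simp: constant_on_def)
  moreover have "F t0 = 1"
  proof -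
    have "w t0 = 1" using G(2)[OF J(3)] init by simp
    moreover have "m t0 = 0"
    proof -
      have "{\<tau>. t0 < \<tau> \<and> \<tau> \<le> t0 \<and> s \<tau> t0 = 0} = {}" by auto
      then show ?thesis unfolding m_def index_fn_def by (metis card.empty of_nat_0 order_refl)
    qed
    ultimately show ?thesis using init by (simp add: F_def u_def)
  qed
  ultimately have "G t = F t" using init F0[OF J(4)] by simp
  also have "\<dots> = csqrt (\<i> * of_real (s t t0) * w t) * cis (- pi / 4) * s_inv_sqrt s t t0"
  proof -
    have "csqrt (\<i> * of_real (s t t0) * w t) = csqrt (of_real \<bar>u t\<bar> * (\<i> * of_real (sgn (u t)) * w t))"
      by (rule arg_cong[where f=csqrt]) (simp add: u_def sgn_if)
    also have "\<dots> = of_real (sqrt \<bar>u t\<bar>) * csqrt (\<i> * of_real (sgn (u t)) * w t)"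
      using t by (intro csqrt_scale) (simp add: u_def)
    finally have c: "csqrt (\<i> * of_real (s t t0) * w t) = of_real (sqrt \<bar>u t\<bar>) * csqrt (\<i> * of_real (sgn (u t)) * w t)" .
    have "sqrt \<bar>u t\<bar> * \<bar>u t\<bar> powr (-1/2) = 1"
      using t by (simp add: u_def powr_half_sqrt[symmetric] flip: powr_add)
    then have "complex_of_real (sqrt \<bar>u t\<bar>) * of_real (\<bar>u t\<bar> powr (-1/2)) = 1" by (simp flip: of_real_mult)
    then show ?thesis unfolding c s_inv_sqrt_def F_def m_def u_def using t by (simp add: mult_ac)
  qed
  finally show ?thesis .
qed

section \<open>Gaussian wave packets\<close>

text \<open>Dominated convergence is stated for sequences and the limit in \<open>h\<close> is over
  reals, hence the passage to arbitrary sequences tending to 0.\<close>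

lemma l2_norm_tendsto_0_dominated:
  fixes F :: "real \<Rightarrow> real \<Rightarrow> complex" and w :: "real \<Rightarrow> real"
  assumes meas: "\<And>h. F h \<in> borel_measurable lborel"
    and w: "integrable lborel (\<lambda>q. (w q)\<^sup>2)"
    and bound: "\<forall>\<^sub>F h in at 0. \<forall>q. cmod (F h q) \<le> w q"
    and lim: "\<And>q. ((\<lambda>h. F h q) \<longlongrightarrow> 0) (at 0)"
  shows "((\<lambda>h. l2_norm (F h)) \<longlongrightarrow> 0) (at 0)"
  unfolding tendsto_at_iff_sequentially
proof (intro allI impI)
  fix X :: "nat \<Rightarrow> real"
  assume X: "\<forall>i. X i \<in> UNIV - {0}" "X \<longlonglongrightarrow> 0"
  have X0: "filterlim X (at 0) sequentially" using X by (auto simp: filterlim_at)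
  from eventually_compose_filterlim[OF bound X0]
  obtain N where N: "\<And>n q. n \<ge> N \<Longrightarrow> cmod (F (X n) q) \<le> w q" by (auto simp: eventually_sequentially)
  \<comment> \<open>The bound holds only near 0; the shift by \<open>N\<close> makes it valid for
    every index.\<close>
  have "(\<lambda>n. LINT q|lborel. (cmod (F (X (n + N)) q))\<^sup>2) \<longlonglongrightarrow> integral\<^sup>L lborel (\<lambda>q::real. 0::real)"
  proof (rule integral_dominated_convergence[where w="\<lambda>q. (w q)\<^sup>2"])
    show "(\<lambda>q. (cmod (F (X (n + N)) q))\<^sup>2) \<in> borel_measurable lborel" for n
      using meas[of "X (n + N)"] by measurable
    have "(\<lambda>n. (cmod (F (X (n + N)) q))\<^sup>2) \<longlonglongrightarrow> 0" for q
    proof -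
      have "(\<lambda>n. F (X n) q) \<longlonglongrightarrow> 0" using filterlim_compose[OF lim X0] .
      then have "(\<lambda>n. F (X (n + N)) q) \<longlonglongrightarrow> 0" by (rule LIMSEQ_ignore_initial_segment)
      from tendsto_power[OF tendsto_norm_zero[OF this], of 2] show ?thesis by simp
    qed
    then show "AE q in lborel. (\<lambda>n. (cmod (F (X (n + N)) q))\<^sup>2) \<longlonglongrightarrow> 0" by simp
    show "AE q in lborel. norm ((cmod (F (X (n + N)) q))\<^sup>2) \<le> (w q)\<^sup>2" for n
      using N[of "n + N"] by (intro AE_I2) (simp add: power_mono)
  qed (use w in simp_all)
  then have "(\<lambda>n. sqrt (LINT q|lborel. (cmod (F (X (n + N)) q))\<^sup>2)) \<longlonglongrightarrow> sqrt 0"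
    by (intro tendsto_real_sqrt) simp
  then have "(\<lambda>n. l2_norm (F (X (n + N)))) \<longlonglongrightarrow> 0" by (simp add: l2_norm_def)
  then have "(\<lambda>n. l2_norm (F (X n))) \<longlonglongrightarrow> 0" by (rule LIMSEQ_offset)
  then show "((\<lambda>h. l2_norm (F h)) \<circ> X) \<longlonglongrightarrow> 0" by (simp add: comp_def)
qed

lemma gauss_parameter_has_vector_derivative:
  assumes "(p has_vector_derivative p') (at x)" "(A has_vector_derivative A') (at x)"
  shows "((\<lambda>\<tau>. A \<tau> * gauss (p \<tau>) q) has_vector_derivative (A' - A x * p' * of_real (q\<^sup>2)) * gauss (p x) q) (at x)"
proof -
  have "((\<lambda>u. exp (- u * of_real (q\<^sup>2))) has_field_derivative (- of_real (q\<^sup>2) * gauss (p x) q)) (at (p x))"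
    unfolding gauss_def by (auto intro!: derivative_eq_intros)
  from field_vector_diff_chain_at[OF assms(1) this]
  have g: "((\<lambda>\<tau>. gauss (p \<tau>) q) has_vector_derivative p' * (- of_real (q\<^sup>2) * gauss (p x) q)) (at x)"
    by (simp add: comp_def gauss_def)
  show ?thesis
    by (rule has_vector_derivative_eq_rhs[OF has_vector_derivative_mult[OF assms(2) g]]) (simp add: algebra_simps)
qed

text \<open>The pointwise derivative in the parameter is upgraded to one in norm. Near
  \<open>x\<close> the real part of \<open>p\<close> stays above a fixed positive number, so the
  mean value inequality dominates all difference quotients by one polynomial times one
  Gaussian.\<close>

lemma gauss_has_l2_derivative:
  fixes p A :: "real \<Rightarrow> complex"
  assumes pos: "0 < Re (p x)"
    and der: "\<forall>\<^sub>F y in nhds x. (p has_vector_derivative p' y) (at y) \<and> (A has_vector_derivative A' y) (at y)"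
    and cont: "isCont p' x" "isCont A' x"
  shows "has_l2_derivative (\<lambda>\<tau> q. A \<tau> * gauss (p \<tau>) q) (\<lambda>q. (A' x - A x * p' x * of_real (q\<^sup>2)) * gauss (p x) q) x"
proof -
  define f where "f \<tau> q = A \<tau> * gauss (p \<tau>) q" for \<tau> q
  define f' where "f' \<tau> q = (A' \<tau> - A \<tau> * p' \<tau> * of_real (q\<^sup>2)) * gauss (p \<tau>) q" for \<tau> q
  define \<epsilon> where "\<epsilon> = Re (p x) / 2"
  have \<epsilon>: "\<epsilon> > 0" "\<epsilon> < Re (p x)" using pos by (auto simp: \<epsilon>_def)
  \<comment> \<open>The added 1 makes the bounds strict at \<open>x\<close>, so they persist in a
    neighbourhood.\<close>
  define C where "C = max (cmod (A' x)) (cmod (A x * p' x)) + 1"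
  have C: "cmod (A' x) < C" "cmod (A x * p' x) < C" "C > 0"
    unfolding C_def by (auto simp: max_def intro: add_nonneg_pos)
  have derx: "(p has_vector_derivative p' x) (at x)" "(A has_vector_derivative A' x) (at x)"
    using eventually_nhds_x_imp_x[OF der] by auto
  have nh: "(g \<longlongrightarrow> g x) (nhds x)" if "isCont g x" for g :: "real \<Rightarrow> 'b::topological_space"
    using that by (simp add: isCont_def tendsto_at_iff_tendsto_nhds)
  note t = nh[OF has_vector_derivative_continuous[OF derx(1)]] nh[OF has_vector_derivative_continuous[OF derx(2)]]
    nh[OF cont(1)] nh[OF cont(2)]
  have e1: "\<forall>\<^sub>F y in nhds x. \<epsilon> < Re (p y)" by (rule order_tendstoD(1)[OF tendsto_Re[OF t(1)] \<epsilon>(2)])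
  have e2: "\<forall>\<^sub>F y in nhds x. cmod (A' y) < C" by (rule order_tendstoD(2)[OF tendsto_norm[OF t(4)] C(1)])
  have e3: "\<forall>\<^sub>F y in nhds x. cmod (A y * p' y) < C"
    by (rule order_tendstoD(2)[OF tendsto_norm[OF tendsto_mult[OF t(2) t(3)]] C(2)])
  from der e1 e2 e3 have "\<forall>\<^sub>F y in nhds x. ((p has_vector_derivative p' y) (at y) \<and> (A has_vector_derivative A' y) (at y))
     \<and> \<epsilon> < Re (p y) \<and> cmod (A' y) < C \<and> cmod (A y * p' y) < C"
    by eventually_elim simp
  then obtain d where d: "d > 0"
    and dd: "\<And>y. dist y x < d \<Longrightarrow> ((p has_vector_derivative p' y) (at y) \<and> (A has_vector_derivative A' y) (at y))
     \<and> \<epsilon> < Re (p y) \<and> cmod (A' y) < C \<and> cmod (A y * p' y) < C"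
    unfolding eventually_nhds_metric by blast
  define W where "W q = poly [:C, 0, C:] q * exp (- \<epsilon> * q\<^sup>2)" for q
  have fder: "((\<lambda>\<tau>. f \<tau> q) has_vector_derivative f' y q) (at y)" if "dist y x < d" for y q
    unfolding f_def f'_def using dd[OF that] by (intro gauss_parameter_has_vector_derivative) auto
  have fbound: "cmod (f' y q) \<le> W q" if "dist y x < d" for y q
  proof -
    have "cmod (A' y - A y * p' y * of_real (q\<^sup>2)) \<le> cmod (A' y) + cmod (A y * p' y * of_real (q\<^sup>2))"
      by (rule norm_triangle_ineq4)
    also have "\<dots> \<le> C + C * q\<^sup>2"
    proof -
      have "cmod (A y * p' y * of_real (q\<^sup>2)) = cmod (A y * p' y) * q\<^sup>2" by (simp only: norm_mult norm_of_real) simp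
      moreover have "cmod (A y * p' y) * q\<^sup>2 \<le> C * q\<^sup>2" using dd[OF that] by (intro mult_right_mono) auto
      moreover have "cmod (A' y) \<le> C" using dd[OF that] by simp
      ultimately show ?thesis by linarith
    qed
    finally have a: "cmod (A' y - A y * p' y * of_real (q\<^sup>2)) \<le> C + C * q\<^sup>2" .
    have "\<epsilon> * q\<^sup>2 \<le> Re (p y) * q\<^sup>2" using dd[OF that] by (intro mult_right_mono) auto
    then have b: "exp (- Re (p y) * q\<^sup>2) \<le> exp (- \<epsilon> * q\<^sup>2)" by simp
    have "cmod (f' y q) \<le> (C + C * q\<^sup>2) * exp (- \<epsilon> * q\<^sup>2)"
      unfolding f'_def norm_mult[of "A' y - _"] norm_gauss using a b C by (intro mult_mono) auto
    then show ?thesis by (simp add: W_def power2_eq_square algebra_simps)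
  qed
  \<comment> \<open>\<open>W\<close> bounds the difference quotient and the derivative separately,
    hence the factor 2.\<close>
  have diff: "cmod ((f (x + h) q - f x q) / of_real h - f' x q) \<le> 2 * W q" if h: "h \<noteq> 0" "\<bar>h\<bar> < d" for h q
  proof -
    have "norm (f (x + h) q - f x q) \<le> W q * norm (x + h - x)"
    proof (rule differentiable_bound[of "ball x d" "\<lambda>\<tau>. f \<tau> q" "\<lambda>y k. k *\<^sub>R f' y q"])
      show "((\<lambda>\<tau>. f \<tau> q) has_derivative (\<lambda>k. k *\<^sub>R f' y q)) (at y within ball x d)" if "y \<in> ball x d" for y
        using fder[of y q] that by (auto simp: has_vector_derivative_def dist_commute intro: has_derivative_at_withinI)
      show "onorm (\<lambda>k. k *\<^sub>R f' y q) \<le> W q" if "y \<in> ball x d" for y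
        using fbound[of y q] that by (intro onorm_le) (auto simp: dist_commute mult.commute intro: mult_left_mono)
    qed (use d h in \<open>auto simp: dist_real_def\<close>)
    then have "cmod ((f (x + h) q - f x q) / of_real h) \<le> W q"
      using h by (simp add: norm_divide field_simps)
    moreover have "cmod (f' x q) \<le> W q" using fbound[of x q] d by simp
    ultimately show ?thesis using norm_triangle_ineq4[of "(f (x + h) q - f x q) / of_real h" "f' x q"] by linarith
  qed
  have "((\<lambda>h. l2_norm (\<lambda>q. (f (x + h) q - f x q) / of_real h - f' x q)) \<longlongrightarrow> 0) (at 0)"
  proof (rule l2_norm_tendsto_0_dominated[where w="\<lambda>q. 2 * W q"])
    show "(\<lambda>q. (f (x + h) q - f x q) / of_real h - f' x q) \<in> borel_measurable lborel" for h
      unfolding f_def f'_def by measurable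
    have "(2 * W q)\<^sup>2 = poly ([:2 * C, 0, 2 * C:] ^ 2) q * exp (- (2 * \<epsilon>) * q\<^sup>2)" for q
    proof -
      have "exp (- (2 * \<epsilon>) * q\<^sup>2) = (exp (- \<epsilon> * q\<^sup>2))\<^sup>2" by (simp add: exp_double[symmetric])
      moreover have "poly ([:2 * C, 0, 2 * C:] ^ 2) q = (2 * poly [:C, 0, C:] q)\<^sup>2"
        unfolding poly_power by (simp add: algebra_simps)
      ultimately show ?thesis unfolding W_def power_mult_distrib by (simp only: mult.assoc)
    qed
    then show "integrable lborel (\<lambda>q. (2 * W q)\<^sup>2)"
      using integrable_poly_gauss_real[of "2 * \<epsilon>" "[:2 * C, 0, 2 * C:] ^ 2"] \<epsilon> by simp
    show "\<forall>\<^sub>F h in at 0. \<forall>q. cmod ((f (x + h) q - f x q) / of_real h - f' x q) \<le> 2 * W q"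
      unfolding eventually_at using d diff by (intro exI[of _ d]) (auto simp: dist_real_def)
    fix q
    have "((\<lambda>h. norm (f (x + h) q - f x q - h *\<^sub>R f' x q) / norm h) \<longlongrightarrow> 0) (at 0)"
      using fder[of x q] d by (simp add: has_vector_derivative_def has_derivative_at)
    moreover have "\<forall>\<^sub>F h in at 0. norm (f (x + h) q - f x q - h *\<^sub>R f' x q) / norm h
        = norm ((f (x + h) q - f x q) / of_real h - f' x q)"
      using eventually_neq_at_within[of 0 0]
    proof eventually_elim
      case (elim h)
      then have "f (x + h) q - f x q - h *\<^sub>R f' x q = of_real h * ((f (x + h) q - f x q) / of_real h - f' x q)"
        by (simp add: scaleR_conv_of_real field_simps)
      then show ?case using elim by (simp only: norm_mult norm_of_real real_norm_def) simp
    qed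
    ultimately have "((\<lambda>h. norm ((f (x + h) q - f x q) / of_real h - f' x q)) \<longlongrightarrow> 0) (at 0)"
      using tendsto_cong by fastforce
    then show "((\<lambda>h. (f (x + h) q - f x q) / of_real h - f' x q) \<longlongrightarrow> 0) (at 0)"
      by (rule tendsto_norm_zero_cancel)
  qed
  then show ?thesis by (simp add: has_l2_derivative_def f_def f'_def)
qed

text \<open>Both sides are the central binomial coefficient \<open>(2n choose n) / 4^n\<close>, the
  coefficient of \<open>x^n\<close> in \<open>(1 - x)^(-1/2)\<close>. The squared prefactors of the
  Hermite coefficients have exactly this value.\<close>

lemma central_binomial_gbinomial: "(- 1 / 2 gchoose n :: real) * (- 1) ^ n = fact (2 * n) / (2 ^ n * fact n)\<^sup>2" 
  for n :: nat
  unfolding power2_eq_square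
proof (induction n)
  case (Suc n)
  have f: "(fact (2 * Suc n) :: real) = (2 * real (Suc n)) * (real (Suc (2 * n)) * fact (2 * n))"
    by (simp add: algebra_simps)
  have "(- 1 / 2 gchoose Suc n :: real) * real (Suc n) = (- 1 / 2 - real n) * (- 1 / 2 gchoose n)"
    using gbinomial_absorption[of n "- 1 / 2 :: real"] gbinomial_absorb_comp[of "- 1 / 2 :: real" n] by (simp only: mult_ac)
  then have g: "(- 1 / 2 gchoose Suc n :: real) = (- 1 / 2 - real n) / real (Suc n) * (- 1 / 2 gchoose n)"
    by (simp add: field_simps del: of_nat_Suc)
  have "(- 1 / 2 gchoose Suc n :: real) * (- 1) ^ Suc n = (1 / 2 + real n) / real (Suc n) * ((- 1 / 2 gchoose n) * (- 1) ^ n)"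
    unfolding g power_Suc by (simp add: field_simps del: of_nat_Suc)
  also have "\<dots> = fact (2 * Suc n) / (2 ^ Suc n * fact (Suc n) * (2 ^ Suc n * fact (Suc n)))"
    unfolding Suc f fact_Suc[of n] power_Suc by (simp add: divide_simps del: of_nat_Suc)
  finally show ?case .
qed simp

text \<open>The squared distance from \<open>f\<close> to its partial sum is the squared norm of
  \<open>f\<close> minus the partial sum of the squared coefficients, so equality in Bessel's
  inequality for this \<open>f\<close> is convergence.\<close>

lemma l2_expansion_tendsto:
  fixes e :: "nat \<Rightarrow> real \<Rightarrow> complex"
  assumes e: "\<And>n. sq_int (e n)" "\<And>m n. l2_inner (e m) (e n) = (if m = n then 1 else 0)"
    and f: "sq_int f" and sums: "(\<lambda>n. (cmod (l2_inner (e n) f))\<^sup>2) sums (l2_norm f)\<^sup>2"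
  shows "(\<lambda>N. l2_norm (\<lambda>q. f q - (\<Sum>n<N. l2_inner (e n) f * e n q))) \<longlonglongrightarrow> 0"
proof -
  define a where "a n = l2_inner (e n) f" for n
  define S where "S N q = (\<Sum>n<N. a n * e n q)" for N q
  have sS: "sq_int (S N)" for N
    unfolding S_def[abs_def] by (intro sq_int_sum sq_int_cmult e)
  have eS: "l2_inner (e m) (S N) = (if m < N then a m else 0)" for m N
    unfolding S_def[abs_def]
    by (subst l2_inner_sum_right) (auto intro: sq_int_cmult e simp: l2_inner_cmult_right e(2) if_distrib cong: if_cong)
  have SG: "l2_inner (S N) g = (\<Sum>n<N. cnj (a n) * l2_inner (e n) g)" if "sq_int g" for N g
  proof -
    have "l2_inner (S N) g = cnj (l2_inner g (S N))" by (rule l2_inner_cnj)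
    also have "l2_inner g (S N) = (\<Sum>n<N. a n * l2_inner g (e n))"
      unfolding S_def[abs_def]
      by (subst l2_inner_sum_right) (auto intro: sq_int_cmult e that simp: l2_inner_cmult_right)
    also have "cnj \<dots> = (\<Sum>n<N. cnj (a n) * l2_inner (e n) g)"
      by (simp add: l2_inner_cnj[of g])
    finally show ?thesis .
  qed
  have norm: "(l2_norm (\<lambda>q. f q - S N q))\<^sup>2 = (l2_norm f)\<^sup>2 - (\<Sum>n<N. (cmod (a n))\<^sup>2)" for N
  proof -
    have c: "cnj (a n) * a n = of_real ((cmod (a n))\<^sup>2)" for n
      using complex_norm_square[of "a n"] by (simp add: mult.commute)
    have Sf: "l2_inner (S N) f = of_real (\<Sum>n<N. (cmod (a n))\<^sup>2)"
      unfolding SG[OF f] a_def[symmetric] c by simp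
    have SS: "l2_inner (S N) (S N) = of_real (\<Sum>n<N. (cmod (a n))\<^sup>2)"
      unfolding SG[OF sS] eS by (simp add: c del: of_real_power)
    have fS: "l2_inner f (S N) = of_real (\<Sum>n<N. (cmod (a n))\<^sup>2)"
      using l2_inner_cnj[of f "S N"] Sf by simp
    have "complex_of_real ((l2_norm (\<lambda>q. f q - S N q))\<^sup>2) = l2_inner (\<lambda>q. f q - S N q) (\<lambda>q. f q - S N q)"
      by (rule l2_inner_self[symmetric])
    also have "\<dots> = of_real ((l2_norm f)\<^sup>2) - of_real (\<Sum>n<N. (cmod (a n))\<^sup>2)"
      by (simp only: l2_inner_diff_left l2_inner_diff_right sq_int_diff f sS Sf SS fS l2_inner_self[of f]) simp
    finally show ?thesis by (simp only: of_real_diff[symmetric] of_real_eq_iff)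
  qed
  have "(\<lambda>N. \<Sum>n<N. (cmod (a n))\<^sup>2) \<longlonglongrightarrow> (l2_norm f)\<^sup>2"
    using sums unfolding sums_def a_def .
  then have "(\<lambda>N. (l2_norm f)\<^sup>2 - (\<Sum>n<N. (cmod (a n))\<^sup>2)) \<longlonglongrightarrow> 0"
    using tendsto_diff[OF tendsto_const[of "(l2_norm f)\<^sup>2"]] by fastforce
  then have "(\<lambda>N. sqrt ((l2_norm (\<lambda>q. f q - S N q))\<^sup>2)) \<longlonglongrightarrow> sqrt 0"
    unfolding norm by (rule tendsto_real_sqrt)
  then show ?thesis by (simp add: S_def a_def)
qed

lemma constant_if_vector_derivative_0:
  fixes f :: "real \<Rightarrow> 'a::real_normed_vector"
  assumes "is_interval I" "\<And>y. y \<in> I \<Longrightarrow> (f has_vector_derivative 0) (at y)" "x \<in> I" "y \<in> I"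
  shows "f x = f y"
proof -
  have "(f has_vector_derivative 0) (at y within I)" if "y \<in> I" for y
    by (rule has_vector_derivative_at_within[OF assms(2)[OF that]])
  from has_vector_derivative_zero_constant[OF is_interval_convex[OF assms(1)] this]
  obtain k where "\<And>y. y \<in> I \<Longrightarrow> f y = k" by metis
  then show ?thesis using assms(3,4) by simp
qed

section \<open>The classical solution and the packet parameters\<close>

locale parametric_oscillator =
  fixes I :: "real set" and \<kappa> :: "real \<Rightarrow> real" and c s :: "real \<Rightarrow> real \<Rightarrow> real" and \<omega> t0 :: real
  assumes I: "open I" "is_interval I" and \<kappa>: "continuous_on I \<kappa>" and t0: "t0 \<in> I" and \<omega>: "\<omega> > 0"
    and c: "lin_sol \<kappa> I (\<lambda>t. c t t0)" "c t0 t0 = 1" "deriv (\<lambda>t. c t t0) t0 = 0"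
    and s: "lin_sol \<kappa> I (\<lambda>t. s t t0)" "s t0 t0 = 0" "deriv (\<lambda>t. s t t0) t0 = 1"
begin

definition "c' = deriv (\<lambda>t. c t t0)"
definition "s' = deriv (\<lambda>t. s t t0)"

definition z :: "real \<Rightarrow> complex" where "z \<tau> = of_real (c \<tau> t0) + \<i> * of_real (\<omega> * s \<tau> t0)"
definition z' :: "real \<Rightarrow> complex" where "z' \<tau> = of_real (c' \<tau>) + \<i> * of_real (\<omega> * s' \<tau>)"
definition p :: "real \<Rightarrow> complex" where "p \<tau> = - (\<i> / 2) * (z' \<tau> / z \<tau>)"
text \<open>The continuous branch of \<open>z^(-1/2)\<close> that is 1 at \<open>t0\<close>. Written
  as an exponential it is differentiable at once, and \<open>amp_square\<close> confirms afterwards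
  that it is a root.\<close>

definition amp :: "real \<Rightarrow> complex" where "amp \<tau> = exp (- \<i> * (LBINT y=ereal t0..ereal \<tau>. p y))"
definition D :: "real \<Rightarrow> complex" where "D \<tau> = of_real \<omega> * z \<tau> - \<i> * z' \<tau>"

lemma c_der: "x \<in> I \<Longrightarrow> ((\<lambda>t. c t t0) has_real_derivative c' x) (at x)"
  and c'_der: "x \<in> I \<Longrightarrow> (c' has_real_derivative - \<kappa> x * c x t0) (at x)"
  and s_der: "x \<in> I \<Longrightarrow> ((\<lambda>t. s t t0) has_real_derivative s' x) (at x)"
  and s'_der: "x \<in> I \<Longrightarrow> (s' has_real_derivative - \<kappa> x * s x t0) (at x)"
  unfolding c'_def s'_def using lin_sol_derivs[OF c(1) I(1)] lin_sol_derivs[OF s(1) I(1)] by blast+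

lemma wronskian: "x \<in> I \<Longrightarrow> c x t0 * s' x - c' x * s x t0 = 1"
  using wronskian_constant[OF c(1) s(1) I _ t0, of x] c s by (simp add: c'_def s'_def)

lemma z_t0: "z t0 = 1" and z'_t0: "z' t0 = \<i> * of_real \<omega>"
  using c s by (simp_all add: z_def z'_def c'_def s'_def)

lemma z_der: "x \<in> I \<Longrightarrow> (z has_vector_derivative z' x) (at x)"
  unfolding z_def[abs_def] z'_def
  by (intro has_vector_derivative_add has_vector_derivative_mult_right has_vector_derivative_of_real
      DERIV_cmult c_der s_der)

lemma z'_der: "x \<in> I \<Longrightarrow> (z' has_vector_derivative - of_real (\<kappa> x) * z x) (at x)"
proof -
  assume x: "x \<in> I"
  have "((\<lambda>\<tau>. of_real (c' \<tau>) + \<i> * of_real (\<omega> * s' \<tau>)) has_vector_derivative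
      of_real (- \<kappa> x * c x t0) + \<i> * of_real (\<omega> * (- \<kappa> x * s x t0))) (at x)"
    by (intro has_vector_derivative_add has_vector_derivative_mult_right has_vector_derivative_of_real
      DERIV_cmult c'_der s'_der x)
  then show ?thesis by (simp add: z'_def[abs_def] z_def algebra_simps)
qed

lemma z_nonzero: "x \<in> I \<Longrightarrow> z x \<noteq> 0"
  using wronskian[of x] \<omega> by (auto simp: z_def complex_eq_iff)

text \<open>Up to constants this is the Wronskian of \<open>z\<close> and its conjugate. Its
  positivity gives \<open>p\<close> a positive real part, that is, a normalisable packet at all
  times.\<close>

lemma Im_z'_cnj_z: "x \<in> I \<Longrightarrow> Im (z' x * cnj (z x)) = \<omega>"
proof -
  assume x: "x \<in> I"
  have "Im (z' x * cnj (z x)) = \<omega> * (c x t0 * s' x - c' x * s x t0)"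
    by (simp add: z_def z'_def algebra_simps)
  then show ?thesis using wronskian[OF x] by simp
qed

lemma z'_eq: "x \<in> I \<Longrightarrow> z' x = 2 * \<i> * p x * z x"
  using z_nonzero by (simp add: p_def field_simps)

lemma p_t0: "p t0 = of_real (\<omega> / 2)"
  by (simp add: p_def z_t0 z'_t0)

lemma Re_p: "x \<in> I \<Longrightarrow> Re (p x) = \<omega> / (2 * (cmod (z x))\<^sup>2)"
proof -
  assume x: "x \<in> I"
  have "Re (- (\<i> / 2) * w) = Im w / 2" for w by simp
  then have "Re (p x) = Im (z' x / z x) / 2" unfolding p_def .
  also have "z' x / z x = (z' x * cnj (z x)) / of_real ((cmod (z x))\<^sup>2)"
    by (rule complex_div_cnj)
  also have "Im \<dots> = \<omega> / (cmod (z x))\<^sup>2" using Im_z'_cnj_z[OF x] by (simp only: Im_divide_of_real)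
  finally show ?thesis by simp
qed

lemma Re_p_pos: "x \<in> I \<Longrightarrow> 0 < Re (p x)"
  using Re_p z_nonzero \<omega> by simp

text \<open>The Riccati equation belonging to the linear equation for \<open>z\<close>. It matches
  the \<open>q^2\<close> coefficient that the Hamiltonian produces on
  \<open>gauss (p x)\<close>.\<close>

lemma p_der: "x \<in> I \<Longrightarrow> (p has_vector_derivative \<i> * (of_real (\<kappa> x) / 2 - 2 * (p x)\<^sup>2)) (at x)"
proof -
  assume x: "x \<in> I"
  note zn = z_nonzero[OF x]
  have inv: "((\<lambda>\<tau>. inverse (z \<tau>)) has_vector_derivative z' x * (- (inverse (z x))\<^sup>2)) (at x)"
  proof -
    have "(inverse has_field_derivative - (inverse (z x))\<^sup>2) (at (z x))"
      using DERIV_inverse[OF zn] by (simp add: numeral_2_eq_2)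
    from field_vector_diff_chain_at[OF z_der[OF x] this] show ?thesis by (simp add: comp_def)
  qed
  have "((\<lambda>\<tau>. - (\<i> / 2) * (z' \<tau> * inverse (z \<tau>))) has_vector_derivative
     - (\<i> / 2) * (z' x * (z' x * (- (inverse (z x))\<^sup>2)) + - of_real (\<kappa> x) * z x * inverse (z x))) (at x)"
    by (intro has_vector_derivative_mult_right has_vector_derivative_mult z'_der x inv)
  moreover have rhs: "- (\<i> / 2) * (z' x * (z' x * (- (inverse (z x))\<^sup>2)) + - of_real (\<kappa> x) * z x * inverse (z x))
     = \<i> * (of_real (\<kappa> x) / 2 - 2 * (p x)\<^sup>2)"
    using zn by (simp add: p_def power_divide power_mult_distrib) (simp add: field_simps power2_eq_square)
  moreover have "p = (\<lambda>\<tau>. - (\<i> / 2) * (z' \<tau> * inverse (z \<tau>)))"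
    by (simp only: fun_eq_iff p_def divide_inverse) simp
  ultimately show ?thesis unfolding rhs[symmetric] by metis
qed

lemma isCont_p: "x \<in> I \<Longrightarrow> isCont p x"
  using p_der has_vector_derivative_continuous by blast

lemma amp_der: "x \<in> I \<Longrightarrow> (amp has_vector_derivative - \<i> * p x * amp x) (at x)"
proof -
  assume x: "x \<in> I"
  \<comment> \<open>The fundamental theorem gives a derivative within a closed interval. Ends
    slightly beyond both \<open>t0\<close> and \<open>x\<close> make \<open>x\<close> interior, so
    the derivative is two-sided.\<close>
  have "min t0 x \<in> I" "max t0 x \<in> I" using x t0 by (auto simp: min_def max_def)
  then obtain e1 e2 where e: "e1 > 0" "cball (min t0 x) e1 \<subseteq> I" "e2 > 0" "cball (max t0 x) e2 \<subseteq> I"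
    using I(1) open_contains_cball by metis
  define a b where "a = min t0 x - e1" and "b = max t0 x + e2"
  have ab: "a \<in> I" "b \<in> I" "a < t0" "t0 < b" "a < x" "x < b"
    using e by (auto simp: a_def b_def subset_iff dist_real_def)
  have "{a..b} \<subseteq> I" using mem_is_interval_1_I[OF I(2) ab(1,2)] by (simp add: subset_iff)
  then have "continuous_on {a..b} p" using isCont_p by (intro continuous_at_imp_continuous_on) auto
  then have "((\<lambda>u. LBINT y=ereal t0..ereal u. p y) has_vector_derivative p x) (at x within {a..b})"
    using ab by (intro interval_integral_FTC2) auto
  moreover have "at x within {a..b} = at x" using ab by (intro at_within_interior) (simp add: interior_atLeastAtMost_real)
  ultimately have P: "((\<lambda>u. LBINT y=ereal t0..ereal u. p y) has_vector_derivative p x) (at x)" by simp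
  have "((\<lambda>u. exp (- \<i> * u)) has_field_derivative - \<i> * exp (- \<i> * (LBINT y=ereal t0..ereal x. p y)))
      (at (LBINT y=ereal t0..ereal x. p y))"
    by (auto intro!: derivative_eq_intros)
  from field_vector_diff_chain_at[OF P this]
  show ?thesis by (simp add: amp_def[abs_def] comp_def algebra_simps)
qed

lemma amp_t0: "amp t0 = 1"
  by (simp add: amp_def)

lemma amp_square: "x \<in> I \<Longrightarrow> (amp x)\<^sup>2 * z x = 1"
proof -
  assume x: "x \<in> I"
  have "((\<lambda>\<tau>. amp \<tau> * amp \<tau> * z \<tau>) has_vector_derivative 0) (at y)" if y: "y \<in> I" for y
    by (rule has_vector_derivative_eq_rhs[OF has_vector_derivative_mult[OF has_vector_derivative_mult[OF amp_der[OF y] amp_der[OF y]] z_der[OF y]]])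
       (simp add: z'_eq[OF y] algebra_simps)
  from constant_if_vector_derivative_0[OF I(2) this x t0]
  show ?thesis by (simp add: amp_t0 z_t0 power2_eq_square)
qed

end

section \<open>The evolved ground state is the packet\<close>

lemma sq_int_quadratic_gauss:
  assumes "Re p > 0"
  shows "sq_int (\<lambda>q. (u + v * of_real (q\<^sup>2)) * gauss p q)"
proof -
  have "sq_int (\<lambda>q. u * gauss p q + v * (of_real (poly [:0,0,1:] q) * gauss p q))"
    by (intro sq_int_add sq_int_cmult sq_int_gauss sq_int_poly_gauss assms)
  moreover have "u * gauss p q + v * (of_real (poly [:0,0,1:] q) * gauss p q) = (u + v * of_real (q\<^sup>2)) * gauss p q" for q
    by (simp add: algebra_simps power2_eq_square)
  ultimately show ?thesis by simp
qed

lemma sq_int_zero: "sq_int (\<lambda>q. 0)"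
  by (simp add: sq_int_def)

lemma l2_inner_cong_AE:
  assumes "sq_int f" "sq_int g" "sq_int h" "AE q in lborel. f q = g q"
  shows "l2_inner h f = l2_inner h g"
  unfolding l2_inner_def
proof (rule integral_cong_AE)
  show "(\<lambda>q. cnj (h q) * f q) \<in> borel_measurable lborel" "(\<lambda>q. cnj (h q) * g q) \<in> borel_measurable lborel"
    using sq_int_inner[OF assms(3,1)] sq_int_inner[OF assms(3,2)] by auto
  show "AE q in lborel. cnj (h q) * f q = cnj (h q) * g q" using assms(4) by eventually_elim simp
qed

lemma l2_norm_cong_AE:
  assumes "sq_int f" "sq_int g" "AE q in lborel. f q = g q"
  shows "l2_norm f = l2_norm g"
proof -
  have "(LINT q|lborel. (cmod (f q))\<^sup>2) = (LINT q|lborel. (cmod (g q))\<^sup>2)"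
  proof (rule integral_cong_AE)
    show "AE q in lborel. (cmod (f q))\<^sup>2 = (cmod (g q))\<^sup>2" using assms(3) by eventually_elim simp
  qed (use assms in \<open>auto simp: sq_int_def\<close>)
  then show ?thesis by (simp add: l2_norm_def)
qed

context parametric_oscillator
begin

definition psi :: "real \<Rightarrow> real \<Rightarrow> complex" where
  "psi \<tau> q = (of_real (hermite_const \<omega> 0) * amp \<tau>) * gauss (p \<tau>) q"

text \<open>This is \<open>- \<i>\<close> times the Hamiltonian applied to
  \<open>psi \<tau>\<close>, arranged so that its last factor is the left argument produced by
  \<open>l2_inner_gauss_ham\<close>.\<close>

definition psi' :: "real \<Rightarrow> real \<Rightarrow> complex" where
  "psi' \<tau> q = (- \<i> * (of_real (hermite_const \<omega> 0) * amp \<tau>)) *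
     ((p \<tau> - (2 * (p \<tau>)\<^sup>2 - of_real (\<kappa> \<tau>) / 2) * of_real (q\<^sup>2)) * gauss (p \<tau>) q)"

lemma psi_t0: "psi t0 = hermite_fn \<omega> 0"
  by (simp add: fun_eq_iff psi_def amp_t0 p_t0 hermite_fn_eq)

lemma sq_int_psi: "x \<in> I \<Longrightarrow> sq_int (psi x)"
  unfolding psi_def[abs_def] by (intro sq_int_cmult sq_int_gauss Re_p_pos)

lemma sq_int_psi': "x \<in> I \<Longrightarrow> sq_int (psi' x)"
  using sq_int_cmult[OF sq_int_quadratic_gauss[OF Re_p_pos]]
  unfolding psi'_def[abs_def] diff_conv_add_uminus mult_minus_left[symmetric] by blast

lemma eventually_in_I: "x \<in> I \<Longrightarrow> \<forall>\<^sub>F y in nhds x. y \<in> I"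
  by (rule eventually_nhds_in_open[OF I(1)])

lemma eventually_plus_in_I: "x \<in> I \<Longrightarrow> \<forall>\<^sub>F h in at 0. x + h \<in> I"
proof -
  assume x: "x \<in> I"
  have "((\<lambda>h. x + h) \<longlongrightarrow> x + 0) (at 0)" by (intro tendsto_intros)
  then show ?thesis using topological_tendstoD[OF _ I(1)] x by fastforce
qed

lemma psi_has_l2_derivative: "x \<in> I \<Longrightarrow> has_l2_derivative psi (psi' x) x"
proof -
  assume x: "x \<in> I"
  let ?K = "complex_of_real (hermite_const \<omega> 0)"
  define A where "A = (\<lambda>y. ?K * amp y)"
  define A' where "A' = (\<lambda>y. ?K * (- \<i> * p y * amp y))"
  define p' where "p' = (\<lambda>y. \<i> * (of_real (\<kappa> y) / 2 - 2 * (p y)\<^sup>2))"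
  have "isCont \<kappa> x" using \<kappa> I(1) x continuous_on_eq_continuous_at by blast
  moreover have "isCont amp x" using amp_der[OF x] by (rule has_vector_derivative_continuous)
  ultimately have cont: "isCont p' x" "isCont A' x"
    unfolding p'_def A'_def using isCont_p[OF x] by (auto intro!: continuous_intros)
  have "\<forall>\<^sub>F y in nhds x. (p has_vector_derivative p' y) (at y) \<and> (A has_vector_derivative A' y) (at y)"
    using eventually_in_I[OF x]
  proof eventually_elim
    case (elim y)
    show ?case unfolding p'_def A_def A'_def
      by (intro conjI p_der has_vector_derivative_mult_right amp_der elim)
  qed
  from gauss_has_l2_derivative[OF Re_p_pos[OF x] this cont]
  have d: "has_l2_derivative (\<lambda>\<tau> q. A \<tau> * gauss (p \<tau>) q) (\<lambda>q. (A' x - A x * p' x * of_real (q\<^sup>2)) * gauss (p x) q) x" .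
  have "(A' x - A x * p' x * of_real (q\<^sup>2)) * gauss (p x) q = psi' x q" for q
    by (simp add: A_def A'_def p'_def psi'_def algebra_simps)
  then show ?thesis using d by (simp add: psi_def[abs_def] A_def)
qed

lemma l2_norm_psi: "x \<in> I \<Longrightarrow> l2_norm (psi x) = 1"
proof -
  assume x: "x \<in> I"
  let ?K = "hermite_const \<omega> 0"
  have z0: "cmod (z x) > 0" using z_nonzero[OF x] by simp
  have amp: "(cmod (amp x))\<^sup>2 * cmod (z x) = 1"
    using arg_cong[OF amp_square[OF x], of cmod] by (simp add: norm_mult norm_power)
  have "(cmod (psi x q))\<^sup>2 = (?K\<^sup>2 * (cmod (amp x))\<^sup>2) * exp (- (2 * Re (p x)) * q\<^sup>2)" for q
    by (simp add: psi_def norm_mult norm_gauss power_mult_distrib exp_double[symmetric])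
  then have "(l2_norm (psi x))\<^sup>2 = (?K\<^sup>2 * (cmod (amp x))\<^sup>2) * sqrt (pi / (2 * Re (p x)))"
    unfolding l2_norm_power2 using integral_gauss[of "2 * Re (p x)"] Re_p_pos[OF x] by simp
  also have "pi / (2 * Re (p x)) = (cmod (z x))\<^sup>2 * (pi / \<omega>)"
    unfolding Re_p[OF x] using \<omega> z0 by (simp add: field_simps)
  also have "sqrt \<dots> = cmod (z x) * sqrt (pi / \<omega>)" by (simp only: real_sqrt_mult real_sqrt_abs) simp
  also have "?K\<^sup>2 * (cmod (amp x))\<^sup>2 * (cmod (z x) * sqrt (pi / \<omega>)) = (?K\<^sup>2 * sqrt (pi / \<omega>)) * ((cmod (amp x))\<^sup>2 * cmod (z x))"
    by (simp only: mult_ac)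
  also have "\<dots> = 1"
    unfolding amp hermite_const_power2[OF \<omega>] using \<omega> by (simp add: real_sqrt_divide)
  finally have "(l2_norm (psi x))\<^sup>2 = 1\<^sup>2" by simp
  then show ?thesis by (rule power2_eq_imp_eq) simp_all
qed

text \<open>The equality is almost everywhere because the values of \<open>U\<close> represent
  classes, and \<open>is_evolution\<close> fixes even the initial value only up to a null
  set.\<close>

lemma evolution_eq_psi:
  assumes U: "is_evolution \<kappa> I U" and x: "x \<in> I"
  shows "sq_int (U x t0 (hermite_fn \<omega> 0))"
    and "AE q in lborel. U x t0 (hermite_fn \<omega> 0) q = psi x q"
proof -
  define \<phi> where "\<phi> = hermite_fn \<omega> 0"
  define u where "u \<tau> = U \<tau> t0 \<phi>" for \<tau>
  have s\<phi>: "sq_int \<phi>" unfolding \<phi>_def by (rule sq_int_hermite_fn[OF \<omega>])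
  have n\<phi>: "l2_inner \<phi> \<phi> = 1" unfolding \<phi>_def using hermite_fn_orthonormal[OF \<omega>, of 0 0] by simp
  have schw: "schwartz \<phi>" unfolding \<phi>_def by (rule schwartz_hermite_fn_0[OF \<omega>])
  have uni: "unitary_L2 (U \<tau> t0)" if "\<tau> \<in> I" for \<tau> using U that t0 unfolding is_evolution_def by blast
  have su: "sq_int (u \<tau>)" if "\<tau> \<in> I" for \<tau>
    using uni[OF that] s\<phi> unfolding unitary_L2_def u_def by blast
  have nu: "l2_inner (u \<tau>) (u \<tau>) = 1" if "\<tau> \<in> I" for \<tau>
    using uni[OF that] s\<phi> n\<phi> unfolding unitary_L2_def u_def by metis
  have init: "AE q in lborel. u t0 q = \<phi> q"
  proof -
    have "l2_norm (\<lambda>q. u t0 q - \<phi> q) = 0"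
      using U t0 s\<phi> unfolding is_evolution_def u_def by blast
    then have "AE q in lborel. u t0 q - \<phi> q = 0"
      using l2_norm_eq_0_AE[OF sq_int_diff[OF su[OF t0] s\<phi>]] by blast
    then show ?thesis by simp
  qed
  have evo: "twice_diff (u \<tau>)" "sq_int (ham \<kappa> \<tau> (u \<tau>))"
     "((\<lambda>h. l2_norm (\<lambda>q. (u (\<tau> + h) q - u \<tau> q) / of_real h + \<i> * ham \<kappa> \<tau> (u \<tau>) q)) \<longlongrightarrow> 0) (at 0 within {h. \<tau> + h \<in> I})"
    if "\<tau> \<in> I" for \<tau>
    using U that t0 schw unfolding is_evolution_def u_def by blast+
  have der: "((\<lambda>\<tau>. l2_inner (psi \<tau>) (u \<tau>)) has_vector_derivative 0) (at \<tau>)" if \<tau>: "\<tau> \<in> I" for \<tau>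
  proof -
    have "open {h. \<tau> + h \<in> I}"
    proof -
      have "open ((\<lambda>h. \<tau> + h) -` I)" by (intro open_vimage I continuous_intros)
      then show ?thesis by (simp add: vimage_def)
    qed
    \<comment> \<open>\<open>is_evolution\<close> takes the limit within \<open>I\<close>; as
      \<open>I\<close> is open, it is the two-sided limit of
      \<open>has_l2_derivative\<close>.\<close>
    then have "at 0 within {h. \<tau> + h \<in> I} = at 0" using \<tau> by (intro at_within_open) auto
    then have du: "has_l2_derivative u (\<lambda>q. - \<i> * ham \<kappa> \<tau> (u \<tau>) q) \<tau>"
      using evo(3)[OF \<tau>] by (simp add: has_l2_derivative_def)
    have ev: "\<forall>\<^sub>F h in at 0. sq_int (psi (\<tau> + h))" "\<forall>\<^sub>F h in at 0. sq_int (u (\<tau> + h))"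
      using eventually_plus_in_I[OF \<tau>] by (auto elim!: eventually_mono intro: sq_int_psi su)
    have d: "((\<lambda>\<tau>. l2_inner (psi \<tau>) (u \<tau>)) has_vector_derivative
        (l2_inner (psi' \<tau>) (u \<tau>) + l2_inner (psi \<tau>) (\<lambda>q. - \<i> * ham \<kappa> \<tau> (u \<tau>) q))) (at \<tau>)"
      by (rule l2_inner_has_vector_derivative[OF ev sq_int_psi[OF \<tau>] su[OF \<tau>] sq_int_psi'[OF \<tau>]
            sq_int_cmult[OF evo(2)[OF \<tau>]] psi_has_l2_derivative[OF \<tau>] du])
    define B where "B = of_real (hermite_const \<omega> 0) * amp \<tau>"
    define X where "X = l2_inner (\<lambda>q. (p \<tau> - (2 * (p \<tau>)\<^sup>2 - of_real (\<kappa> \<tau>) / 2) * of_real (q\<^sup>2)) * gauss (p \<tau>) q) (u \<tau>)"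
    have "l2_inner (psi' \<tau>) (u \<tau>) = cnj (- \<i> * B) * X"
      unfolding psi'_def[abs_def] X_def B_def by (rule l2_inner_cmult_left)
    moreover have "l2_inner (psi \<tau>) (\<lambda>q. - \<i> * ham \<kappa> \<tau> (u \<tau>) q) = - \<i> * l2_inner (psi \<tau>) (ham \<kappa> \<tau> (u \<tau>))"
      by (rule l2_inner_cmult_right)
    moreover have "l2_inner (psi \<tau>) (ham \<kappa> \<tau> (u \<tau>)) = cnj B * l2_inner (gauss (p \<tau>)) (ham \<kappa> \<tau> (u \<tau>))"
      unfolding psi_def[abs_def] B_def by (rule l2_inner_cmult_left)
    moreover have "l2_inner (gauss (p \<tau>)) (ham \<kappa> \<tau> (u \<tau>)) = X"
      unfolding X_def by (rule l2_inner_gauss_ham[OF Re_p_pos[OF \<tau>] evo(1)[OF \<tau>] su[OF \<tau>] evo(2)[OF \<tau>]])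
    \<comment> \<open>Conjugation in the first slot turns \<open>- \<i>\<close> into
      \<open>\<i>\<close>, so the two terms \<open>\<i> * cnj B * X\<close> and
      \<open>- \<i> * cnj B * X\<close> cancel.\<close>
    ultimately show ?thesis using d by simp
  qed
  have "l2_inner (psi x) (u x) = l2_inner (psi t0) (u t0)"
    by (rule constant_if_vector_derivative_0[OF I(2) der x t0])
  also have "\<dots> = l2_inner \<phi> \<phi>"
    unfolding psi_t0 \<phi>_def[symmetric] by (rule l2_inner_cong_AE[OF su[OF t0] s\<phi> s\<phi> init])
  finally have pu: "l2_inner (psi x) (u x) = 1" using n\<phi> by simp
  then have up: "l2_inner (u x) (psi x) = 1" using l2_inner_cnj[of "u x" "psi x"] by simp
  have pp: "l2_inner (psi x) (psi x) = 1" using l2_norm_psi[OF x] by (simp add: l2_inner_self)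
  \<comment> \<open>The square expands to 1 - 1 - 1 + 1.\<close>
  have "complex_of_real ((l2_norm (\<lambda>q. u x q - psi x q))\<^sup>2) = 0"
    unfolding l2_inner_self[symmetric]
    by (simp add: l2_inner_diff_left l2_inner_diff_right sq_int_diff su x sq_int_psi pu up pp nu)
  then have "l2_norm (\<lambda>q. u x q - psi x q) = 0" by simp
  then have "AE q in lborel. u x q - psi x q = 0"
    by (rule l2_norm_eq_0_AE[OF sq_int_diff[OF su[OF x] sq_int_psi[OF x]]])
  then show "AE q in lborel. U x t0 (hermite_fn \<omega> 0) q = psi x q"
    by (simp add: u_def \<phi>_def)
  show "sq_int (U x t0 (hermite_fn \<omega> 0))" using su[OF x] by (simp add: u_def \<phi>_def)
qed

section \<open>The ground-state overlap\<close>

definition overlap :: "real \<Rightarrow> complex" where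
  "overlap \<tau> = l2_inner (hermite_fn \<omega> 0) (psi \<tau>)"

lemma D_eq: "x \<in> I \<Longrightarrow> D x = z x * (of_real \<omega> + 2 * p x)"
  unfolding D_def by (simp add: z'_eq algebra_simps)

lemma D_nonzero: "x \<in> I \<Longrightarrow> D x \<noteq> 0"
proof -
  assume x: "x \<in> I"
  have "Re (of_real \<omega> + 2 * p x) > 0" using \<omega> Re_p_pos[OF x] by simp
  then have "of_real \<omega> + 2 * p x \<noteq> 0" by force
  then show ?thesis using z_nonzero[OF x] by (simp add: D_eq[OF x])
qed

lemma Re_D: "Re (D x) = \<omega> * (c x t0 + s' x)" and Im_D: "Im (D x) = \<omega>\<^sup>2 * s x t0 - c' x"
  by (simp_all add: D_def z_def z'_def algebra_simps power2_eq_square)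

lemma D_der: "x \<in> I \<Longrightarrow> (D has_vector_derivative of_real \<omega> * z' x + \<i> * of_real (\<kappa> x) * z x) (at x)"
proof -
  assume x: "x \<in> I"
  have "((\<lambda>\<tau>. of_real \<omega> * z \<tau> - \<i> * z' \<tau>) has_vector_derivative of_real \<omega> * z' x - \<i> * (- of_real (\<kappa> x) * z x)) (at x)"
    by (intro has_vector_derivative_diff has_vector_derivative_mult_right z_der z'_der x)
  then show ?thesis by (simp add: D_def[abs_def] mult.assoc)
qed

lemma l2_inner_ground_quadratic_gauss:
  assumes P: "Re P > 0"
  shows "l2_inner (hermite_fn \<omega> 0) (\<lambda>q. (u - v * of_real (q\<^sup>2)) * gauss P q)
     = (u - v / (of_real \<omega> + 2 * P)) * l2_inner (hermite_fn \<omega> 0) (gauss P)"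
proof -
  let ?K = "complex_of_real (hermite_const \<omega> 0)"
  define r where "r = of_real (\<omega> / 2) + P"
  have r: "Re r > 0" using \<omega> P by (simp add: r_def)
  then have r0: "r \<noteq> 0" by force
  define M0 where "M0 = (LINT q|lborel. gauss r q)"
  \<comment> \<open>The second moment, with \<open>q^2\<close> split as in
    \<open>integral_pderiv_gauss\<close> for the polynomial \<open>q\<close>; that identity then
    gives \<open>M0 = 2 r M2\<close>.\<close>
  define M2 where "M2 = (LINT q|lborel. complex_of_real (q * poly [:0,1:] q) * gauss r q)"
  have "M0 = 2 * r * M2"
    using integral_pderiv_gauss[OF r, of "[:0,1:]"] by (simp add: M0_def M2_def pderiv_pCons)
  then have M2: "M2 = M0 / (2 * r)" using r0 by simp
  have i0: "integrable lborel (\<lambda>q. gauss r q)" using integrable_poly_gauss[OF r, of 1] by simp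
  have i2: "integrable lborel (\<lambda>q. complex_of_real (q * poly [:0,1:] q) * gauss r q)"
    using integrable_poly_gauss[OF r, of "[:0,0,1:]"] by simp
  have h: "cnj (hermite_fn \<omega> 0 q) = ?K * gauss (of_real (\<omega> / 2)) q" for q
    by (simp add: hermite_fn_eq cnj_gauss)
  have g: "gauss (of_real (\<omega> / 2)) q * gauss P q = gauss r q" for q
    unfolding r_def by (rule gauss_mult)
  have "l2_inner (hermite_fn \<omega> 0) (gauss P) = (LINT q|lborel. ?K * gauss r q)"
    unfolding l2_inner_def h mult.assoc g ..
  then have L0: "l2_inner (hermite_fn \<omega> 0) (gauss P) = ?K * M0"
    by (simp only: integral_mult_right_zero M0_def)
  have "cnj (hermite_fn \<omega> 0 q) * ((u - v * of_real (q\<^sup>2)) * gauss P q)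
     = ?K * u * gauss r q - ?K * v * (complex_of_real (q * poly [:0,1:] q) * gauss r q)" for q
    unfolding h g[symmetric] by (simp add: algebra_simps power2_eq_square)
  then have "l2_inner (hermite_fn \<omega> 0) (\<lambda>q. (u - v * of_real (q\<^sup>2)) * gauss P q)
     = (LINT q|lborel. ?K * u * gauss r q - ?K * v * (complex_of_real (q * poly [:0,1:] q) * gauss r q))"
    unfolding l2_inner_def by simp
  also have "\<dots> = ?K * u * M0 - ?K * v * M2"
    unfolding M0_def M2_def
    by (subst Bochner_Integration.integral_diff[OF integrable_mult_right[OF i0] integrable_mult_right[OF i2]])
       (simp only: integral_mult_right_zero)
  finally show ?thesis unfolding L0 M2 using r0 by (simp add: r_def algebra_simps)
qed

text \<open>A closed form of the overlap would involve a Gaussian integral with complex parameter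
  and hence a choice of root. Its differential equation involves no such choice.\<close>

lemma overlap_der:
  "x \<in> I \<Longrightarrow> (overlap has_vector_derivative
     - \<i> * (p x - (2 * (p x)\<^sup>2 - of_real (\<kappa> x) / 2) / (of_real \<omega> + 2 * p x)) * overlap x) (at x)"
proof -
  assume x: "x \<in> I"
  let ?B = "of_real (hermite_const \<omega> 0) * amp x"
  have s0: "sq_int (hermite_fn \<omega> 0)" by (rule sq_int_hermite_fn[OF \<omega>])
  have "\<forall>\<^sub>F h in at 0. sq_int (psi (x + h))"
    using eventually_plus_in_I[OF x] by (auto elim!: eventually_mono intro: sq_int_psi)
  moreover have "has_l2_derivative (\<lambda>\<tau>. hermite_fn \<omega> 0) (\<lambda>q. 0) x"
    by (simp add: has_l2_derivative_def l2_norm_def)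
  ultimately have "((\<lambda>\<tau>. l2_inner (hermite_fn \<omega> 0) (psi \<tau>)) has_vector_derivative
     (l2_inner (\<lambda>q. 0) (psi x) + l2_inner (hermite_fn \<omega> 0) (psi' x))) (at x)"
    using x s0 by (intro l2_inner_has_vector_derivative psi_has_l2_derivative sq_int_psi sq_int_psi' sq_int_zero) auto
  moreover have "l2_inner (\<lambda>q. 0) (psi x) = 0" by (simp add: l2_inner_def)
  moreover have "l2_inner (hermite_fn \<omega> 0) (psi' x) = - \<i> * ?B *
      ((p x - (2 * (p x)\<^sup>2 - of_real (\<kappa> x) / 2) / (of_real \<omega> + 2 * p x)) * l2_inner (hermite_fn \<omega> 0) (gauss (p x)))"
    unfolding psi'_def[abs_def] l2_inner_ground_quadratic_gauss[OF Re_p_pos[OF x], symmetric]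
    by (rule l2_inner_cmult_right)
  moreover have "overlap x = ?B * l2_inner (hermite_fn \<omega> 0) (gauss (p x))"
    unfolding overlap_def psi_def[abs_def] by (rule l2_inner_cmult_right)
  ultimately show ?thesis by (simp add: overlap_def[abs_def] mult_ac)
qed

lemma overlap_t0: "overlap t0 = 1"
  unfolding overlap_def psi_t0 using hermite_fn_orthonormal[OF \<omega>, of 0 0] by simp

text \<open>The logarithmic derivative of \<open>overlap\<close> is \<open>- \<i> k\<close> and that
  of \<open>D\<close> is \<open>2 \<i> k\<close>, with the same \<open>k\<close>, so
  \<open>overlap^2 D\<close> keeps its value at \<open>t0\<close>.\<close>

lemma overlap_square: "x \<in> I \<Longrightarrow> (overlap x)\<^sup>2 = of_real (2 * \<omega>) / D x"
proof -
  assume x: "x \<in> I"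
  have "((\<lambda>\<tau>. overlap \<tau> * overlap \<tau> * D \<tau>) has_vector_derivative 0) (at y)" if y: "y \<in> I" for y
  proof (rule has_vector_derivative_eq_rhs[OF has_vector_derivative_mult[OF has_vector_derivative_mult[OF overlap_der[OF y] overlap_der[OF y]] D_der[OF y]]])
    define k where "k = p y - (2 * (p y)\<^sup>2 - of_real (\<kappa> y) / 2) / (of_real \<omega> + 2 * p y)"
    have n: "of_real \<omega> + 2 * p y \<noteq> 0" using D_nonzero[OF y] D_eq[OF y] by auto
    \<comment> \<open>The \<open>p^2\<close> terms cancel, and \<open>2 \<i> z\<close> times the
      right side is the derivative of \<open>D\<close>.\<close>
    have k: "k * (of_real \<omega> + 2 * p y) = of_real \<omega> * p y + of_real (\<kappa> y) / 2"
    proof -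
      have "k * (of_real \<omega> + 2 * p y) = p y * (of_real \<omega> + 2 * p y) - (2 * (p y)\<^sup>2 - of_real (\<kappa> y) / 2)"
        unfolding k_def left_diff_distrib[of "p y"] using n by (simp only: times_divide_eq_left nonzero_mult_div_cancel_right) simp
      then show ?thesis by (simp add: algebra_simps power2_eq_square)
    qed
    have "overlap y * overlap y * (of_real \<omega> * z' y + \<i> * of_real (\<kappa> y) * z y) +
       (overlap y * (- \<i> * k * overlap y) + - \<i> * k * overlap y * overlap y) * D y
     = overlap y * overlap y * (of_real \<omega> * (2 * \<i> * p y * z y) + \<i> * of_real (\<kappa> y) * z y
         - 2 * \<i> * z y * (k * (of_real \<omega> + 2 * p y)))"
      unfolding D_eq[OF y] z'_eq[OF y] by (simp add: algebra_simps)
    also have "\<dots> = 0" unfolding k by (simp add: algebra_simps)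
    finally show "overlap y * overlap y * (of_real \<omega> * z' y + \<i> * of_real (\<kappa> y) * z y) +
       (overlap y * (- \<i> * (p y - (2 * (p y)\<^sup>2 - of_real (\<kappa> y) / 2) / (of_real \<omega> + 2 * p y)) * overlap y)
        + - \<i> * (p y - (2 * (p y)\<^sup>2 - of_real (\<kappa> y) / 2) / (of_real \<omega> + 2 * p y)) * overlap y * overlap y) * D y = 0"
      unfolding k_def .
  qed
  from constant_if_vector_derivative_0[OF I(2) this x t0]
  have "(overlap x)\<^sup>2 * D x = D t0" by (simp add: overlap_t0 power2_eq_square)
  also have "D t0 = of_real (2 * \<omega>)" by (simp add: D_def z_t0 z'_t0)
  finally show ?thesis using D_nonzero[OF x] by (simp add: field_simps)
qed

end

section \<open>Branch of the overlap, higher coefficients and Parseval's identity\<close>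

context parametric_oscillator
begin

lemma overlap_eq_index_branch:
  assumes x: "x \<in> I" and nz: "s x t0 \<noteq> 0"
  shows "overlap x = csqrt (\<i> * of_real (s x t0) * (of_real (2 * \<omega>) / D x)) * cis (- pi / 4) * s_inv_sqrt s x t0"
proof (rule continuous_root_eq_index_branch[where J=I and s'=s' and w="\<lambda>x. of_real (2 * \<omega>) / D x"])
  show "continuous_on I (\<lambda>x. of_real (2 * \<omega>) / D x)"
    using D_der D_nonzero
    by (intro continuous_on_divide continuous_on_const continuous_at_imp_continuous_on)
       (auto intro: has_vector_derivative_continuous)
  show "continuous_on I overlap"
    by (intro continuous_at_imp_continuous_on ballI) (rule has_vector_derivative_continuous[OF overlap_der])
  show "of_real (2 * \<omega>) / D y \<noteq> 0" if "y \<in> I" for y using D_nonzero[OF that] \<omega> by simp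
  show "0 < s' y * Re (of_real (2 * \<omega>) / D y)" if y: "y \<in> I" and 0: "s y t0 = 0" for y
  proof -
    \<comment> \<open>At a zero of \<open>s\<close> the Wronskian reduces to
      \<open>c s' = 1\<close>, so this product is \<omega> times \<open>1 + s'^2\<close>.\<close>
    have "s' y * Re (D y) = \<omega> * (c y t0 * s' y + (s' y)\<^sup>2)" by (simp add: Re_D power2_eq_square algebra_simps)
    also have "c y t0 * s' y = 1" using wronskian[OF y] 0 by simp
    finally have 1: "s' y * Re (D y) > 0" using \<omega> by (simp add: add_pos_nonneg)
    have "Re (of_real (2 * \<omega>) / D y) = 2 * \<omega> * Re (D y) / (cmod (D y))\<^sup>2"
      by (simp add: Re_divide cmod_power2)
    then have "s' y * Re (of_real (2 * \<omega>) / D y) = (2 * \<omega> / (cmod (D y))\<^sup>2) * (s' y * Re (D y))" by simp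
    moreover have "2 * \<omega> / (cmod (D y))\<^sup>2 > 0" using \<omega> D_nonzero[OF y] by simp
    ultimately show ?thesis using mult_pos_pos[OF _ 1] by metis
  qed
  show "\<i> * of_real (s y t0) * (of_real (2 * \<omega>) / D y) \<notin> \<real>\<^sub>\<le>\<^sub>0" if y: "y \<in> I" and n: "s y t0 \<noteq> 0" for y
  proof
    define Q where "Q = \<i> * of_real (s y t0) * (of_real (2 * \<omega>) / D y)"
    assume "\<i> * of_real (s y t0) * (of_real (2 * \<omega>) / D y) \<in> \<real>\<^sub>\<le>\<^sub>0"
    then obtain r where r: "Q = of_real r" "r \<le> 0" unfolding Q_def[symmetric] by (auto elim: nonpos_Reals_cases)
    have "Q * D y = \<i> * of_real (2 * \<omega> * s y t0)" using D_nonzero[OF y] by (simp add: Q_def)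
    then have "r * Re (D y) = 0" "r * Im (D y) = 2 * \<omega> * s y t0" using r by (simp_all add: complex_eq_iff)
    then have ReD: "Re (D y) = 0" and ImD: "r * Im (D y) = 2 * \<omega> * s y t0" using n \<omega> by auto
    \<comment> \<open>On the cut \<open>D\<close> would be purely imaginary. The Wronskian then
      becomes \<open>- c' s = 1 + c^2\<close>, so \<open>s Im D > 0\<close>, while
      \<open>r (s Im D) = 2 \<omega> s^2 > 0\<close> contradicts that \<open>r\<close> is not
      positive.\<close>
    have "s' y = - c y t0" using ReD \<omega> by (simp add: Re_D)
    then have "s y t0 * Im (D y) = \<omega>\<^sup>2 * (s y t0)\<^sup>2 + (1 + (c y t0)\<^sup>2)"
      using wronskian[OF y] by (simp add: Im_D power2_eq_square algebra_simps)
    also have "\<dots> > 0" by (rule add_nonneg_pos[OF mult_nonneg_nonneg add_pos_nonneg]) simp_all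
    finally have "r * (s y t0 * Im (D y)) \<le> 0" using r(2) by (simp add: mult_nonpos_nonneg)
    moreover have "r * (s y t0 * Im (D y)) = 2 * \<omega> * (s y t0)\<^sup>2" using ImD by (simp add: power2_eq_square)
    moreover have "2 * \<omega> * (s y t0)\<^sup>2 > 0" using \<omega> n by simp
    ultimately show False by linarith
  qed
  show "s' t0 > 0" using s by (simp add: s'_def)
qed (use I t0 x nz s s_der overlap_square overlap_t0 in auto)

text \<open>The Cayley transform \<open>(\<omega> - 2 p) / (\<omega> + 2 p)\<close>. It vanishes
  when \<open>p\<close> is \<open>\<omega> / 2\<close>, the parameter of the ground state.\<close>

definition ratio :: "real \<Rightarrow> complex" where
  "ratio x = of_real (2 * \<omega>) * (z x / D x) - 1"

lemma l2_inner_hermite_psi_odd: "x \<in> I \<Longrightarrow> l2_inner (hermite_fn \<omega> (2 * n + 1)) (psi x) = 0"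
  unfolding psi_def[abs_def] l2_inner_cmult_right
  using l2_inner_hermite_gauss_odd[OF Re_p_pos \<omega>, of x n] by simp

lemma l2_inner_hermite_psi_even:
  assumes x: "x \<in> I"
  shows "l2_inner (hermite_fn \<omega> (2 * n)) (psi x)
    = of_real (sqrt (fact (2 * n)) / (2 ^ n * fact n)) * ratio x ^ n * overlap x"
proof -
  have e: "of_real (\<omega> / 2) + p x = (of_real \<omega> + 2 * p x) / 2" by simp
  have "of_real \<omega> / (of_real (\<omega> / 2) + p x) = of_real (2 * \<omega>) / (of_real \<omega> + 2 * p x)" unfolding e by simp
  also have "\<dots> = of_real (2 * \<omega>) * (z x / D x)"
    unfolding D_eq[OF x] using z_nonzero[OF x] by simp
  finally have r: "of_real \<omega> / (of_real (\<omega> / 2) + p x) - 1 = ratio x" by (simp add: ratio_def)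
  show ?thesis
    unfolding overlap_def psi_def[abs_def] l2_inner_cmult_right l2_inner_hermite_gauss_even[OF Re_p_pos[OF x] \<omega>, of n] r
    by (simp only: mult_ac)
qed

text \<open>Numerator \<open>\<omega> z + \<i> z'\<close> and denominator
  \<open>\<omega> z - \<i> z'\<close> differ in squared modulus by 4 \<omega> times the imaginary
  part of \<open>z'\<close> times the conjugate of \<open>z\<close>, which is the constant
  \<omega>.\<close>

lemma norm_ratio: 
  assumes x: "x \<in> I"
  shows "1 - (cmod (ratio x))\<^sup>2 = (2 * \<omega> / cmod (D x))\<^sup>2"
proof -
  define N where "N = of_real \<omega> * z x + \<i> * z' x"
  have r: "ratio x = N / D x" using D_nonzero[OF x] by (simp add: ratio_def N_def field_simps) (simp add: D_def)
  have "(cmod (D x))\<^sup>2 - (cmod N)\<^sup>2 = 4 * \<omega> * Im (z' x * cnj (z x))"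
    unfolding cmod_power2 by (simp add: D_def N_def power2_eq_square algebra_simps)
  also have "\<dots> = (2 * \<omega>)\<^sup>2" using Im_z'_cnj_z[OF x] by (simp add: power2_eq_square)
  finally have "(cmod (D x))\<^sup>2 - (cmod N)\<^sup>2 = (2 * \<omega>)\<^sup>2" .
  then have "(cmod N)\<^sup>2 = (cmod (D x))\<^sup>2 - (2 * \<omega>)\<^sup>2" by simp
  then show ?thesis
    unfolding r norm_divide power_divide using D_nonzero[OF x] by (simp add: diff_divide_distrib)
qed

lemma psi_expansion:
  assumes x: "x \<in> I"
  shows "(\<lambda>N. l2_norm (\<lambda>q. psi x q - (\<Sum>n<N. l2_inner (hermite_fn \<omega> (2 * n)) (psi x) * hermite_fn \<omega> (2 * n) q))) \<longlonglongrightarrow> 0"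
proof (rule l2_expansion_tendsto)
  show "sq_int (hermite_fn \<omega> (2 * n))" for n by (rule sq_int_hermite_fn[OF \<omega>])
  show "l2_inner (hermite_fn \<omega> (2 * m)) (hermite_fn \<omega> (2 * n)) = (if m = n then 1 else 0)" for m n
    using hermite_fn_orthonormal[OF \<omega>, of "2 * m" "2 * n"] by simp
  show "sq_int (psi x)" by (rule sq_int_psi[OF x])
  define R where "R = (cmod (ratio x))\<^sup>2"
  \<comment> \<open>This is the squared modulus of the overlap, and its square is
    \<open>1 - R\<close>. So the series sums to \<open>(1 - R)^(-1/2) = 1 / d\<close>, and the
    prefactor \<open>d\<close> brings the total to 1, the squared norm of the packet.\<close>
  define d where "d = 2 * \<omega> / cmod (D x)"
  have d: "d > 0" using \<omega> D_nonzero[OF x] by (simp add: d_def)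
  have R: "1 - R = d\<^sup>2" unfolding R_def d_def by (rule norm_ratio[OF x])
  moreover have "d\<^sup>2 > 0" using d by simp
  ultimately have "R < 1" by linarith
  then have "\<bar>- R\<bar> < 1" by (simp add: R_def)
  from gen_binomial_real[OF this, of "- 1 / 2"]
  have "(\<lambda>n. (- 1 / 2 gchoose n) * (- R) ^ n) sums (1 + - R) powr (- 1 / 2)" .
  moreover have "(- 1 / 2 gchoose n) * (- R) ^ n = (fact (2 * n) / (2 ^ n * fact n)\<^sup>2) * R ^ n" for n
    unfolding central_binomial_gbinomial[symmetric] power_minus[of R] by (simp only: mult_ac)
  moreover have "(1 + - R) powr (- 1 / 2) = 1 / d"
  proof -
    have "(1 + - R) powr (- 1 / 2) = (d powr 2) powr (- 1 / 2)" using R d by simp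
    also have "\<dots> = d powr (- 1)" unfolding powr_powr by simp
    finally show ?thesis using d by (simp add: powr_minus_divide)
  qed
  ultimately have "(\<lambda>n. (fact (2 * n) / (2 ^ n * fact n)\<^sup>2) * R ^ n) sums (1 / d)" by simp
  from sums_mult[OF this, of d] have "(\<lambda>n. d * ((fact (2 * n) / (2 ^ n * fact n)\<^sup>2) * R ^ n)) sums 1" using d by simp
  moreover have "(cmod (l2_inner (hermite_fn \<omega> (2 * n)) (psi x)))\<^sup>2 = d * ((fact (2 * n) / (2 ^ n * fact n)\<^sup>2) * R ^ n)" for n
  proof -
    have "(cmod (overlap x))\<^sup>2 = d"
      using arg_cong[OF overlap_square[OF x], of cmod] \<omega> by (simp add: norm_power norm_divide norm_mult d_def)
    moreover have "(sqrt (fact (2 * n)) / (2 ^ n * fact n))\<^sup>2 = fact (2 * n) / (2 ^ n * fact n)\<^sup>2"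
      by (simp add: power_divide)
    ultimately show ?thesis
      unfolding l2_inner_hermite_psi_even[OF x] norm_mult norm_of_real power_mult_distrib power2_abs norm_power R_def
      by (simp only: power_mult[symmetric] mult_ac)
  qed
  ultimately show "(\<lambda>n. (cmod (l2_inner (hermite_fn \<omega> (2 * n)) (psi x)))\<^sup>2) sums (l2_norm (psi x))\<^sup>2"
    using l2_norm_psi[OF x] by simp
qed

end

section \<open>The matrix \<Lambda> and the final assembly\<close>

lemma matrix_inv_2_22:
  fixes M :: "complex^2^2"
  assumes "det M \<noteq> 0"
  shows "matrix_inv M $ 2 $ 2 = M $ 1 $ 1 / det M"
proof -
  define B :: "complex^2^2" where "B = vector [vector [M$2$2 / det M, - M$1$2 / det M], vector [- M$2$1 / det M, M$1$1 / det M]]"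
  have d: "M$1$1 * M$2$2 = det M + M$1$2 * M$2$1" by (simp add: det_2)
  have "M ** B = mat 1"
    using assms
    by (simp add: vec_eq_iff forall_2 B_def matrix_matrix_mult_def sum_2 mat_def) (simp add: field_simps d)
  moreover have "B ** M = mat 1"
    using assms
    by (simp add: vec_eq_iff forall_2 B_def matrix_matrix_mult_def sum_2 mat_def) (simp add: field_simps d)
  ultimately have MB: "M ** B = mat 1 \<and> B ** M = mat 1" ..
  have "matrix_inv M = B"
    unfolding matrix_inv_def
  \<comment> \<open>\<open>matrix_inv\<close> is a choice term, so the explicit inverse must also be
    shown to be the only one.\<close>
  proof (rule some_equality)
    show "M ** B = mat 1 \<and> B ** M = mat 1" by (rule MB)
    show "A' = B" if "M ** A' = mat 1 \<and> A' ** M = mat 1" for A'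
      using that MB by (metis matrix_mul_assoc matrix_mul_lid matrix_mul_rid)
  qed
  then show ?thesis by (simp add: B_def)
qed

theorem theoremD2p3:
  fixes I :: "real set" and \<kappa> :: "real \<Rightarrow> real"
    and c s :: "real \<Rightarrow> real \<Rightarrow> real"
    and U :: "real \<Rightarrow> real \<Rightarrow> (real \<Rightarrow> complex) \<Rightarrow> (real \<Rightarrow> complex)"
    and \<omega> t t0 :: real
  assumes I_open: "open I" and I_interval: "is_interval I" and I_ne: "I \<noteq> {}"
    and \<kappa>_cont: "continuous_on I \<kappa>"
    and c_sol: "\<forall>t0\<in>I. lin_sol \<kappa> I (\<lambda>t. c t t0) \<and> c t0 t0 = 1 \<and> deriv (\<lambda>t. c t t0) t0 = 0"
    and s_sol: "\<forall>t0\<in>I. lin_sol \<kappa> I (\<lambda>t. s t t0) \<and> s t0 t0 = 0 \<and> deriv (\<lambda>t. s t t0) t0 = 1"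
    and U_evol: "is_evolution \<kappa> I U"
    and \<omega>_pos: "\<omega> > 0"
    and t_in: "t \<in> I" and t0_in: "t0 \<in> I"
    and s_nz: "s t t0 \<noteq> 0"
  shows "((\<lambda>N. l2_norm (\<lambda>q. U t t0 (hermite_fn \<omega> 0) q
              - (\<Sum>n<N. l2_inner (hermite_fn \<omega> (2*n)) (U t t0 (hermite_fn \<omega> 0))
                          * hermite_fn \<omega> (2*n) q))) \<longlonglongrightarrow> 0)
    \<and> (\<forall>n. l2_inner (hermite_fn \<omega> (2*n+1)) (U t t0 (hermite_fn \<omega> 0)) = 0)
    \<and> (\<forall>n::nat. n \<ge> 1 \<longrightarrow>
          l2_inner (hermite_fn \<omega> (2*n)) (U t t0 (hermite_fn \<omega> 0))
          = complex_of_real (sqrt (fact (2*n)) / (2 ^ n * fact n))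
            * (2 * complex_of_real \<omega> * (matrix_inv (Lam \<omega> c s t t0)) $ 2 $ 2 - 1) ^ n
            * l2_inner (hermite_fn \<omega> 0) (U t t0 (hermite_fn \<omega> 0)))
    \<and> l2_inner (hermite_fn \<omega> 0) (U t t0 (hermite_fn \<omega> 0))
        = csqrt (2 * complex_of_real \<omega> / det (Lam \<omega> c s t t0)) * cis (- pi / 4) * s_inv_sqrt s t t0
    \<and> invertible (Lam \<omega> c s t t0)
    \<and> (matrix_inv (Lam \<omega> c s t t0)) $ 2 $ 2
        = (complex_of_real (\<omega> * (s t t0)\<^sup>2) - \<i> * complex_of_real (s t t0 * c t t0))
          / (complex_of_real (1 + \<omega>\<^sup>2 * (s t t0)\<^sup>2 - c t t0 * c t0 t)
             - \<i> * complex_of_real (\<omega> * s t t0 * (c t t0 + c t0 t)))"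
proof -
  interpret po: parametric_oscillator I \<kappa> c s \<omega> t0
    using assms by unfold_locales auto
  let ?L = "Lam \<omega> c s t t0"
  let ?u = "U t t0 (hermite_fn \<omega> 0)"
  define S where "S = complex_of_real (s t t0)"
  have S0: "S \<noteq> 0" using s_nz by (simp add: S_def)
  \<comment> \<open>The Wronskian of \<open>c(., t)\<close> and \<open>s(., t0)\<close>, solutions
    with different base points, compared at \<open>t\<close> and at \<open>t0\<close>. It replaces
    the reversed entry \<open>c t0 t\<close> by the derivative of \<open>s(., t0)\<close>.\<close>
  have rev: "c t0 t = po.s' t"
  proof -
    have "c t t * deriv (\<lambda>x. s x t0) t - deriv (\<lambda>x. c x t) t * s t t0
        = c t0 t * deriv (\<lambda>x. s x t0) t0 - deriv (\<lambda>x. c x t) t0 * s t0 t0"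
      using c_sol s_sol t_in t0_in by (intro wronskian_constant[OF _ _ I_open I_interval]) auto
    then show ?thesis using c_sol s_sol t_in t0_in by (simp add: po.s'_def)
  qed
  have W: "c t t0 * po.s' t = 1 + po.c' t * s t t0" using po.wronskian[OF t_in] by simp
  have L11: "?L $ 1 $ 1 = of_real \<omega> - \<i> * c t t0 / S" by (simp add: Lam_def S_def)
  \<comment> \<open>The factor \<open>s^2\<close> clears the denominators; the final 1 is minus the
    product of the off-diagonal entries \<open>\<i> / s\<close>.\<close>
  have detS: "det ?L * S\<^sup>2 = (of_real \<omega> * S - \<i> * c t t0) * (of_real \<omega> * S - \<i> * po.s' t) + 1"
    using S0 by (simp add: det_2 Lam_def rev S_def[symmetric] power2_eq_square field_simps)
  also have "\<dots> = - \<i> * S * po.D t"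
  proof -
    have "complex_of_real (c t t0) * complex_of_real (po.s' t) = 1 + complex_of_real (po.c' t) * S"
      using arg_cong[OF W, of complex_of_real] by (simp add: S_def)
    then show ?thesis
      by (simp add: po.D_def po.z_def po.z'_def S_def algebra_simps)
  qed
  finally have "det ?L * S\<^sup>2 = - \<i> * S * po.D t" .
  then have "(det ?L * S) * S = (- \<i> * po.D t) * S" by (simp add: power2_eq_square mult_ac)
  then have "det ?L * S = - \<i> * po.D t" using S0 mult_right_cancel by blast
  then have det: "det ?L = - \<i> * po.D t / S" using S0 by (simp add: field_simps)
  have det0: "det ?L \<noteq> 0" unfolding det using S0 po.D_nonzero[OF t_in] by simp
  have inv22: "matrix_inv ?L $ 2 $ 2 = po.z t / po.D t"
  proof -
    have "matrix_inv ?L $ 2 $ 2 = (of_real \<omega> - \<i> * c t t0 / S) / (- \<i> * po.D t / S)"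
      using matrix_inv_2_22[OF det0] unfolding L11 det .
    also have "\<dots> = (of_real \<omega> * S - \<i> * c t t0) / (- \<i> * po.D t)"
      using S0 by (simp add: divide_simps)
    also have "of_real \<omega> * S - \<i> * c t t0 = - \<i> * po.z t"
      by (simp add: po.z_def S_def algebra_simps)
    also have "- \<i> * po.z t / (- \<i> * po.D t) = po.z t / po.D t" by simp
    finally show ?thesis .
  qed
  have r: "2 * complex_of_real \<omega> * (matrix_inv ?L $ 2 $ 2) - 1 = po.ratio t"
    unfolding inv22 by (simp add: po.ratio_def)
  note u = po.evolution_eq_psi[OF U_evol t_in]
  have inner: "l2_inner (hermite_fn \<omega> n) ?u = l2_inner (hermite_fn \<omega> n) (po.psi t)" for n
    by (rule l2_inner_cong_AE[OF u(1) po.sq_int_psi[OF t_in] sq_int_hermite_fn[OF \<omega>_pos] u(2)])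
  have ov: "l2_inner (hermite_fn \<omega> 0) (po.psi t) = po.overlap t" by (simp add: po.overlap_def)
  show ?thesis
  proof (intro conjI allI impI)
    show "(\<lambda>N. l2_norm (\<lambda>q. ?u q - (\<Sum>n<N. l2_inner (hermite_fn \<omega> (2*n)) ?u * hermite_fn \<omega> (2*n) q))) \<longlonglongrightarrow> 0"
    proof -
      have "l2_norm (\<lambda>q. ?u q - (\<Sum>n<N. l2_inner (hermite_fn \<omega> (2*n)) (po.psi t) * hermite_fn \<omega> (2*n) q))
          = l2_norm (\<lambda>q. po.psi t q - (\<Sum>n<N. l2_inner (hermite_fn \<omega> (2*n)) (po.psi t) * hermite_fn \<omega> (2*n) q))" for N
      proof (rule l2_norm_cong_AE)
        show "AE q in lborel. ?u q - (\<Sum>n<N. l2_inner (hermite_fn \<omega> (2*n)) (po.psi t) * hermite_fn \<omega> (2*n) q)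
           = po.psi t q - (\<Sum>n<N. l2_inner (hermite_fn \<omega> (2*n)) (po.psi t) * hermite_fn \<omega> (2*n) q)"
          using u(2) by eventually_elim simp
      qed (intro sq_int_diff sq_int_sum sq_int_cmult u(1) po.sq_int_psi t_in sq_int_hermite_fn \<omega>_pos)+
      then show ?thesis unfolding inner using po.psi_expansion[OF t_in] by simp
    qed
    show "l2_inner (hermite_fn \<omega> (2*n+1)) ?u = 0" for n
      unfolding inner by (rule po.l2_inner_hermite_psi_odd[OF t_in])
    show "l2_inner (hermite_fn \<omega> (2*n)) ?u = complex_of_real (sqrt (fact (2*n)) / (2 ^ n * fact n))
            * (2 * complex_of_real \<omega> * (matrix_inv ?L) $ 2 $ 2 - 1) ^ n * l2_inner (hermite_fn \<omega> 0) ?u" for n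
      unfolding inner r ov by (rule po.l2_inner_hermite_psi_even[OF t_in])
    have "2 * complex_of_real \<omega> / det ?L = \<i> * S * (of_real (2 * \<omega>) / po.D t)"
      unfolding det using S0 po.D_nonzero[OF t_in] by (simp add: field_simps)
    then show "l2_inner (hermite_fn \<omega> 0) ?u = csqrt (2 * complex_of_real \<omega> / det ?L) * cis (- pi / 4) * s_inv_sqrt s t t0"
      unfolding inner ov using po.overlap_eq_index_branch[OF t_in s_nz] by (simp add: S_def)
    show "invertible ?L" using det0 by (simp add: invertible_det_nz)
    \<comment> \<open>The stated fraction is the cofactor quotient with numerator and denominator
      both multiplied by \<open>s^2\<close>.\<close>
    have "complex_of_real (\<omega> * (s t t0)\<^sup>2) - \<i> * complex_of_real (s t t0 * c t t0) = (?L $ 1 $ 1) * S\<^sup>2"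
      unfolding L11 using S0 by (simp add: S_def[symmetric] power2_eq_square algebra_simps)
    moreover have "complex_of_real (1 + \<omega>\<^sup>2 * (s t t0)\<^sup>2 - c t t0 * c t0 t) - \<i> * complex_of_real (\<omega> * s t t0 * (c t t0 + c t0 t))
       = det ?L * S\<^sup>2"
      unfolding detS rev by (simp add: S_def[symmetric] power2_eq_square algebra_simps)
    ultimately show "(matrix_inv ?L) $ 2 $ 2
        = (complex_of_real (\<omega> * (s t t0)\<^sup>2) - \<i> * complex_of_real (s t t0 * c t t0))
          / (complex_of_real (1 + \<omega>\<^sup>2 * (s t t0)\<^sup>2 - c t t0 * c t0 t)
             - \<i> * complex_of_real (\<omega> * s t t0 * (c t t0 + c t0 t)))"
      using S0 matrix_inv_2_22[OF det0] by simp
  qed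
qed

end
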